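(* Let $D$ be an unoriented knotted $4$-valent graph in $\mathbb{R}^2$. Let $P(D)(q,a)$ be its Kauffman-Vogel polynomial and let $R(\cdot)(q,a)$ be the Murakami-Ohtsuki-Yamada polynomial of oriented knotted $4$-valent graphs. Then $$P(D)(q,a^2q^{-1}) = \sum_{\varrho \in \mathcal{O}(D)} \ \sum_{\varsigma \in \Sigma(D_\varrho)} (a^{-1}q)^{\mathrm{rot}(D_{\varrho,\varsigma})}\, [D_\varrho,\varsigma]\, R(D_{\varrho,\varsigma})(q,a).$$ Consequently, for every integer $N\geq 1$, writing $P_{2N}(D)(q)=P(D)(q,q^{2N-1})$ and $R_N(D')(q)=R(D')(q,q^N)$, $$P_{2N}(D)(q) = \sum_{\varrho \in \mathcal{O}(D)}\ \sum_{\varsigma \in \Sigma(D_\varrho)} q^{-(N-1)\mathrm{rot}(D_{\varrho,\varsigma})}\, [D_\varrho,\varsigma]\, R_N(D_{\varrho,\varsigma})(q).$$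
   Context: **Knotted 4-valent graphs.** A knotted $4$-valent graph is an immersion of an abstract $4$-valent graph (vertexless circles allowed) into $\mathbb{R}^2$ whose only singularities are finitely many transversal double points away from the vertices, each made into a crossing by specifying an upper and a lower branch. It is oriented if the underlying graph is oriented so that at every vertex each pair of opposite edges consists of one incoming and one outgoing edge (as if two oriented strands cross transversally at the vertex). It is unoriented if no orientation is given. **Local pictures.** In a small disk with boundary points SW, SE, NW, NE let: $X_+$ be the crossing of the strands SW–NE and SE–NW with SW–NE on top; $X_-$ the same with SE–NW on top; $V$ the two disjoint arcs SW–NW and SE–NE; $H$ the two disjoint arcs SW–SE and NW–NE; $X_\bullet$ a $4$-valent vertex. **Kauffman-Vogel polynomial.** $P(D)(q,a)$ is the invariant of unoriented knotted $4$-valent graphs under regular rigid vertex isotopy (no Reidemeister I move) determined by: $P(\text{crossingless circle})=\frac{a-a^{-1}}{q-q^{-1}}+1$; $P(X_+)-P(X_-)=(q-q^{-1})(P(V)-P(H))$; removing a positive kink (a Reidemeister I curl whose crossing is positive for either orientation of the strand) multiplies by $a$, i.e. $P(\text{positive kink})=a\,P(\text{straight arc})$; and $P(X_\bullet)=-P(X_+)+qP(V)+q^{-1}P(H)=-P(X_-)+q^{-1}P(V)+qP(H)$. **MOY polynomial (uncolored).** $R(D)(q,a)$ is the invariant of oriented knotted $4$-valent graphs under regular rigid vertex isotopy determined by the following, where in $X_\pm, V, X_\bullet$ all strands are oriented upward (from SW, SE to NW, NE), so that $X_+$ is a positive crossing: $R(\text{crossingless circle})=\frac{a-a^{-1}}{q-q^{-1}}$;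 $R(X_+)-R(X_-)=(q-q^{-1})R(V)$; $R(\text{positive kink})=a\,R(\text{straight arc})$; $R(X_\bullet)=-R(X_+)+qR(V)=-R(X_-)+q^{-1}R(V)$. **Edge orientations.** An edge of $D$ is a segment of $D$ between two adjacent vertices or crossings (a component without vertices or crossings is also an edge). A balanced edge orientation of $D$ is an orientation of every edge of $D$ such that at each crossing and at each vertex two edges point inward and two point outward. $D_\varrho$ denotes $D$ equipped with the balanced edge orientation $\varrho$. At a crossing, either each of the two strands is consistently oriented through the crossing (a positive or negative crossing), or both edges of the upper branch point outward and both edges of the lower branch point inward ("top outward"), or both edges of the upper branch point inward and both edges of the lower branch point outward ("top inward"). At a vertex, either each pair of opposite edges has one inward and one outward edge ("crossing-like"), or one pair of opposite edges both point inward and the other pair both point outward ("non-crossing-like"). $\varrho$ is admissible if $D_\varrho$ has no top inward crossing. $\mathcal{O}(D)$ is the set of admissible balanced edge orientations. **Resolutions.** At a top outward crossing or a non-crossing-like vertex there are two smoothings compatible with the edge orientations: in one, each incoming edge is joined to the outgoing edge on its right (each incoming strand turns right), and in the other each incoming edge is joined to the outgoing edge on its left (each incoming strand turns left). At a top outward crossing the right-turning smoothing is called $A$ and the left-turning one is called $B$ (so if the upper branch is SW–NE, $A$ is $V$ and $B$ is $H$). At a non-crossing-like vertex the left-turning smoothing is called $L$ and the right-turning one $R$. A resolution $\varsigma$ of $D_\varrho$ is a choice of $A$ or $B$ at every top outward crossing and of $L$ or $R$ at every non-crossing-like vertex. $\Sigma(D_\varrho)$ is the set of resolutions of $D_\varrho$,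 and $D_{\varrho,\varsigma}$ is the oriented knotted $4$-valent graph obtained by applying $\varsigma$ to $D_\varrho$. **Weights.** The local weight of $\varsigma$ at a top outward crossing is $q-q^{-1}$ for $A$ and $-(q-q^{-1})$ for $B$; at a non-crossing-like vertex it is $q$ for $L$ and $q^{-1}$ for $R$. $[D_\varrho,\varsigma]$ is the product of the local weights over all top outward crossings and all non-crossing-like vertices of $D_\varrho$. **Rotation number.** $\mathrm{rot}(D_{\varrho,\varsigma})$ is the rotation number (Whitney index) of $D_{\varrho,\varsigma}$ viewed as a collection of oriented immersed closed curves in $\mathbb{R}^2$ (crossings and vertices being treated as transversal double points), a counterclockwise embedded circle having rotation number $+1$. *)

theory Defs
  imports Complex_Main
begin

section \<open>Diagrams\<close>

text \<open>
  A knotted 4-valent graph in the plane, up to planar isotopy, is represented in Morse position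
  (generic with respect to the height function), that is, as the list of its elementary
  horizontal slices, read from bottom to top.  Every slice \<open>(i, e)\<close> contains one
  elementary piece \<open>e\<close>, with exactly \<open>i\<close> vertical strands to its left and any
  number of vertical strands to its right:
  \<open>Cup\<close> is a local minimum (two ends at the top),
  \<open>Cap\<close> is a local maximum (two ends at the bottom),
  and \<open>Node\<close> has the four ends SW, SE, NW, NE.
  In the crossing \<open>XPlus\<close> the branch SW--NE is on top, in \<open>XMinus\<close> the
  branch SE--NW is on top, and \<open>XVert\<close> is a 4-valent vertex.  Opposite edges at a vertex
  are SW, NE and SE, NW.  Since planar isotopy can turn crossings and vertices and can
  separate the heights of all these pieces, every diagram has such a presentation; the planar
  isotopies between presentations are among the moves below.
\<close>

datatype node = XPlus | XMinus | XVert

datatype elem = Cup | Cap | Node node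

type_synonym diagram = "(nat \<times> elem) list"

fun bot_width :: "elem \<Rightarrow> nat" where
  "bot_width Cup = 0"
| "bot_width Cap = 2"
| "bot_width (Node k) = 2"

fun top_width :: "elem \<Rightarrow> nat" where
  "top_width Cup = 2"
| "top_width Cap = 0"
| "top_width (Node k) = 2"

fun tangle :: "nat \<Rightarrow> diagram \<Rightarrow> nat \<Rightarrow> bool" where
  "tangle m [] n \<longleftrightarrow> m = n"
| "tangle m ((i, e) # D) n \<longleftrightarrow>
     i + bot_width e \<le> m \<and> tangle (m - bot_width e + top_width e) D n"

definition knotted_graph :: "diagram \<Rightarrow> bool" where
  "knotted_graph D \<longleftrightarrow> tangle 0 D 0"


section \<open>Regular rigid vertex isotopy\<close>

fun switch :: "node \<Rightarrow> node" where
  "switch XPlus = XMinus"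
| "switch XMinus = XPlus"
| "switch XVert = XVert"

text \<open>
  The rules up to \<open>cap_slide\<close> are the planar isotopies of diagrams in Morse position: exchange of
  the heights of two pieces lying beside each other, cancellation of a minimum against a maximum,
  and moving a local extremum across a strand through a node.  In \<open>cup_slide\<close> and
  \<open>cap_slide\<close> the node turns by a right angle, which exchanges the two kinds of crossing.
  The remaining ones are the Reidemeister move II, the passage of a strand over or under a crossing
  (Reidemeister III) or a vertex, and the rigid rotation of a vertex by half a turn about the
  vertical axis.  The Reidemeister II and III moves with other relative positions or other
  over/under patterns are compositions of these.
\<close>

inductive local_move :: "diagram \<Rightarrow> diagram \<Rightarrow> bool" where
  height_exchange:
    "local_move [(i, d), (i + top_width d + k, e)] [(i + bot_width d + k, e), (i, d)]"
| zigzag_left: "local_move [(i, Cup), (i + 1, Cap)] []"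
| zigzag_right: "local_move [(i + 1, Cup), (i, Cap)] []"
| cup_slide:
    "local_move [(i, Cup), (i + 1, Node x)] [(i + 1, Cup), (i, Node (switch x))]"
| cap_slide:
    "local_move [(i + 1, Node x), (i, Cap)] [(i, Node (switch x)), (i + 1, Cap)]"
| reidemeister2:
    "x \<noteq> XVert \<Longrightarrow> local_move [(i, Node x), (i, Node (switch x))] []"
| strand_slide:
    "x \<noteq> XVert \<Longrightarrow>
     local_move [(i, Node y), (i + 1, Node x), (i, Node x)]
                [(i + 1, Node x), (i, Node x), (i + 1, Node y)]"
| vertex_flip:
    "x \<noteq> XVert \<Longrightarrow>
     local_move [(i, Node x), (i, Node XVert)] [(i, Node XVert), (i, Node x)]"

definition isotopy_step :: "diagram \<Rightarrow> diagram \<Rightarrow> bool" where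
  "isotopy_step D D' \<longleftrightarrow> knotted_graph D \<and> knotted_graph D' \<and>
     (\<exists>u v s t. D = u @ s @ v \<and> D' = u @ t @ v \<and> local_move s t)"

definition isotopic :: "diagram \<Rightarrow> diagram \<Rightarrow> bool" where
  "isotopic = (\<lambda>D D'. isotopy_step D D' \<or> isotopy_step D' D)\<^sup>*\<^sup>*"


section \<open>Edge orientations\<close>

text \<open>
  A balanced edge orientation is recorded by giving the direction (up or down) of the strand at
  every end of every piece.  The directions at an extremum are
  determined by that of its left leg.  The directions at a node are listed in the order SW, SE,
  NW, NE.  Orienting the ends so that they match along all vertical strands is the same thing
  as orienting every edge.
\<close>

datatype dir = Up | Down

fun opp :: "dir \<Rightarrow> dir" where
  "opp Up = Down"
| "opp Down = Up"

datatype oelem = OCup dir | OCap dir | ONode node dir dir dir dir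

type_synonym odiagram = "(nat \<times> oelem) list"

fun forget :: "oelem \<Rightarrow> elem" where
  "forget (OCup d) = Cup"
| "forget (OCap d) = Cap"
| "forget (ONode x sw se nw ne) = Node x"

definition underlying :: "odiagram \<Rightarrow> diagram" where
  "underlying E = map (map_prod id forget) E"

fun bot_dirs :: "oelem \<Rightarrow> dir list" where
  "bot_dirs (OCup d) = []"
| "bot_dirs (OCap d) = [d, opp d]"
| "bot_dirs (ONode x sw se nw ne) = [sw, se]"

fun top_dirs :: "oelem \<Rightarrow> dir list" where
  "top_dirs (OCup d) = [d, opp d]"
| "top_dirs (OCap d) = []"
| "top_dirs (ONode x sw se nw ne) = [nw, ne]"

text \<open>For each end, in the order SW, SE, NW, NE, whether its edge points into the node.\<close>

fun inward :: "oelem \<Rightarrow> bool list" where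
  "inward (ONode x sw se nw ne) = [sw = Up, se = Up, nw = Down, ne = Down]"
| "inward _ = []"

fun balanced :: "oelem \<Rightarrow> bool" where
  "balanced (ONode x sw se nw ne) \<longleftrightarrow>
     count_list (inward (ONode x sw se nw ne)) True = 2"
| "balanced _ \<longleftrightarrow> True"

fun otangle :: "dir list \<Rightarrow> odiagram \<Rightarrow> dir list \<Rightarrow> bool" where
  "otangle ds [] es \<longleftrightarrow> ds = es"
| "otangle ds ((i, e) # E) es \<longleftrightarrow> balanced e \<and>
     (\<exists>l r. length l = i \<and> ds = l @ bot_dirs e @ r \<and> otangle (l @ top_dirs e @ r) E es)"

definition balanced_orientation :: "diagram \<Rightarrow> odiagram \<Rightarrow> bool" where
  "balanced_orientation D E \<longleftrightarrow> otangle [] E [] \<and> underlying E = D"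

fun crossing_like :: "oelem \<Rightarrow> bool" where
  "crossing_like (ONode x sw se nw ne) \<longleftrightarrow> sw = ne \<and> se = nw"
| "crossing_like _ \<longleftrightarrow> True"

fun top_outward :: "oelem \<Rightarrow> bool" where
  "top_outward (ONode XPlus sw se nw ne) \<longleftrightarrow>
     inward (ONode XPlus sw se nw ne) = [False, True, True, False]"
| "top_outward (ONode XMinus sw se nw ne) \<longleftrightarrow>
     inward (ONode XMinus sw se nw ne) = [True, False, False, True]"
| "top_outward _ \<longleftrightarrow> False"

fun top_inward :: "oelem \<Rightarrow> bool" where
  "top_inward (ONode XPlus sw se nw ne) \<longleftrightarrow>
     inward (ONode XPlus sw se nw ne) = [True, False, False, True]"
| "top_inward (ONode XMinus sw se nw ne) \<longleftrightarrow>
     inward (ONode XMinus sw se nw ne) = [False, True, True, False]"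
| "top_inward _ \<longleftrightarrow> False"

fun non_crossing_like_vertex :: "oelem \<Rightarrow> bool" where
  "non_crossing_like_vertex (ONode XVert sw se nw ne) \<longleftrightarrow>
     inward (ONode XVert sw se nw ne) \<in> {[True, False, False, True], [False, True, True, False]}"
| "non_crossing_like_vertex _ \<longleftrightarrow> False"

definition admissible_orientations :: "diagram \<Rightarrow> odiagram set"  (\<open>\<O>\<close>) where
  "\<O> D = {E. balanced_orientation D E \<and> (\<forall>(i, e)\<in>set E. \<not> top_inward e)}"


section \<open>Oriented knotted graphs and their isotopy\<close>

definition oriented_knotted_graph :: "odiagram \<Rightarrow> bool" where
  "oriented_knotted_graph E \<longleftrightarrow> otangle [] E [] \<and> (\<forall>(i, e)\<in>set E. crossing_like e)"

text \<open>
  An oriented move is an unoriented one that respects the orientation.  As the two sides agree outside the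
  moved part and every strand runs through its nodes consistently, the orientation of one
  side determines that of the other.
\<close>

definition oriented_isotopy_step :: "odiagram \<Rightarrow> odiagram \<Rightarrow> bool" where
  "oriented_isotopy_step E E' \<longleftrightarrow> oriented_knotted_graph E \<and> oriented_knotted_graph E' \<and>
     (\<exists>u v s t. E = u @ s @ v \<and> E' = u @ t @ v \<and> local_move (underlying s) (underlying t))"

definition oriented_isotopic :: "odiagram \<Rightarrow> odiagram \<Rightarrow> bool" where
  "oriented_isotopic = (\<lambda>E E'. oriented_isotopy_step E E' \<or> oriented_isotopy_step E' E)\<^sup>*\<^sup>*"


section \<open>The two polynomials\<close>

text \<open>
  The invariants are rational functions in \<open>q\<close> and \<open>a\<close> whose denominators are products of
  \<open>q\<close>, \<open>a\<close> and \<open>q - inverse q\<close>.  They are treated as functions on the points \<open>(q, a)\<close>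
  over an arbitrary field at which these are invertible; the field may itself be a field of
  rational functions with \<open>q\<close> and \<open>a\<close> as indeterminates.
\<close>

definition generic :: "'k::field \<Rightarrow> 'k \<Rightarrow> bool" where
  "generic q a \<longleftrightarrow> q \<noteq> 0 \<and> a \<noteq> 0 \<and> q - inverse q \<noteq> 0"

text \<open>
  In both definitions the two kinks are a strand with a curl on its right and one with a curl on its left.
  The smoothing \<open>V\<close> is the removal of the node and \<open>H\<close> is a maximum followed by a minimum.  The value
  on the empty diagram is the usual normalization; the other relations leave it open.
\<close>

definition kauffman_vogel :: "(diagram \<Rightarrow> 'k::field \<Rightarrow> 'k \<Rightarrow> 'k) \<Rightarrow> bool" where
  "kauffman_vogel P \<longleftrightarrow> (\<forall>q a. generic q a \<longrightarrow>
     (\<forall>D D'. isotopic D D' \<longrightarrow> P D q a = P D' q a) \<and>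
     P [] q a = 1 \<and>
     P [(0, Cup), (0, Cap)] q a = (a - inverse a) / (q - inverse q) + 1 \<and>
     (\<forall>u i v. knotted_graph (u @ [(i, Node XPlus)] @ v) \<longrightarrow>
        P (u @ [(i, Node XPlus)] @ v) q a - P (u @ [(i, Node XMinus)] @ v) q a
          = (q - inverse q) * (P (u @ v) q a - P (u @ [(i, Cap), (i, Cup)] @ v) q a)) \<and>
     (\<forall>u i v. knotted_graph (u @ [(i + 1, Cup), (i, Node XPlus), (i + 1, Cap)] @ v) \<longrightarrow>
        P (u @ [(i + 1, Cup), (i, Node XPlus), (i + 1, Cap)] @ v) q a = a * P (u @ v) q a) \<and>
     (\<forall>u i v. knotted_graph (u @ [(i, Cup), (i + 1, Node XPlus), (i, Cap)] @ v) \<longrightarrow>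
        P (u @ [(i, Cup), (i + 1, Node XPlus), (i, Cap)] @ v) q a = a * P (u @ v) q a) \<and>
     (\<forall>u i v. knotted_graph (u @ [(i, Node XVert)] @ v) \<longrightarrow>
        P (u @ [(i, Node XVert)] @ v) q a
          = - P (u @ [(i, Node XPlus)] @ v) q a + q * P (u @ v) q a
            + inverse q * P (u @ [(i, Cap), (i, Cup)] @ v) q a \<and>
        P (u @ [(i, Node XVert)] @ v) q a
          = - P (u @ [(i, Node XMinus)] @ v) q a + inverse q * P (u @ v) q a
            + q * P (u @ [(i, Cap), (i, Cup)] @ v) q a))"

definition moy :: "(odiagram \<Rightarrow> 'k::field \<Rightarrow> 'k \<Rightarrow> 'k) \<Rightarrow> bool" where
  "moy R \<longleftrightarrow> (\<forall>q a. generic q a \<longrightarrow>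
     (\<forall>E E'. oriented_isotopic E E' \<longrightarrow> R E q a = R E' q a) \<and>
     R [] q a = 1 \<and>
     (\<forall>d. R [(0, OCup d), (0, OCap d)] q a = (a - inverse a) / (q - inverse q)) \<and>
     (\<forall>u i v. oriented_knotted_graph (u @ [(i, ONode XPlus Up Up Up Up)] @ v) \<longrightarrow>
        R (u @ [(i, ONode XPlus Up Up Up Up)] @ v) q a
          - R (u @ [(i, ONode XMinus Up Up Up Up)] @ v) q a
          = (q - inverse q) * R (u @ v) q a) \<and>
     (\<forall>u i d v.
        oriented_knotted_graph
          (u @ [(i + 1, OCup d), (i, ONode XPlus d d d d), (i + 1, OCap d)] @ v) \<longrightarrow>
        R (u @ [(i + 1, OCup d), (i, ONode XPlus d d d d), (i + 1, OCap d)] @ v) q a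
          = a * R (u @ v) q a) \<and>
     (\<forall>u i d v.
        oriented_knotted_graph
          (u @ [(i, OCup (opp d)), (i + 1, ONode XPlus d d d d), (i, OCap (opp d))] @ v) \<longrightarrow>
        R (u @ [(i, OCup (opp d)), (i + 1, ONode XPlus d d d d), (i, OCap (opp d))] @ v) q a
          = a * R (u @ v) q a) \<and>
     (\<forall>u i v. oriented_knotted_graph (u @ [(i, ONode XVert Up Up Up Up)] @ v) \<longrightarrow>
        R (u @ [(i, ONode XVert Up Up Up Up)] @ v) q a
          = - R (u @ [(i, ONode XPlus Up Up Up Up)] @ v) q a + q * R (u @ v) q a \<and>
        R (u @ [(i, ONode XVert Up Up Up Up)] @ v) q a
          = - R (u @ [(i, ONode XMinus Up Up Up Up)] @ v) q a + inverse q * R (u @ v) q a))"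


section \<open>Resolutions, weights and rotation number\<close>

datatype res = ResA | ResB | ResL | ResR | NoRes

fun choices :: "oelem \<Rightarrow> res set" where
  "choices e = (if top_outward e then {ResA, ResB}
                else if non_crossing_like_vertex e then {ResL, ResR}
                else {NoRes})"

text \<open>A resolution is the list of the choices made at the successive pieces.\<close>

definition resolutions :: "odiagram \<Rightarrow> res list set"  (\<open>\<Sigma>\<^sub>r\<close>) where
  "\<Sigma>\<^sub>r E = listset (map (\<lambda>(i, e). choices e) E)"

text \<open>
  \<open>smooth_V\<close> joins SW--NW and SE--NE; \<open>smooth_H\<close> joins SW--SE and NW--NE.  If SW
  (hence NE) points into the node, then the edge coming in at SW has SE on its right and NW on
  its left, so turning right is \<open>smooth_H\<close>.  If SW and NE point outward, the edge coming in at
  SE has NE on its right and SW on its left, so turning right is \<open>smooth_V\<close>.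
\<close>

fun smooth_V :: "nat \<times> oelem \<Rightarrow> odiagram" where
  "smooth_V _ = []"

fun smooth_H :: "nat \<times> oelem \<Rightarrow> odiagram" where
  "smooth_H (i, ONode x sw se nw ne) = [(i, OCap sw), (i, OCup nw)]"
| "smooth_H (i, e) = [(i, e)]"

fun turn_right :: "nat \<times> oelem \<Rightarrow> odiagram" where
  "turn_right (i, e) = (if hd (inward e) then smooth_H (i, e) else smooth_V (i, e))"

fun turn_left :: "nat \<times> oelem \<Rightarrow> odiagram" where
  "turn_left (i, e) = (if hd (inward e) then smooth_V (i, e) else smooth_H (i, e))"

fun resolve_at :: "nat \<times> oelem \<Rightarrow> res \<Rightarrow> odiagram" where
  "resolve_at p ResA = turn_right p"
| "resolve_at p ResB = turn_left p"
| "resolve_at p ResL = turn_left p"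
| "resolve_at p ResR = turn_right p"
| "resolve_at p NoRes = [p]"

definition resolve :: "odiagram \<Rightarrow> res list \<Rightarrow> odiagram" where
  "resolve E \<sigma> = concat (map2 resolve_at E \<sigma>)"

fun local_weight :: "'k::field \<Rightarrow> res \<Rightarrow> 'k" where
  "local_weight q ResA = q - inverse q"
| "local_weight q ResB = - (q - inverse q)"
| "local_weight q ResL = q"
| "local_weight q ResR = inverse q"
| "local_weight q NoRes = 1"

text \<open>The factor 1 at the pieces without a choice is there only to make the product range over all pieces.\<close>

definition weight :: "'k::field \<Rightarrow> res list \<Rightarrow> 'k" where
  "weight q \<sigma> = (\<Prod>r\<leftarrow>\<sigma>. local_weight q r)"

text \<open>
  With all ends of the pieces vertical, the tangent vector makes half a turn along each
  extremum, counterclockwise if the left leg points down and clockwise if it points up.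
  Along a branch of a crossing or vertex its total turning is zero.  For a closed diagram the
  number of half turns is even.
\<close>

fun half_turns :: "oelem \<Rightarrow> int" where
  "half_turns (OCup d) = (if d = Down then 1 else - 1)"
| "half_turns (OCap d) = (if d = Down then 1 else - 1)"
| "half_turns (ONode x sw se nw ne) = 0"

definition rot :: "odiagram \<Rightarrow> int" where
  "rot E = (\<Sum>(i, e)\<leftarrow>E. half_turns e) div 2"

end

theory Submission
  imports Defs
begin

text \<open>
  The polynomial $P$ is determined by its defining relations.  The vertex relation removes the
  vertices.  Modulo diagrams with fewer crossings the crossings may be switched at will, so that a
  diagram may be replaced by its projection.  Pull the first maximum of the projection down through
  the minima and crossings below it.  On its way it turns into a maximum that crosses several strands
  transversally, and every piece that it meets is either passed, or absorbed, or cancels against it,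
  or produces a bigon, a kink or a circle.  So the number of crossings or the number of maxima drops.

  It remains to see that the state sum satisfies the relations of $P$ at $(q, a^2q^{-1})$ for diagrams
  without vertices, and the vertex relation.  The function $G(E) = (a^{-1}q)^{\mathrm{rot}(E)} R(E)$ is again
  an isotopy invariant with the skein relation of $R$, while its kink factors are $a^2q^{-1}$ and $q$,
  depending on the sense of rotation of the kink.  For each orientation of the ends of the pieces involved, every
  relation for the state sum is then a linear combination of relations for $G$.  For the third
  Reidemeister move only the ends $\downarrow\uparrow\uparrow$ and $\downarrow\downarrow\uparrow$ need more than
  isotopy; there the terms cancel because the factors $q$ and $q^{-1}$ of a positive and a negative kink
  differ by $q - q^{-1}$.
\<close>

section \<open>Diagrams without vertices\<close>

text \<open>The argument a^2/q is forced. A curl changes the rotation number by -1 or 1, so its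
  factor a becomes a (q/a)^(-1) = a^2/q or a (q/a) = q, and the two orientations of a circle add up
  to (a/q + q/a)(a - 1/a)/(q - 1/q), which is the circle value of \<open>P\<close> at A = a^2/q. The
  obstacle is that invariants are given on closed diagrams only, whereas the relations to be checked
  are local and the states of the pieces above and below depend on the directions of the ends. A
  local relation is therefore proved for every linear functional on oriented pieces with fixed ends
  that kills all combinations vanishing in every closed diagram. With one state below and the
  unaffected strands beside the piece fixed, summation over the states above gives such a
  functional, one for each list of ends at the top. Each relation thus becomes a finite computation
  for each list of directions at the bottom. Uniqueness is stated as agreement of two functions that
  satisfy the same relations; \<open>P\<close> and \<open>R\<close> themselves are given.\<close>

lemma tangle_append: "tangle m (D @ D') n \<longleftrightarrow> (\<exists>k. tangle m D k \<and> tangle k D' n)"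
  by (induction m D n rule: tangle.induct) auto

fun is_node :: "elem \<Rightarrow> bool" where
  "is_node (Node x) = True"
| "is_node _ = False"

definition nodes :: "diagram \<Rightarrow> nat" where
  "nodes D = length (filter (is_node \<circ> snd) D)"

definition caps :: "diagram \<Rightarrow> nat" where
  "caps D = length (filter (\<lambda>p. snd p = Cap) D)"

definition vertex_free :: "diagram \<Rightarrow> bool" where
  "vertex_free D \<longleftrightarrow> (\<forall>p\<in>set D. snd p \<noteq> Node XVert)"

lemma nodes_simps [simp]:
  "nodes [] = 0" "nodes (p # D) = (if is_node (snd p) then 1 else 0) + nodes D"
  "nodes (D @ D') = nodes D + nodes D'"
  by (auto simp: nodes_def)

lemma caps_simps [simp]:
  "caps [] = 0" "caps (p # D) = (if snd p = Cap then 1 else 0) + caps D"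
  "caps (D @ D') = caps D + caps D'"
  by (auto simp: caps_def)

lemma vertex_free_simps [simp]:
  "vertex_free []" "vertex_free (p # D) \<longleftrightarrow> snd p \<noteq> Node XVert \<and> vertex_free D"
  "vertex_free (D @ D') \<longleftrightarrow> vertex_free D \<and> vertex_free D'"
  by (auto simp: vertex_free_def)

text \<open>One version of each move that the uniqueness argument uses: only one order of the bigon,
  and only the braid relation among the strand slides. Each of them has to be verified for the state
  sum too, which is why the list is kept short.\<close>

inductive core_move :: "diagram \<Rightarrow> diagram \<Rightarrow> bool" where
  exchange: "core_move [(i, d), (i + top_width d + k, e)] [(i + bot_width d + k, e), (i, d)]"
| zigzag1: "core_move [(i, Cup), (Suc i, Cap)] []"
| zigzag2: "core_move [(Suc i, Cup), (i, Cap)] []"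
| cupslide: "x \<noteq> XVert \<Longrightarrow> core_move [(i, Cup), (Suc i, Node x)] [(Suc i, Cup), (i, Node (switch x))]"
| capslide: "x \<noteq> XVert \<Longrightarrow> core_move [(Suc i, Node x), (i, Cap)] [(i, Node (switch x)), (Suc i, Cap)]"
| bigon: "core_move [(i, Node XPlus), (i, Node XMinus)] []"
| braid: "core_move [(i, Node XPlus), (Suc i, Node XPlus), (i, Node XPlus)]
                    [(Suc i, Node XPlus), (i, Node XPlus), (Suc i, Node XPlus)]"

lemma core_move_tangle:
  assumes "core_move s t" "tangle m s n"
  shows "tangle m t n"
  using assms by (induction) auto

lemma knotted_local:
  assumes "knotted_graph (u @ s @ v)" "\<And>m n. tangle m s n \<Longrightarrow> tangle m t n"
  shows "knotted_graph (u @ t @ v)"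
  using assms unfolding knotted_graph_def tangle_append by blast

text \<open>Both \<open>P\<close> and the state sum are models, with \<open>z\<close> for q - 1/q
  and \<open>A\<close> for the second variable. Uniqueness is a statement about two models.\<close>

locale kv_skein =
  fixes f :: "diagram \<Rightarrow> 'k::field" and z A :: 'k
  assumes z_nz: "z \<noteq> 0" and A_nz: "A \<noteq> 0"
    and move: "core_move s t \<Longrightarrow> knotted_graph (u @ s @ v) \<Longrightarrow> vertex_free (u @ s @ v) \<Longrightarrow>
       f (u @ s @ v) = f (u @ t @ v)"
    and empty: "f [] = 1"
    and circle0: "f [(0, Cup), (0, Cap)] = (A - inverse A) / z + 1"
    and skein: "knotted_graph (u @ [(i, Node XPlus)] @ v) \<Longrightarrow> vertex_free (u @ v) \<Longrightarrow>
       f (u @ [(i, Node XPlus)] @ v) - f (u @ [(i, Node XMinus)] @ v)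
       = z * (f (u @ v) - f (u @ [(i, Cap), (i, Cup)] @ v))"
    and curl_right: "knotted_graph (u @ [(Suc i, Cup), (i, Node XPlus), (Suc i, Cap)] @ v) \<Longrightarrow> vertex_free (u @ v) \<Longrightarrow>
       f (u @ [(Suc i, Cup), (i, Node XPlus), (Suc i, Cap)] @ v) = A * f (u @ v)"
    and curl_left: "knotted_graph (u @ [(i, Cup), (Suc i, Node XPlus), (i, Cap)] @ v) \<Longrightarrow> vertex_free (u @ v) \<Longrightarrow>
       f (u @ [(i, Cup), (Suc i, Node XPlus), (i, Cap)] @ v) = A * f (u @ v)"
begin

section \<open>Twists at extrema and free circles\<close>

lemma exch:
  assumes "knotted_graph (u @ (i, d) # (j, e) # v)" "vertex_free (u @ (i, d) # (j, e) # v)"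
    "i + top_width d \<le> j" "j' + top_width d = j + bot_width d"
  shows "f (u @ (i, d) # (j, e) # v) = f (u @ (j', e) # (i, d) # v)"
proof -
  define k where "k = j - (i + top_width d)"
  have "j = i + top_width d + k" "j' = i + bot_width d + k" using assms(3,4) by (auto simp: k_def)
  then show ?thesis using move[OF exchange[of i d k e], of u v] assms(1,2) by simp
qed

text \<open>A zigzag inserted in the left strand just below the maximum lets the crossing sink to
  the new minimum, which turns it by a right angle into \<open>XPlus\<close>. What remains is a curl
  on the right of a strand. The quarter turn is the reason why the factor \<open>A\<close> belongs
  to \<open>XMinus\<close> here.\<close>

lemma cap_twist:
  assumes "knotted_graph (u @ (j, Cap) # v)" "vertex_free (u @ v)"
  shows "f (u @ (j, Node XMinus) # (j, Cap) # v) = A * f (u @ (j, Cap) # v)"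
proof -
  obtain m where m: "tangle 0 u m" "j + 2 \<le> m" "tangle (m - 2) v 0"
    using assms by (auto simp: knotted_graph_def tangle_append)
  have K: "knotted_graph (u @ (Suc j, Cup) # (j, Cap) # (j, Node XMinus) # (j, Cap) # v)"
     "knotted_graph (u @ (Suc j, Cup) # (j + 2, Node XMinus) # (j, Cap) # (j, Cap) # v)"
     "knotted_graph (u @ (Suc j, Cup) # (j + 2, Node XMinus) # (j + 2, Cap) # (j, Cap) # v)"
     "knotted_graph (u @ (j + 2, Cup) # (Suc j, Node XPlus) # (j + 2, Cap) # (j, Cap) # v)"
    using m by (auto simp: knotted_graph_def tangle_append intro!: exI[of _ m])
  have "f (u @ (j, Node XMinus) # (j, Cap) # v) = f (u @ (Suc j, Cup) # (j, Cap) # (j, Node XMinus) # (j, Cap) # v)"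
    using move[OF zigzag2[of j], of u "(j, Node XMinus) # (j, Cap) # v"] K assms(2) by simp
  also have "\<dots> = f (u @ (Suc j, Cup) # (j + 2, Node XMinus) # (j, Cap) # (j, Cap) # v)"
    using exch[of "u @ [(Suc j, Cup)]" j Cap j "Node XMinus" "(j, Cap) # v" "j + 2"] K assms(2) by simp
  also have "\<dots> = f (u @ (Suc j, Cup) # (j + 2, Node XMinus) # (j + 2, Cap) # (j, Cap) # v)"
    using exch[of "u @ [(Suc j, Cup), (j + 2, Node XMinus)]" j Cap j "Cap" v "j + 2"] K assms(2) by simp
  also have "\<dots> = f (u @ (j + 2, Cup) # (Suc j, Node XPlus) # (j + 2, Cap) # (j, Cap) # v)"
    using move[OF cupslide[of XMinus "Suc j"], of u "(j + 2, Cap) # (j, Cap) # v"] K assms(2) by simp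
  also have "\<dots> = A * f (u @ (j, Cap) # v)"
    using curl_right[of u "Suc j" "(j, Cap) # v"] K assms(2) by simp
  finally show ?thesis .
qed

text \<open>The argument for a maximum turned upside down: the zigzag is inserted above the
  crossing, and a cap slide turns it.\<close>

lemma cup_twist:
  assumes "knotted_graph (u @ (j, Cup) # v)" "vertex_free (u @ v)"
  shows "f (u @ (j, Cup) # (j, Node XMinus) # v) = A * f (u @ (j, Cup) # v)"
proof -
  obtain m where m: "tangle 0 u m" "j \<le> m" "tangle (m + 2) v 0"
    using assms by (auto simp: knotted_graph_def tangle_append)
  have K: "knotted_graph (u @ (j, Cup) # (j, Node XMinus) # (Suc j, Cup) # (j, Cap) # v)"
     "knotted_graph (u @ (j, Cup) # (j, Cup) # (j + 2, Node XMinus) # (Suc j, Cap) # v)"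
     "knotted_graph (u @ (j, Cup) # (j + 2, Cup) # (j + 2, Node XMinus) # (Suc j, Cap) # v)"
     "knotted_graph (u @ (j, Cup) # (j + 2, Cup) # (Suc j, Node XPlus) # (j + 2, Cap) # v)"
     "knotted_graph (u @ (j, Cup) # (j, Node XMinus) # (j, Cup) # (Suc j, Cap) # v)"
     "knotted_graph (u @ (j, Cup) # v)"
    using m by (auto simp: knotted_graph_def tangle_append intro!: exI[of _ m])
  have "f (u @ (j, Cup) # (j, Node XMinus) # v) = f (u @ (j, Cup) # (j, Node XMinus) # (j, Cup) # (Suc j, Cap) # v)"
    using move[OF zigzag1[of j], of "u @ [(j, Cup), (j, Node XMinus)]" "v"] K assms(2) by simp
  also have "\<dots> = f (u @ (j, Cup) # (j, Cup) # (j + 2, Node XMinus) # (Suc j, Cap) # v)"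
    using exch[of "u @ [(j, Cup)]" j Cup "j + 2" "Node XMinus" "(Suc j, Cap) # v" j] K assms(2) by simp
  also have "\<dots> = f (u @ (j, Cup) # (j + 2, Cup) # (j + 2, Node XMinus) # (Suc j, Cap) # v)"
    using exch[of "u" j Cup "j + 2" "Cup" "(j + 2, Node XMinus) # (Suc j, Cap) # v" j] K assms(2) by simp
  also have "\<dots> = f (u @ (j, Cup) # (j + 2, Cup) # (Suc j, Node XPlus) # (j + 2, Cap) # v)"
    using move[OF capslide[of XMinus "Suc j"], of "u @ [(j, Cup), (j + 2, Cup)]" v] K assms(2) by simp
  also have "\<dots> = A * f (u @ (j, Cup) # v)"
    using curl_right[of "u @ [(j, Cup)]" "Suc j" v] K assms(2) by simp
  finally show ?thesis .
qed

lemma cap_twist_inv: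
  assumes "knotted_graph (u @ (j, Cap) # v)" "vertex_free (u @ v)"
  shows "f (u @ (j, Node XPlus) # (j, Cap) # v) = inverse A * f (u @ (j, Cap) # v)"
proof -
  have K: "knotted_graph (u @ (j, Node XPlus) # (j, Cap) # v)"
    "knotted_graph (u @ (j, Node XPlus) # (j, Node XMinus) # (j, Cap) # v)"
    using assms by (auto simp: knotted_graph_def tangle_append)
  have "f (u @ (j, Cap) # v) = f (u @ (j, Node XPlus) # (j, Node XMinus) # (j, Cap) # v)"
    using move[OF bigon[of j], of u "(j, Cap) # v"] K assms(2) by simp
  also have "\<dots> = A * f (u @ (j, Node XPlus) # (j, Cap) # v)"
    using cap_twist[of "u @ [(j, Node XPlus)]"] K assms by simp
  finally show ?thesis using A_nz by (simp add: field_simps)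
qed

definition \<delta> :: 'k where "\<delta> = (A - inverse A) / z + 1"

text \<open>The skein relation at the crossing of a curl. The two curls contribute \<open>A\<close>
  and \<open>inverse A\<close>, one smoothing is the strand with the circle beside it, and the other
  is a strand with two zigzags; so A - 1/A = z (circle - 1).\<close>

lemma circle_right:
  assumes "knotted_graph (u @ (Suc i, Cup) # (Suc i, Cap) # v)" "vertex_free (u @ v)"
  shows "f (u @ (Suc i, Cup) # (Suc i, Cap) # v) = \<delta> * f (u @ v)"
proof -
  let ?D = "\<lambda>x. u @ (Suc i, Cup) # (i, Node x) # (Suc i, Cap) # v"
  obtain m where m: "tangle 0 u m" "Suc i \<le> m" "tangle m v 0"
    using assms by (auto simp: knotted_graph_def tangle_append)
  have K: "knotted_graph (?D x)" "knotted_graph (u @ (i, Cup) # (Suc i, Node x) # (Suc i, Cap) # v)"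
     "knotted_graph (u @ (i, Cup) # (Suc i, Cap) # v)" "knotted_graph (u @ v)"
     "knotted_graph (u @ (Suc i, Cup) # (i, Cap) # (i, Cup) # (Suc i, Cap) # v)" for x
    using m by (auto simp: knotted_graph_def tangle_append intro!: exI[of _ m])
  have 1: "f (?D XPlus) = A * f (u @ v)"
    using curl_right[of u i v] K assms by simp
  have "f (?D XMinus) = f (u @ (i, Cup) # (Suc i, Node XPlus) # (Suc i, Cap) # v)"
    using move[OF cupslide[of XPlus i], of u "(Suc i, Cap) # v"] K assms(2) by simp
  also have "\<dots> = inverse A * f (u @ (i, Cup) # (Suc i, Cap) # v)"
    using cap_twist_inv[of "u @ [(i, Cup)]" "Suc i" v] K assms(2) by simp
  also have "f (u @ (i, Cup) # (Suc i, Cap) # v) = f (u @ v)"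
    using move[OF zigzag1[of i], of u v] K assms(2) by simp
  finally have 2: "f (?D XMinus) = inverse A * f (u @ v)" .
  have "f (u @ (Suc i, Cup) # (i, Cap) # (i, Cup) # (Suc i, Cap) # v)
     = f (u @ (i, Cup) # (Suc i, Cap) # v)"
    using move[OF zigzag2[of i], of u "(i, Cup) # (Suc i, Cap) # v"] K assms(2) by simp
  also have "f (u @ (i, Cup) # (Suc i, Cap) # v) = f (u @ v)"
    using move[OF zigzag1[of i], of u v] K assms(2) by simp
  finally have 3: "f (u @ (Suc i, Cup) # (i, Cap) # (i, Cup) # (Suc i, Cap) # v) = f (u @ v)" .
  have "f (?D XPlus) - f (?D XMinus) = z * (f (u @ (Suc i, Cup) # (Suc i, Cap) # v) - f (u @ v))"
    using skein[of "u @ [(Suc i, Cup)]" i "(Suc i, Cap) # v"] K assms(2) 3 by simp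
  then have "A * f (u @ v) - inverse A * f (u @ v) + z * f (u @ v) = z * f (u @ (Suc i, Cup) # (Suc i, Cap) # v)"
    unfolding 1 2 by (simp add: algebra_simps)
  then show ?thesis using z_nz A_nz by (simp add: \<delta>_def field_simps)
qed

lemma circle_left:
  assumes "knotted_graph (u @ (i, Cup) # (i, Cap) # v)" "vertex_free (u @ v)" "tangle 0 u m" "i < m"
    "tangle m v 0"
  shows "f (u @ (i, Cup) # (i, Cap) # v) = \<delta> * f (u @ v)"
proof -
  let ?D = "\<lambda>x. u @ (i, Cup) # (Suc i, Node x) # (i, Cap) # v"
  have K: "knotted_graph (?D x)" "knotted_graph (u @ (Suc i, Cup) # (i, Node x) # (i, Cap) # v)"
     "knotted_graph (u @ (Suc i, Cup) # (i, Cap) # v)" "knotted_graph (u @ v)"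
     "knotted_graph (u @ (i, Cup) # (Suc i, Cap) # (Suc i, Cup) # (i, Cap) # v)" for x
    using assms by (auto simp: knotted_graph_def tangle_append intro!: exI[of _ m])
  have 1: "f (?D XPlus) = A * f (u @ v)"
    using curl_left[of u i v] K assms by simp
  have "f (?D XMinus) = f (u @ (Suc i, Cup) # (i, Node XPlus) # (i, Cap) # v)"
    using move[OF cupslide[of XMinus i], of u "(i, Cap) # v"] K assms(2) by simp
  also have "\<dots> = inverse A * f (u @ (Suc i, Cup) # (i, Cap) # v)"
    using cap_twist_inv[of "u @ [(Suc i, Cup)]" "i" v] K assms(2) by simp
  also have "f (u @ (Suc i, Cup) # (i, Cap) # v) = f (u @ v)"
    using move[OF zigzag2[of i], of u v] K assms(2) by simp
  finally have 2: "f (?D XMinus) = inverse A * f (u @ v)" .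
  have "f (u @ (i, Cup) # (Suc i, Cap) # (Suc i, Cup) # (i, Cap) # v)
     = f (u @ (Suc i, Cup) # (i, Cap) # v)"
    using move[OF zigzag1[of i], of u "(Suc i, Cup) # (i, Cap) # v"] K assms(2) by simp
  also have "f (u @ (Suc i, Cup) # (i, Cap) # v) = f (u @ v)"
    using move[OF zigzag2[of i], of u v] K assms(2) by simp
  finally have 3: "f (u @ (i, Cup) # (Suc i, Cap) # (Suc i, Cup) # (i, Cap) # v) = f (u @ v)" .
  have "f (?D XPlus) - f (?D XMinus) = z * (f (u @ (i, Cup) # (i, Cap) # v) - f (u @ v))"
    using skein[of "u @ [(i, Cup)]" "Suc i" "(i, Cap) # v"] K assms(2) 3 by simp
  then have "A * f (u @ v) - inverse A * f (u @ v) + z * f (u @ v) = z * f (u @ (i, Cup) # (i, Cap) # v)"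
    unfolding 1 2 by (simp add: algebra_simps)
  then show ?thesis using z_nz A_nz by (simp add: \<delta>_def field_simps)
qed

text \<open>A circle with a neighbouring strand is covered by the two preceding cases. At a level
  without strands it is exchanged with the minimum that follows or the maximum that precedes it,
  after which it has a neighbour. Only the circle that forms the whole diagram rests on the
  normalization \<open>circle0\<close>.\<close>

lemma circle:
  assumes "knotted_graph (u @ (i, Cup) # (i, Cap) # v)" "vertex_free (u @ v)"
  shows "f (u @ (i, Cup) # (i, Cap) # v) = \<delta> * f (u @ v)"
proof -
  obtain m where m: "tangle 0 u m" "i \<le> m" "tangle m v 0"
    using assms by (auto simp: knotted_graph_def tangle_append)
  consider (l) "i < m" | (r) j where "i = Suc j" | (u) "m = 0" "i = 0" "u = []" | (v) "m = 0" "i = 0" "u \<noteq> []"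
    using m(2) by (cases i; cases "i < m"; cases "u = []") auto
  then show ?thesis
  proof cases
    case l then show ?thesis using circle_left assms m by blast
  next
    case r then show ?thesis using circle_right[of u j v] assms by simp
  next
    case u
    show ?thesis
    proof (cases v)
      case Nil
      then show ?thesis using u circle0 empty by (simp add: \<delta>_def)
    next
      case (Cons p v')
      then obtain v' where v: "v = (0, Cup) # v'" using u m(3)
        by (cases p; cases "snd p") (auto)
      have t: "tangle 2 v' 0" using m(3) u v by (auto simp: eval_nat_numeral)
      then have K: "knotted_graph ((0, Cup) # (0, Cap) # (0, Cup) # v')"
        "knotted_graph ((0, Cup) # (2, Cup) # (0, Cap) # v')"
        "knotted_graph ((0, Cup) # (0, Cup) # (0, Cap) # v')" "knotted_graph ((0, Cup) # v')"
        by (auto simp: knotted_graph_def eval_nat_numeral)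
      have "f ((0, Cup) # (0, Cap) # (0, Cup) # v') = f ((0, Cup) # (2, Cup) # (0, Cap) # v')"
        using exch[of "[(0, Cup)]" 0 Cap 0 Cup v' 2] K assms v u by simp
      also have "\<dots> = f ((0, Cup) # (0, Cup) # (0, Cap) # v')"
        using exch[of "[]" 0 Cup 2 Cup "(0, Cap) # v'" 0] K assms v u by simp
      also have "\<dots> = \<delta> * f ((0, Cup) # v')"
        using circle_left[of "[(0, Cup)]" 0 v' 2] K assms v u t by simp
      finally show ?thesis using u v by simp
    qed
  next
    case v
    then obtain u' j e where u': "u = u' @ [(j, e)]" by (metis rev_exhaust surj_pair)
    then obtain k where k: "tangle 0 u' k" "j + bot_width e \<le> k" "k - bot_width e + top_width e = 0"
      using m(1) v by (auto simp: tangle_append)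
    then have "e = Cap" by (cases e) auto
    then have u: "u = u' @ [(0, Cap)]" "tangle 0 u' 2"
      using k u' by (auto simp: le_Suc_eq eval_nat_numeral)
    have K: "knotted_graph (u' @ (0, Cap) # (0, Cup) # (0, Cap) # v)"
      "knotted_graph (u' @ (2, Cup) # (0, Cap) # (0, Cap) # v)"
      "knotted_graph (u' @ (2, Cup) # (2, Cap) # (0, Cap) # v)"
      using u m v
      by (auto simp: knotted_graph_def tangle_append eval_nat_numeral intro!: exI[of _ "Suc (Suc 0)"])
    have "f (u' @ (0, Cap) # (0, Cup) # (0, Cap) # v) = f (u' @ (2, Cup) # (0, Cap) # (0, Cap) # v)"
      using exch[of u' 0 Cap 0 Cup "(0, Cap) # v" 2] K assms u by simp
    also have "\<dots> = f (u' @ (2, Cup) # (2, Cap) # (0, Cap) # v)"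
      using exch[of "u' @ [(2, Cup)]" 0 Cap 0 Cap "v" 2] K assms u by simp
    also have "\<dots> = \<delta> * f (u' @ (0, Cap) # v)"
      using circle_right[of u' 1 "(0, Cap) # v"] K assms u by (simp add: eval_nat_numeral)
    finally show ?thesis using u v by simp
  qed
qed

end

text \<open>Projections are represented by diagrams all of whose crossings are \<open>XPlus\<close>.\<close>

definition plus :: "diagram \<Rightarrow> bool" where
  "plus D \<longleftrightarrow> (\<forall>p\<in>set D. \<forall>x. snd p = Node x \<longrightarrow> x = XPlus)"

lemma plus_simps [simp]:
  "plus []" "plus (p # D) \<longleftrightarrow> (\<forall>x. snd p = Node x \<longrightarrow> x = XPlus) \<and> plus D"
  "plus (D @ D') \<longleftrightarrow> plus D \<and> plus D'"
  by (auto simp: plus_def)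

lemma two_le_pred: "2 \<le> k \<Longrightarrow> Suc (Suc (k - 2)) = k"
  by simp

lemma plus_vf: "plus D \<Longrightarrow> vertex_free D"
  by (auto simp: plus_def vertex_free_def)

section \<open>Rewriting of projections\<close>

abbreviation X :: elem where "X \<equiv> Node XPlus"
abbreviation Y :: elem where "Y \<equiv> Node XMinus"

text \<open>Core moves and reversed core moves with over and under forgotten, so that slides leave
  \<open>X\<close> unchanged. None of them changes the number of crossings or increases the number
  of maxima, which is what makes an induction on these two numbers possible.\<close>

inductive shadow_move :: "diagram \<Rightarrow> diagram \<Rightarrow> bool" where
  exchange: "i + top_width d \<le> j \<Longrightarrow> j' + top_width d = j + bot_width d \<Longrightarrow>
    shadow_move [(i, d), (j, e)] [(j', e), (i, d)]"
| exchange_rev: "i + bot_width d \<le> j' \<Longrightarrow> j' + top_width d = j + bot_width d \<Longrightarrow>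
    shadow_move [(j', e), (i, d)] [(i, d), (j, e)]"
| zigzag1: "shadow_move [(i, Cup), (Suc i, Cap)] []"
| zigzag2: "shadow_move [(Suc i, Cup), (i, Cap)] []"
| cupslide: "shadow_move [(i, Cup), (Suc i, X)] [(Suc i, Cup), (i, X)]"
| cupslide_rev: "shadow_move [(Suc i, Cup), (i, X)] [(i, Cup), (Suc i, X)]"
| capslide: "shadow_move [(Suc i, X), (i, Cap)] [(i, X), (Suc i, Cap)]"
| capslide_rev: "shadow_move [(i, X), (Suc i, Cap)] [(Suc i, X), (i, Cap)]"
| braid_rev: "shadow_move [(Suc i, X), (i, X), (Suc i, X)] [(i, X), (Suc i, X), (i, X)]"

lemma shadow_move_tangle:
  assumes "shadow_move s t" "tangle m s n"
  shows "tangle m t n"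
  using assms by induction auto

inductive shadow :: "diagram \<Rightarrow> diagram \<Rightarrow> bool" where
  stop: "shadow w w"
| step: "shadow_move s t \<Longrightarrow> shadow (p @ t @ r) w \<Longrightarrow> shadow (p @ s @ r) w"

lemma shadow_trans: "shadow a b \<Longrightarrow> shadow b c \<Longrightarrow> shadow a c"
  by (induction rule: shadow.induct) (auto intro: shadow.step)

lemma shadow_ctx: "shadow a b \<Longrightarrow> shadow (p @ a @ r) (p @ b @ r)"
proof (induction rule: shadow.induct)
  case (step s t p' r' w)
  then show ?case using shadow.step[of s t "p @ p'" "r' @ r"] by simp
qed (rule shadow.stop)

lemma shadow_Cons: "shadow a b \<Longrightarrow> shadow (x # a) (x # b)"
  using shadow_ctx[of a b "[x]" "[]"] by simp

lemma shadow_app: "shadow a b \<Longrightarrow> shadow (a @ r) (b @ r)"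
  using shadow_ctx[of a b "[]" r] by simp

lemma shadow_head: "shadow_move s t \<Longrightarrow> shadow (t @ r) w \<Longrightarrow> shadow (s @ r) w"
  using shadow.step[of s t "[]" r] by simp

lemma shadow_swap:
  assumes "shadow_move [a, b] [c, d]" "shadow (d # w) w'"
  shows "shadow (a # b # w) (c # w')"
  using shadow_head[OF assms(1), of w "c # w'"] shadow_Cons[OF assms(2), of c] by simp

lemma shadow_inv:
  assumes "shadow a b"
  shows "tangle m a n \<Longrightarrow> tangle m b n" "plus a \<Longrightarrow> plus b" "nodes b = nodes a" "caps b \<le> caps a"
proof -
  have *: "plus s \<Longrightarrow> plus t" "nodes s = nodes t" "caps t \<le> caps s" if "shadow_move s t" for s t
    using that by (induction, auto)+
  show "tangle m a n \<Longrightarrow> tangle m b n" "plus a \<Longrightarrow> plus b" "nodes b = nodes a" "caps b \<le> caps a"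
    using assms
    by (induction, auto simp: tangle_append dest: shadow_move_tangle *)
qed

text \<open>The configurations in which a crossing can be removed once it is switched suitably: a
  bigon, and a twist at a minimum or at a maximum.\<close>

definition redex :: "diagram \<Rightarrow> bool" where
  "redex s \<longleftrightarrow> (\<exists>i. s = [(i, X), (i, X)] \<or> s = [(i, Cup), (i, X)] \<or> s = [(i, X), (i, Cap)])"

definition reducible :: "diagram \<Rightarrow> bool" where
  "reducible w \<longleftrightarrow> (\<exists>p s r. shadow w (p @ s @ r) \<and> redex s)"

lemma reducible_redex: "redex s \<Longrightarrow> reducible (s @ r)"
  unfolding reducible_def by (intro exI[of _ "[]"] exI[of _ s] exI[of _ r]) (simp add: shadow.stop)

lemma reducible_step: "shadow_move s t \<Longrightarrow> reducible (t @ r) \<Longrightarrow> reducible (s @ r)"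
  unfolding reducible_def using shadow_head by blast

lemma reducible_Cons: "reducible w \<Longrightarrow> reducible (x # w)"
  unfolding reducible_def using shadow_Cons by (metis append_Cons)

text \<open>The maximum joining the strands \<open>i\<close> and \<open>i + l + 1\<close>, which crosses the \<open>l\<close> strands in between.\<close>

fun long_cap :: "nat \<Rightarrow> nat \<Rightarrow> diagram" where
  "long_cap i 0 = [(i, Cap)]"
| "long_cap i (Suc l) = (i, X) # long_cap (Suc i) l"

section \<open>Pulling a long maximum down past one piece\<close>

lemma long_cap_counts [simp]: "caps (long_cap i l) = 1" "nodes (long_cap i l) = l" "plus (long_cap i l)"
  by (induction i l rule: long_cap.induct) auto

lemma node_far_left: "Suc j < i \<Longrightarrow> shadow ((j, X) # long_cap i l) (long_cap i l @ [(j, X)])"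
proof (induction i l rule: long_cap.induct)
  case (1 i)
  then show ?case using shadow_head[OF shadow_move.exchange[of j X i i Cap] shadow.stop, of "[]"] by simp
next
  case (2 i l)
  then show ?case
    using shadow_swap[OF shadow_move.exchange[of j X i i X]] by simp
qed

lemma cup_far_left: "Suc j < i \<Longrightarrow> shadow ((j, Cup) # long_cap i l) (long_cap (i - 2) l @ [(j, Cup)])"
proof (induction i l rule: long_cap.induct)
  case (1 i)
  then show ?case using shadow_head[OF shadow_move.exchange[of j Cup i "i - 2" Cap] shadow.stop, of "[]"] by simp
next
  case (2 i l)
  then show ?case
    using shadow_swap[OF shadow_move.exchange[of j Cup i "i - 2" X]] Suc_diff_le[of 2 i]
    by (auto simp: two_le_pred)
qed

text \<open>Both strands of the crossing are crossed by the maximum, so one Reidemeister III move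
  carries it through. Its index drops by one because the left leg of the maximum no longer lies to
  its left.\<close>

lemma node_between:
  "i < j \<Longrightarrow> j < i + l \<Longrightarrow> shadow ((j, X) # long_cap i l) (long_cap i l @ [(j - 1, X)])"
proof (induction i l rule: long_cap.induct)
  case (2 i l)
  show ?case
  proof (cases "j = Suc i")
    case True
    then obtain l' where l: "l = Suc l'" using 2 by (cases l) auto
    have "shadow ([(i, X), (Suc i, X)] @ ((i, X) # long_cap (i + 2) l'))
        ([(i, X), (Suc i, X)] @ (long_cap (i + 2) l' @ [(i, X)]))"
      using shadow_ctx[OF node_far_left[of i "i + 2" l'], of "[(i, X), (Suc i, X)]" "[]"] by simp
    then show ?thesis
      using shadow_head[OF shadow_move.braid_rev[of i], of "long_cap (i + 2) l'"] True l by simp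
  next
    case False
    then have "shadow ((j, X) # long_cap (Suc i) l) (long_cap (Suc i) l @ [(j - 1, X)])"
      using 2 by simp
    then show ?thesis
      using shadow_swap[OF shadow_move.exchange_rev[of i X j j X]] False 2 by simp
  qed
qed simp

text \<open>The right leg meets the last crossed strand in this crossing, and the maximum crosses
  that strand again. Sliding the extremum across the strand puts the two crossings on top of each
  other as a bigon.\<close>

lemma node_last: "reducible ((i + Suc l, X) # long_cap i (Suc l))"
proof (induction l arbitrary: i)
  case 0
  have "reducible ([(Suc i, X)] @ [(Suc i, X), (i, Cap)])"
    using reducible_redex[of "[(Suc i, X), (Suc i, X)]" "[(i, Cap)]"] by (simp add: redex_def)
  then obtain p s r where "shadow [(Suc i, X), (Suc i, X), (i, Cap)] (p @ s @ r)" "redex s"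
    by (auto simp: reducible_def)
  then show ?case
    using shadow.step[OF shadow_move.capslide_rev[of i], of "[(Suc i, X)]" "[]"] by (auto simp: reducible_def)
next
  case (Suc l)
  have "reducible ((i, X) # (Suc i + Suc l, X) # long_cap (Suc i) (Suc l))"
    using Suc.IH reducible_Cons by blast
  then show ?case
    using reducible_step[OF shadow_move.exchange_rev[of i X "i + Suc (Suc l)" "i + Suc (Suc l)" X],
        of "long_cap (Suc i) (Suc l)"] by simp
qed

text \<open>The strand to the right of the maximum becomes one more crossed strand. Since
  \<open>long_cap\<close> keeps all its crossings on the left leg, the new crossing has to slide
  over the extremum from the right leg to the left one.\<close>

lemma node_extend: "shadow ((i + l + 1, X) # long_cap i l) (long_cap i (Suc l))"
proof (induction i l rule: long_cap.induct)
  case (1 i)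
  then show ?case using shadow_head[OF shadow_move.capslide[of i] shadow.stop, of "[]"] by simp
next
  case (2 i l)
  show ?case
    using shadow_swap[OF shadow_move.exchange_rev[of i X "i + Suc l + 1" "i + Suc l + 1" X]] 2 by simp
qed

lemma far_right:
  "i + l + 2 \<le> j \<Longrightarrow> shadow ((j, e) # long_cap i l) (long_cap i l @ [(j - 2, e)])"
proof (induction i l rule: long_cap.induct)
  case (1 i)
  then show ?case using shadow_head[OF shadow_move.exchange_rev[of i Cap j "j - 2" e] shadow.stop, of "[]"] by simp
next
  case (2 i l)
  then have *: "shadow ((j, e) # long_cap (Suc i) l) (long_cap (Suc i) l @ [(j - 2, e)])" by simp
  show ?case
    using shadow_swap[OF shadow_move.exchange_rev[of i X j j e] *] 2 by simp
qed

text \<open>Repeated cup slides carry the minimum along the left leg until it cancels against the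
  maximum in a zigzag. Only the crossings with the strands in between are left, hence
  \<open>caps r = 0\<close>.\<close>

lemma cup_join_left: "\<exists>r. shadow ((j, Cup) # long_cap (Suc j) l) r \<and> caps r = 0"
proof (induction l arbitrary: j)
  case 0
  then show ?case using shadow_head[OF shadow_move.zigzag1[of j] shadow.stop, of "[]"] by auto
next
  case (Suc l)
  obtain r where r: "shadow ((Suc j, Cup) # long_cap (j + 2) l) r" "caps r = 0"
    using Suc by auto
  have "shadow ([(Suc j, Cup)] @ ((j, X) # long_cap (j + 2) l)) ([(Suc j, Cup)] @ long_cap (j + 2) l @ [(j, X)])"
    using shadow_ctx[OF node_far_left[of j "j + 2" l], of "[(Suc j, Cup)]" "[]"] by simp
  then have "shadow ([(Suc j, Cup)] @ ((j, X) # long_cap (j + 2) l)) (r @ [(j, X)])"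
    using shadow_trans shadow_app[OF r(1), of "[(j, X)]"] by simp
  then show ?case
    using shadow_head[OF shadow_move.cupslide[of j], of "long_cap (j + 2) l"] r(2)
    by (intro exI[of _ "r @ [(j, X)]"]) simp
qed

lemma cup_join_right: "\<exists>r. shadow ((i + l + 1, Cup) # long_cap i l) r \<and> caps r = 0"
proof (induction l arbitrary: i)
  case 0
  then show ?case using shadow_head[OF shadow_move.zigzag2[of i] shadow.stop, of "[]"] by auto
next
  case (Suc l)
  obtain r where r: "shadow ((Suc i + l + 1, Cup) # long_cap (Suc i) l) r" "caps r = 0"
    using Suc by blast
  show ?case
    using shadow_swap[OF shadow_move.exchange_rev[of i X "i + Suc l + 1" "i + Suc l + 1" Cup]] r
    by (intro exI[of _ "(i, X) # r"]) simp
qed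

text \<open>If both legs of the minimum are crossed strands (\<open>j < i + l\<close>), the maximum
  forms a bigon with it. If \<open>j = i + l\<close>, its right leg is the right leg of the maximum
  and its left leg is crossed, which gives a twist.\<close>

lemma cup_between:
  "i < j \<Longrightarrow> j \<le> i + l \<Longrightarrow> reducible ((j, Cup) # long_cap i l)"
proof (induction l arbitrary: i)
  case (Suc l)
  show ?case
  proof (cases "j = Suc i")
    case True
    show ?thesis
    proof (cases l)
      case 0
      have "reducible ([(i, Cup)] @ [(Suc i, X), (Suc i, Cap)])"
        using reducible_redex[of "[(Suc i, X), (Suc i, Cap)]" "[]"] by (simp add: redex_def reducible_Cons)
      then show ?thesis
        using reducible_step[OF shadow_move.cupslide_rev[of i], of "[(Suc i, Cap)]"] 0 True by simp
    next
      case (Suc l')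
      have "reducible ([(i, Cup)] @ [(Suc i, X), (Suc i, X)] @ long_cap (i + 2) l')"
        using reducible_redex[of "[(Suc i, X), (Suc i, X)]" "long_cap (i + 2) l'"]
        by (simp add: redex_def reducible_Cons)
      then show ?thesis
        using reducible_step[OF shadow_move.cupslide_rev[of i], of "(Suc i, X) # long_cap (i + 2) l'"] Suc True
        by simp
    qed
  next
    case False
    then have "reducible ((i, X) # (j, Cup) # long_cap (Suc i) l)"
      using Suc reducible_Cons by auto
    then show ?thesis
      using reducible_step[OF shadow_move.exchange_rev[of i X j j Cup], of "long_cap (Suc i) l"] Suc.prems False
      by simp
  qed
qed simp

text \<open>All positions of a piece relative to the legs \<open>i\<close> and
  \<open>i + l + 1\<close>. The outcomes are a removable crossing, a long maximum that has moved
  below the piece (possibly with one more crossed strand), a cancellation of the maximum, or a free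
  circle. The pieces left above contain no maximum, so the count of maxima stays under
  control.\<close>

lemma absorb:
  assumes "plus [(j, e)]" "e \<noteq> Cap"
  shows "reducible ((j, e) # long_cap i l)
    \<or> (\<exists>i' l' r. shadow ((j, e) # long_cap i l) (long_cap i' l' @ r) \<and> caps r = 0)
    \<or> (\<exists>r. shadow ((j, e) # long_cap i l) r \<and> caps r = 0)
    \<or> (e = Cup \<and> j = i \<and> l = 0)"
proof (cases e)
  case Cup
  have c: "caps [(k, Cup)] = 0" for k by simp
  consider "Suc j < i" | "Suc j = i" | "j = i" "l = 0" | "j = i" "l \<noteq> 0" | "i < j" "j \<le> i + l"
    | "j = i + l + 1" | "i + l + 2 \<le> j" by linarith
  then show ?thesis
  proof cases
    case 1 then show ?thesis using cup_far_left[of j i l] Cup c by blast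
  next
    case 2 then show ?thesis using cup_join_left[of j l] Cup by blast
  next
    case 4
    then obtain l' where "l = Suc l'" using not0_implies_Suc by blast
    with 4 show ?thesis using reducible_redex[of "[(i, Cup), (i, X)]" "long_cap (Suc i) l'"] Cup
      by (simp add: redex_def)
  next
    case 7 then show ?thesis using far_right[of i l j Cup] Cup c by blast
  qed (use Cup cup_between cup_join_right in blast)+
next
  case (Node x)
  then have e: "e = X" using assms by simp
  have c: "caps [(k, X)] = 0" for k by simp
  consider "Suc j < i" | "Suc j = i" | "j = i" "l = 0" | "j = i" "l \<noteq> 0" | "i < j" "j < i + l"
    | "j = i + l" "l \<noteq> 0" | "j = i + l + 1" | "i + l + 2 \<le> j" by linarith
  then show ?thesis
  proof cases
    case 1 then show ?thesis using node_far_left[of j i l] e c by blast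
  next
    case 2
    then have "shadow ((j, e) # long_cap i l) (long_cap j (Suc l) @ [])" using e by (simp add: shadow.stop)
    then show ?thesis using caps_simps(1) by blast
  next
    case 3 then show ?thesis using reducible_redex[of "[(i, X), (i, Cap)]" "[]"] e by (simp add: redex_def)
  next
    case 4
    then obtain l' where "l = Suc l'" using not0_implies_Suc by blast
    with 4 show ?thesis using reducible_redex[of "[(i, X), (i, X)]" "long_cap (Suc i) l'"] e
      by (simp add: redex_def)
  next
    case 5 then show ?thesis using node_between[of i j l] e c by blast
  next
    case 6
    then obtain l' where "l = Suc l'" using not0_implies_Suc by blast
    with 6 show ?thesis using node_last[of i l'] e by simp
  next
    case 7 then show ?thesis using node_extend[of i l] e by (metis append_Nil2 caps_simps(1))
  next
    case 8 then show ?thesis using far_right[of i l j X] e c by blast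
  qed
qed (use assms in simp)

section \<open>Uniqueness by induction on crossings and maxima\<close>

locale kv_skein_pair = F: kv_skein f z A + G: kv_skein g z A for f g :: "diagram \<Rightarrow> 'k::field" and z A
begin

context
  fixes n :: nat
  assumes IH: "\<And>D. knotted_graph D \<Longrightarrow> vertex_free D \<Longrightarrow> nodes D < n \<Longrightarrow> f D = g D"
begin

text \<open>Both smoothings have fewer than \<open>n\<close> crossings, so \<open>f\<close> and
  \<open>g\<close> agree on them. By the skein relation the difference of \<open>f\<close> and
  \<open>g\<close> is then the same for \<open>XPlus\<close> and \<open>XMinus\<close>.\<close>

lemma flip:
  assumes "knotted_graph (u @ (i, Node XPlus) # v)" "vertex_free (u @ v)" "nodes (u @ v) < n"
  shows "f (u @ (i, Node XPlus) # v) = g (u @ (i, Node XPlus) # v) \<longleftrightarrow>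
    f (u @ (i, Node XMinus) # v) = g (u @ (i, Node XMinus) # v)"
proof -
  have "knotted_graph (u @ v)" "knotted_graph (u @ (i, Cap) # (i, Cup) # v)"
    using knotted_local[of u "[(i, X)]" v "[]"] knotted_local[of u "[(i, X)]" v "[(i, Cap), (i, Cup)]"]
      assms(1) by (auto simp: two_le_pred)
  then have "f (u @ v) = g (u @ v)" "f (u @ (i, Cap) # (i, Cup) # v) = g (u @ (i, Cap) # (i, Cup) # v)"
    using assms(2,3) by (auto intro!: IH)
  then have "f (u @ (i, X) # v) - f (u @ (i, Node XMinus) # v) = g (u @ (i, X) # v) - g (u @ (i, Node XMinus) # v)"
    using F.skein[of u i v] G.skein[of u i v] assms by simp
  then have "f (u @ (i, X) # v) - g (u @ (i, X) # v) = f (u @ (i, Node XMinus) # v) - g (u @ (i, Node XMinus) # v)"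
    by (simp add: algebra_simps)
  then show ?thesis by (metis right_minus_eq)
qed

lemma det_move:
  assumes "core_move s t" "knotted_graph (u @ s @ v)" "vertex_free (u @ s @ v)"
  shows "f (u @ s @ v) = g (u @ s @ v) \<longleftrightarrow> f (u @ t @ v) = g (u @ t @ v)"
  using F.move[OF assms] G.move[OF assms] by simp

text \<open>A slide across an extremum really switches the crossing, and \<open>flip\<close>
  switches it back. The remaining cases are core moves, read in one direction or the other.
  Agreement is transported from the rewritten diagram back to the original.\<close>

lemma det_shadow_move:
  assumes "shadow_move s t" "knotted_graph (u @ s @ v)" "plus (u @ s @ v)" "nodes (u @ s @ v) = n"
    "f (u @ t @ v) = g (u @ t @ v)"
  shows "f (u @ s @ v) = g (u @ s @ v)"
proof -
  have kt: "knotted_graph (u @ t @ v)"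
    using knotted_local[OF assms(2) shadow_move_tangle[OF assms(1)]] .
  have vf: "vertex_free (u @ s @ v)" using assms plus_vf by blast
  from assms(1) show ?thesis
  proof cases
    case (exchange i d j j' e)
    then show ?thesis using F.exch[of u i d j e v j'] G.exch[of u i d j e v j'] assms vf by simp
  next
    case (exchange_rev i d j' j e)
    then show ?thesis using F.exch[of u i d j e v j'] G.exch[of u i d j e v j'] assms vf kt by simp
  next
    case (zigzag1 i)
    then show ?thesis using det_move[OF core_move.zigzag1[of i], of u v] assms vf by simp
  next
    case (zigzag2 i)
    then show ?thesis using det_move[OF core_move.zigzag2[of i], of u v] assms vf by simp
  next
    case (cupslide i)
    then show ?thesis using det_move[OF core_move.cupslide[of XPlus i], of u v] assms vf kt
        flip[of "u @ [(Suc i, Cup)]" i v] by simp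
  next
    case (cupslide_rev i)
    have "knotted_graph (u @ [(i, Cup), (Suc i, Node XMinus)] @ v)"
      using kt cupslide_rev by (auto simp: knotted_graph_def tangle_append)
    then show ?thesis using det_move[OF core_move.cupslide[of XMinus i], of u v] assms vf kt cupslide_rev
        flip[of "u @ [(i, Cup)]" "Suc i" v] by simp
  next
    case (capslide i)
    then show ?thesis using det_move[OF core_move.capslide[of XPlus i], of u v] assms vf kt
        flip[of u i "(Suc i, Cap) # v"] by simp
  next
    case (capslide_rev i)
    have "knotted_graph (u @ [(Suc i, Node XMinus), (i, Cap)] @ v)"
      using kt capslide_rev by (auto simp: knotted_graph_def tangle_append)
    then show ?thesis using det_move[OF core_move.capslide[of XMinus i], of u v] assms vf kt capslide_rev
        flip[of u "Suc i" "(i, Cap) # v"] by simp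
  next
    case (braid_rev i)
    then show ?thesis using det_move[OF core_move.braid[of i], of u v] assms vf kt by simp
  qed
qed

lemma det_shadow:
  assumes "shadow w w'" "knotted_graph (u @ w @ v)" "plus (u @ w @ v)" "nodes (u @ w @ v) = n"
    "f (u @ w' @ v) = g (u @ w' @ v)"
  shows "f (u @ w @ v) = g (u @ w @ v)"
  using assms
proof (induction rule: shadow.induct)
  case (step s t p r w)
  note inv = shadow_inv[OF shadow.step[OF step.hyps(1) shadow.stop, of p r]]
  have "f (u @ (p @ t @ r) @ v) = g (u @ (p @ t @ r) @ v)"
  proof (rule step.IH)
    show "knotted_graph (u @ (p @ t @ r) @ v)" using knotted_local[OF step.prems(1) inv(1)] .
  qed (use step.prems inv in auto)
  then show ?case
    using det_shadow_move[OF step.hyps(1), of "u @ p" "r @ v"] step.prems by simp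
qed

text \<open>After switching one crossing the bigon is a Reidemeister II move, and a twist is the one
  with factor \<open>A\<close>. In both cases the simplified diagram has fewer crossings.\<close>

lemma det_redex:
  assumes "redex s" "knotted_graph (u @ s @ v)" "plus (u @ s @ v)" "nodes (u @ s @ v) = n"
  shows "f (u @ s @ v) = g (u @ s @ v)"
proof -
  have vf: "vertex_free (u @ s @ v)" using assms plus_vf by blast
  obtain i where "s = [(i, X), (i, X)] \<or> s = [(i, Cup), (i, X)] \<or> s = [(i, X), (i, Cap)]"
    using assms(1) by (auto simp: redex_def)
  then consider "s = [(i, X), (i, X)]" | "s = [(i, Cup), (i, X)]" | "s = [(i, X), (i, Cap)]" by blast
  then show ?thesis
  proof cases
    case 1
    have "knotted_graph (u @ v)" "knotted_graph (u @ [(i, X), (i, Node XMinus)] @ v)"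
      using assms(2) 1 knotted_local[of u s v "[]"] knotted_local[of u s v "[(i, X), (i, Node XMinus)]"]
      by (auto simp: two_le_pred)
    then show ?thesis
      using det_move[OF core_move.bigon[of i], of u v] flip[of "u @ [(i, X)]" i v] assms 1 vf
        IH[of "u @ v"] by simp
  next
    case 2
    have "knotted_graph (u @ (i, Cup) # v)"
      using assms(2) 2 by (auto simp: knotted_graph_def tangle_append)
    then show ?thesis
      using F.cup_twist[of u i v] G.cup_twist[of u i v] flip[of "u @ [(i, Cup)]" i v] assms 2 vf
        IH[of "u @ (i, Cup) # v"] by simp
  next
    case 3
    have "knotted_graph (u @ (i, Cap) # v)"
      using assms(2) 3 by (auto simp: knotted_graph_def tangle_append)
    then show ?thesis
      using F.cap_twist[of u i v] G.cap_twist[of u i v] flip[of "u" i "(i, Cap) # v"] assms 3 vf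
        IH[of "u @ (i, Cap) # v"] by simp
  qed
qed

lemma det_reducible:
  assumes "reducible w" "knotted_graph (u @ w @ v)" "plus (u @ w @ v)" "nodes (u @ w @ v) = n"
  shows "f (u @ w @ v) = g (u @ w @ v)"
proof -
  obtain p s r where psr: "shadow w (p @ s @ r)" "redex s" using assms(1) by (auto simp: reducible_def)
  note inv = shadow_inv[OF psr(1)]
  have k: "knotted_graph (u @ (p @ s @ r) @ v)" using knotted_local[OF assms(2) inv(1)] .
  have "f (u @ (p @ s @ r) @ v) = g (u @ (p @ s @ r) @ v)"
    using det_redex[OF psr(2), of "u @ p" "r @ v"] k assms inv by simp
  then show ?thesis using det_shadow[OF psr(1)] assms by blast
qed

text \<open>Induction on the pieces below the long maximum, from the topmost one downwards. When the
  maximum disappears, by a cancellation or in a circle, the hypothesis on diagrams with fewer than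
  \<open>c\<close> maxima applies, since \<open>w\<close> contains none.\<close>

lemma det_long_cap:
  assumes "\<And>D. knotted_graph D \<Longrightarrow> plus D \<Longrightarrow> nodes D = n \<Longrightarrow> caps D < c \<Longrightarrow> f D = g D"
    and "knotted_graph (w @ long_cap i l @ v)" "plus (w @ v)" "caps w = 0" "nodes (w @ v) + l = n"
    "caps v < c"
  shows "f (w @ long_cap i l @ v) = g (w @ long_cap i l @ v)"
  using assms(2-)
proof (induction w arbitrary: i l v rule: rev_induct)
  case Nil
  \<comment> \<open>At the bottom of a closed diagram there are no strands that could enter a long
    maximum.\<close>
  then show ?case by (cases l) (auto simp: knotted_graph_def)
next
  case (snoc p w)
  obtain j e where p: "p = (j, e)" by (cases p)
  let ?w = "(j, e) # long_cap i l"
  have e: "plus [(j, e)]" "e \<noteq> Cap" using snoc.prems p by (auto split: if_splits)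
  have K: "knotted_graph (w @ ?w @ v)" "plus (w @ ?w @ v)" "nodes (w @ ?w @ v) = n"
    using snoc.prems p by auto
  have "f (w @ ?w @ v) = g (w @ ?w @ v)"
    using absorb[OF e, of i l]
  proof (elim disjE exE conjE)
    assume "reducible ?w" then show ?thesis using det_reducible K by blast
  next
    fix i' l' r assume s: "shadow ?w (long_cap i' l' @ r)" "caps r = 0"
    note inv = shadow_inv[OF s(1)]
    have "knotted_graph (w @ (long_cap i' l' @ r) @ v)" using knotted_local[OF K(1) inv(1)] .
    then have "f (w @ long_cap i' l' @ (r @ v)) = g (w @ long_cap i' l' @ (r @ v))"
      using snoc.prems p K inv s by (intro snoc.IH) auto
    then show ?thesis using det_shadow[OF s(1)] K by simp
  next
    fix r assume s: "shadow ?w r" "caps r = 0"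
    note inv = shadow_inv[OF s(1)]
    have "knotted_graph (w @ r @ v)" using knotted_local[OF K(1) inv(1)] .
    then have "f (w @ r @ v) = g (w @ r @ v)"
      using snoc.prems p K inv s by (intro assms(1)) auto
    then show ?thesis using det_shadow[OF s(1)] K by simp
  next
    assume *: "e = Cup" "j = i" "l = 0"
    have "knotted_graph (w @ v)"
      using K(1) * by (auto simp: knotted_graph_def tangle_append)
    then have "f (w @ v) = g (w @ v)"
      using snoc.prems p K * by (intro assms(1)) auto
    then show ?thesis using F.circle[of w i v] G.circle[of w i v] K * plus_vf
      by (auto simp: F.\<delta>_def G.\<delta>_def)
  qed
  then show ?case using p by simp
qed

lemma no_caps: "caps D = 0 \<Longrightarrow> tangle m D 0 \<Longrightarrow> D = [] \<and> m = 0"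
proof (induction D arbitrary: m)
  case (Cons p D)
  then show ?case by (cases p; cases "snd p") (auto split: if_splits)
qed simp

lemma det_plus: "knotted_graph D \<Longrightarrow> plus D \<Longrightarrow> nodes D = n \<Longrightarrow> f D = g D"
proof (induction "caps D" arbitrary: D rule: less_induct)
  case less
  show ?case
  proof (cases "\<exists>p\<in>set D. snd p = Cap")
    case False
    then have "caps D = 0" by (auto simp: caps_def filter_empty_conv)
    then have "D = []" using no_caps less.prems by (auto simp: knotted_graph_def)
    then show ?thesis using F.empty G.empty by simp
  next
    case True
    then obtain w p v where D: "D = w @ p # v" "snd p = Cap" "\<forall>y\<in>set w. snd y \<noteq> Cap"
      using split_list_first_prop[OF True] by blast
    then have "caps w = 0" by (auto simp: caps_def filter_empty_conv)
    then show ?thesis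
      using det_long_cap[of "caps D" w "fst p" 0 v] less D by (cases p) auto
  qed
qed

text \<open>The crossings are switched to \<open>XPlus\<close> one after the other from the bottom;
  \<open>u\<close> is the part already treated.\<close>

lemma det_vf:
  assumes "knotted_graph (u @ D)" "vertex_free (u @ D)" "plus u" "nodes (u @ D) = n"
  shows "f (u @ D) = g (u @ D)"
  using assms
proof (induction D arbitrary: u)
  case Nil
  then show ?case using det_plus by simp
next
  case (Cons p D)
  obtain i e where p: "p = (i, e)" by (cases p)
  show ?case
  proof (cases "e = Node XMinus")
    case True
    have "knotted_graph ((u @ [(i, X)]) @ D)" using Cons.prems p True
      by (auto simp: knotted_graph_def tangle_append)
    then have "f ((u @ [(i, X)]) @ D) = g ((u @ [(i, X)]) @ D)"
      by (rule Cons.IH) (use Cons.prems p True in auto)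
    then show ?thesis using flip[of u i D] Cons.prems p True \<open>knotted_graph ((u @ [(i, X)]) @ D)\<close> by auto
  next
    case False
    have "x = XPlus" if "e = Node x" for x
      using that False Cons.prems p by (cases x) auto
    then have "f ((u @ [p]) @ D) = g ((u @ [p]) @ D)"
      using Cons.prems p by (intro Cons.IH) auto
    then show ?thesis by simp
  qed
qed

end

theorem unique:
  "knotted_graph D \<Longrightarrow> vertex_free D \<Longrightarrow> f D = g D"
proof (induction "nodes D" arbitrary: D rule: less_induct)
  case less
  then show ?case using det_vf[of "nodes D" "[]" D] by simp
qed

end

section \<open>Oriented pieces and the relations of the MOY polynomial\<close>

definition shift :: "nat \<Rightarrow> (nat \<times> 'a) list \<Rightarrow> (nat \<times> 'a) list" where
  "shift k = map (\<lambda>(i, e). (k + i, e))"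

lemma shift_simps [simp]:
  "shift k [] = []" "shift k ((i, e) # D) = (k + i, e) # shift k D"
  "shift k (D @ D') = shift k D @ shift k D'" "shift 0 D = D"
  "shift k (shift m D) = shift (k + m) D"
  by (auto simp: shift_def add.assoc)

text \<open>\<open>otangle\<close> together with \<open>crossing_like\<close>, where the existential
  splitting of the ends is replaced by explicit segments. In this form the condition can be
  evaluated on concrete pieces.\<close>

fun ot :: "dir list \<Rightarrow> odiagram \<Rightarrow> dir list \<Rightarrow> bool" where
  "ot ds [] es \<longleftrightarrow> ds = es"
| "ot ds ((i, e) # E) es \<longleftrightarrow> crossing_like e \<and> balanced e \<and> i + length (bot_dirs e) \<le> length ds \<and>
     take (length (bot_dirs e)) (drop i ds) = bot_dirs e \<and>
     ot (take i ds @ top_dirs e @ drop (i + length (bot_dirs e)) ds) E es"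

lemma split_at:
  "(\<exists>l r. length l = i \<and> ds = l @ b @ r \<and> Q l r) \<longleftrightarrow>
   i + length b \<le> length ds \<and> take (length b) (drop i ds) = b \<and> Q (take i ds) (drop (i + length b) ds)"
proof (safe)
  assume *: "i + length b \<le> length ds" "take (length b) (drop i ds) = b" "Q (take i ds) (drop (i + length b) ds)"
  have "ds = take i ds @ b @ drop (i + length b) ds"
    using *(2) by (metis append_take_drop_id drop_drop add.commute)
  then show "\<exists>l r. length l = i \<and> ds = l @ b @ r \<and> Q l r"
    using * by (intro exI[of _ "take i ds"] exI[of _ "drop (i + length b) ds"]) auto
qed auto

lemma otangle_Cons:
  "otangle ds ((i, e) # E) es \<longleftrightarrow> balanced e \<and> i + length (bot_dirs e) \<le> length ds \<and>
     take (length (bot_dirs e)) (drop i ds) = bot_dirs e \<and>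
     otangle (take i ds @ top_dirs e @ drop (i + length (bot_dirs e)) ds) E es"
  using split_at[of i ds "bot_dirs e" "\<lambda>l r. otangle (l @ top_dirs e @ r) E es"] by auto

lemma ot_iff: "ot ds E es \<longleftrightarrow> otangle ds E es \<and> (\<forall>(i, e)\<in>set E. crossing_like e)"
  by (induction ds E es rule: ot.induct) (auto simp: otangle_Cons simp del: otangle.simps(2))

lemma oriented_knotted_iff: "oriented_knotted_graph E \<longleftrightarrow> ot [] E []"
  by (auto simp: ot_iff oriented_knotted_graph_def)

lemma ot_append: "ot ds (E @ E') es \<longleftrightarrow> (\<exists>fs. ot ds E fs \<and> ot fs E' es)"
  by (induction ds E es rule: ot.induct) auto

lemma ot_shift: "ot ds E es \<Longrightarrow> ot (l @ ds @ r) (shift (length l) E) (l @ es @ r)"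
proof (induction ds E es rule: ot.induct)
  case (2 ds i e E es)
  then show ?case by simp
qed simp

lemma plug:
  "ot ds s nd \<Longrightarrow> ot [] u (l @ ds @ r) \<Longrightarrow> ot (l @ nd @ r) w [] \<Longrightarrow> ot [] (u @ shift (length l) s @ w) []"
  using ot_shift ot_append by blast

text \<open>The number of half turns, of which \<open>rot\<close> is one half. It is additive also
  for pieces that are not closed, whereas the division in \<open>rot\<close> is not.\<close>

definition turns :: "odiagram \<Rightarrow> int" where
  "turns E = (\<Sum>(i, e)\<leftarrow>E. half_turns e)"

lemma turns_simps [simp]: "turns [] = 0" "turns ((i, e) # E) = half_turns e + turns E"
  "turns (E @ E') = turns E + turns E'" "turns (shift k E) = turns E"
proof -
  show "turns (shift k E) = turns E" by (induction E) (auto simp: turns_def)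
qed (auto simp: turns_def)

lemma rot_turns: "rot E = turns E div 2"
  by (simp add: rot_def turns_def)

section \<open>Checking isotopies of explicit oriented pieces by evaluation\<close>

lemma underlying_simps [simp]: "underlying [] = []" "underlying ((i, e) # E) = (i, forget e) # underlying E"
  "underlying (E @ E') = underlying E @ underlying E'"
  by (auto simp: underlying_def)

lemma underlying_shift: "underlying (shift k E) = shift k (underlying E)"
  by (auto simp: underlying_def shift_def)

text \<open>An executable sufficient condition for \<open>local_move\<close> when the first side
  consists of two pieces. The positions are compared by equations, so that no offset has to be
  guessed.\<close>

definition is_move2 :: "nat \<Rightarrow> elem \<Rightarrow> nat \<Rightarrow> elem \<Rightarrow> diagram \<Rightarrow> bool" where
  "is_move2 i d j e t \<longleftrightarrow>
     (case t of
        [] \<Rightarrow> d = Cup \<and> e = Cap \<and> (j = i + 1 \<or> i = j + 1) \<or>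
          i = j \<and> (d = Node XPlus \<and> e = Node XMinus \<or> d = Node XMinus \<and> e = Node XPlus)
      | [(j', e'), (i', d')] \<Rightarrow>
          d = d' \<and> e = e' \<and> i = i' \<and> i + top_width d \<le> j \<and> j' + top_width d = j + bot_width d \<or>
          d = Cup \<and> e' = Cup \<and> j = i + 1 \<and> j' = j \<and> i' = i \<and>
            (d', e) \<in> {(Node XPlus, Node XMinus), (Node XMinus, Node XPlus), (Node XVert, Node XVert)} \<or>
          e = Cap \<and> d' = Cap \<and> i = j + 1 \<and> i' = i \<and> j' = j \<and>
            (e', d) \<in> {(Node XPlus, Node XMinus), (Node XMinus, Node XPlus), (Node XVert, Node XVert)}
      | _ \<Rightarrow> False)"

definition is_move3 :: "nat \<Rightarrow> elem \<Rightarrow> nat \<Rightarrow> elem \<Rightarrow> nat \<Rightarrow> elem \<Rightarrow> diagram \<Rightarrow> bool" where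
  "is_move3 i d j e k f t \<longleftrightarrow> is_node d \<and> (e = Node XPlus \<or> e = Node XMinus) \<and> f = e \<and> j = i + 1 \<and> k = i \<and>
     t = [(j, e), (i, e), (j, d)]"

fun is_move :: "diagram \<Rightarrow> diagram \<Rightarrow> bool" where
  "is_move [(i, d), (j, e)] t = is_move2 i d j e t"
| "is_move [(i, d), (j, e), (k, f)] t = is_move3 i d j e k f t"
| "is_move _ t = False"

lemma is_move2_sound:
  assumes "is_move2 i d j e t"
  shows "local_move [(i, d), (j, e)] t"
proof (cases t)
  case Nil
  then show ?thesis using assms local_move.zigzag_left[of i] local_move.zigzag_right[of j]
      local_move.reidemeister2[of XPlus i] local_move.reidemeister2[of XMinus i]
    by (auto simp: is_move2_def)
next
  case (Cons a t')
  with assms obtain j' e' i' d' where t: "t = [(j', e'), (i', d')]"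
    by (cases a; cases t'; cases "tl t'"; cases "hd t'") (auto simp: is_move2_def)
  consider (1) "d = d'" "e = e'" "i = i'" "i + top_width d \<le> j" "j' + top_width d = j + bot_width d"
    | (2) x where "d = Cup" "e' = Cup" "e = Node x" "d' = Node (switch x)" "j = i + 1" "j' = j" "i' = i"
    | (3) x where "e = Cap" "d' = Cap" "d = Node x" "e' = Node (switch x)" "i = j + 1" "i' = i" "j' = j"
    using assms t by (fastforce simp: is_move2_def)
  then show ?thesis
  proof cases
    case 1
    define k where "k = j - (i + top_width d)"
    have "j = i + top_width d + k" "j' = i + bot_width d + k" using 1 by (auto simp: k_def)
    then show ?thesis using local_move.height_exchange[of i d k e] 1 t by simp
  next
    case 2 then show ?thesis using local_move.cup_slide[of i x] t by simp
  next
    case 3 then show ?thesis using local_move.cap_slide[of j x] t by simp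
  qed
qed

lemma is_move_sound: "is_move s t \<Longrightarrow> local_move s t"
proof (induction s t rule: is_move.induct)
  case (1 i d j e t)
  then show ?case using is_move2_sound by simp
next
  case (2 i d j e k f t)
  then show ?case
    using local_move.strand_slide[of XPlus i] local_move.strand_slide[of XMinus i]
    by (cases d) (auto simp: is_move3_def)
qed auto

lemma local_move_shift:
  assumes "local_move s t"
  shows "local_move (shift k s) (shift k t)"
  using assms
proof induction
  case (height_exchange i d m e)
  then show ?case using local_move.height_exchange[of "k + i" d m e] by (simp add: add.assoc)
next
  case (zigzag_left i) then show ?case using local_move.zigzag_left[of "k + i"] by simp
next
  case (zigzag_right i) then show ?case using local_move.zigzag_right[of "k + i"] by simp
next
  case (cup_slide i x) then show ?case using local_move.cup_slide[of "k + i" x] by simp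
next
  case (cap_slide i x) then show ?case using local_move.cap_slide[of "k + i" x] by simp
next
  case (reidemeister2 x i) then show ?case using local_move.reidemeister2[of x "k + i"] by simp
next
  case (strand_slide x i y) then show ?case using local_move.strand_slide[of x "k + i" y] by simp
next
  case (vertex_flip x i) then show ?case using local_move.vertex_flip[of x "k + i"] by simp
qed

text \<open>Searches for a common beginning of length \<open>k\<close> and a common end of length
  \<open>m\<close> such that the two middle parts are related by a move in either direction.\<close>

definition iso_step :: "odiagram \<Rightarrow> odiagram \<Rightarrow> bool" where
  "iso_step s t \<longleftrightarrow> list_ex (\<lambda>k. take k s = take k t \<and> list_ex (\<lambda>m.
     drop (length s - m) s = drop (length t - m) t \<and>
     (let s' = underlying (take (length s - k - m) (drop k s)); t' = underlying (take (length t - k - m) (drop k t))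
      in is_move s' t' \<or> is_move t' s'))
     [0..<Suc (min (length s) (length t) - k)]) [0..<Suc (min (length s) (length t))]"

lemma iso_stepE:
  assumes "iso_step s t"
  obtains p s' t' v where "s = p @ s' @ v" "t = p @ t' @ v"
    "local_move (underlying s') (underlying t') \<or> local_move (underlying t') (underlying s')"
proof -
  obtain k m where km: "take k s = take k t" "drop (length s - m) s = drop (length t - m) t"
    "k \<le> min (length s) (length t)" "m \<le> min (length s) (length t) - k"
    "is_move (underlying (take (length s - k - m) (drop k s))) (underlying (take (length t - k - m) (drop k t)))
    \<or> is_move (underlying (take (length t - k - m) (drop k t))) (underlying (take (length s - k - m) (drop k s)))"
    using assms unfolding iso_step_def list_ex_iff by (auto simp: Let_def less_Suc_eq_le simp del: upt_Suc) 
  have *: "w = take k w @ take (length w - k - m) (drop k w) @ drop (length w - m) w"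
    if "k + m \<le> length w" for w :: odiagram
  proof -
    have "drop (length w - m) w = drop (length w - k - m) (drop k w)" using that by (simp add: add.commute)
    then show ?thesis by (metis append_take_drop_id)
  qed
  show ?thesis
    using that[of "take k s" "take (length s - k - m) (drop k s)" "drop (length s - m) s"
        "take (length t - k - m) (drop k t)"] *[of s] *[of t] km is_move_sound by auto
qed

text \<open>Besides the isotopy, each step must preserve the ends and the number of half turns. The
  latter makes the power of q/a in \<open>G\<close> the same for both pieces.\<close>

fun iso_chain :: "dir list \<Rightarrow> dir list \<Rightarrow> odiagram list \<Rightarrow> bool" where
  "iso_chain ds nd (s # t # xs) \<longleftrightarrow>
     ot ds s nd \<and> ot ds t nd \<and> turns s = turns t \<and> iso_step s t \<and> iso_chain ds nd (t # xs)"
| "iso_chain ds nd _ \<longleftrightarrow> True"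

section \<open>The renormalized invariant and functionals on oriented pieces\<close>

locale moy_point =
  fixes R :: "odiagram \<Rightarrow> 'k::field \<Rightarrow> 'k \<Rightarrow> 'k" and q a :: 'k
  assumes moy: "moy R" and gen: "generic q a"
begin

abbreviation "z \<equiv> q - inverse q"

lemma nz: "q \<noteq> 0" "a \<noteq> 0" "z \<noteq> 0"
  using gen by (auto simp: generic_def)

lemmas moy_rules = mp[OF moy[unfolded moy_def, THEN spec, THEN spec] gen]
lemmas R_iso = moy_rules[THEN conjunct1, rule_format]
lemmas R_empty = moy_rules[THEN conjunct2, THEN conjunct1]
lemmas R_circle = moy_rules[THEN conjunct2, THEN conjunct2, THEN conjunct1, rule_format]
lemmas R_skein = moy_rules[THEN conjunct2, THEN conjunct2, THEN conjunct2, THEN conjunct1, rule_format]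
lemmas R_curl_right = moy_rules[THEN conjunct2, THEN conjunct2, THEN conjunct2, THEN conjunct2, THEN conjunct1, rule_format]
lemmas R_curl_left = moy_rules[THEN conjunct2, THEN conjunct2, THEN conjunct2, THEN conjunct2, THEN conjunct2,
    THEN conjunct1, rule_format]
lemmas R_vertex = moy_rules[THEN conjunct2, THEN conjunct2, THEN conjunct2, THEN conjunct2, THEN conjunct2,
    THEN conjunct2, rule_format, THEN conjunct1]

definition G :: "odiagram \<Rightarrow> 'k" where
  "G E = (inverse a * q) powi rot E * R E q a"

text \<open>The linear functionals on local pieces from \<open>ds\<close> to \<open>nd\<close> that respect all linear relations between
  the pieces which hold in every closed diagram.\<close>

definition lval :: "dir list \<Rightarrow> dir list \<Rightarrow> (odiagram \<Rightarrow> 'k) \<Rightarrow> bool" where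
  "lval ds nd \<psi> \<longleftrightarrow> (\<forall>A. (\<forall>l r u w. ot [] u (l @ ds @ r) \<longrightarrow> ot (l @ nd @ r) w [] \<longrightarrow>
      (\<Sum>(c, p)\<leftarrow>A. c * G (u @ shift (length l) p @ w)) = 0) \<longrightarrow> (\<Sum>(c, p)\<leftarrow>A. c * \<psi> p) = 0)"

lemma lvalD:
  assumes "lval ds nd \<psi>"
    "\<And>l r u w. ot [] u (l @ ds @ r) \<Longrightarrow> ot (l @ nd @ r) w [] \<Longrightarrow>
      (\<Sum>(c, p)\<leftarrow>A. c * G (u @ shift (length l) p @ w)) = 0"
  shows "(\<Sum>(c, p)\<leftarrow>A. c * \<psi> p) = 0"
  using assms unfolding lval_def by blast

text \<open>The parts \<open>p\<close> and \<open>p'\<close> and the strands \<open>l\<close> and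
  \<open>r\<close> beside the piece are absorbed into the surrounding diagram. Thus a relation
  proved for a small piece can be used inside a larger one.\<close>

lemma lval_ctx:
  assumes "lval ds nd \<psi>" "ot ds p (l @ ds' @ r)" "ot (l @ nd' @ r) p' nd" "k = length l"
  shows "lval ds' nd' (\<lambda>s. \<psi> (p @ shift k s @ p'))"
  unfolding lval_def
proof (intro allI impI)
  fix A
  assume A: "\<forall>l r u w. ot [] u (l @ ds' @ r) \<longrightarrow> ot (l @ nd' @ r) w [] \<longrightarrow>
    (\<Sum>(c, p)\<leftarrow>A. c * G (u @ shift (length l) p @ w)) = 0"
  have "(\<Sum>(c, s)\<leftarrow>map (\<lambda>(c, s). (c, p @ shift k s @ p')) A. c * \<psi> s) = 0"
  proof (rule lvalD[OF assms(1)])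
    fix l1 r1 u w assume uw: "ot [] u (l1 @ ds @ r1)" "ot (l1 @ nd @ r1) w []"
    have "ot [] (u @ shift (length l1) p) ((l1 @ l) @ ds' @ (r @ r1))"
      "ot ((l1 @ l) @ nd' @ (r @ r1)) (shift (length l1) p' @ w) []"
      using ot_shift[OF assms(2), of l1 r1] ot_shift[OF assms(3), of l1 r1] uw
      by (auto simp: ot_append)
    then show "(\<Sum>(c, s)\<leftarrow>map (\<lambda>(c, s). (c, p @ shift k s @ p')) A. c * G (u @ shift (length l1) s @ w)) = 0"
      using A[rule_format, of "u @ shift (length l1) p" "l1 @ l" "r @ r1" "shift (length l1) p' @ w"] assms(4)
      by (simp add: comp_def case_prod_unfold)
  qed
  then show "(\<Sum>(c, s)\<leftarrow>A. c * \<psi> (p @ shift k s @ p')) = 0"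
    by (simp add: comp_def case_prod_unfold)
qed

lemma G_iso:
  assumes "ot [] (u @ s @ w) []" "ot [] (u @ t @ w) []" "turns s = turns t"
    "local_move (underlying s) (underlying t) \<or> local_move (underlying t) (underlying s)"
  shows "G (u @ s @ w) = G (u @ t @ w)"
proof -
  have "oriented_isotopy_step (u @ s @ w) (u @ t @ w) \<or> oriented_isotopy_step (u @ t @ w) (u @ s @ w)"
    using assms unfolding oriented_isotopy_step_def oriented_knotted_iff by blast
  then have "oriented_isotopic (u @ s @ w) (u @ t @ w)"
    unfolding oriented_isotopic_def by blast
  then have "R (u @ s @ w) q a = R (u @ t @ w) q a"
    by (rule R_iso)
  then show ?thesis using assms(3) by (simp add: G_def rot_turns)
qed

lemma lval_move:
  assumes "lval ds nd \<psi>" "ot ds (p @ s @ v) nd" "ot ds (p @ t @ v) nd" "turns s = turns t"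
    "local_move (underlying s) (underlying t) \<or> local_move (underlying t) (underlying s)"
  shows "\<psi> (p @ s @ v) = \<psi> (p @ t @ v)"
proof -
  have "(\<Sum>(c, p)\<leftarrow>[(1, p @ s @ v), (- 1, p @ t @ v)]. c * \<psi> p) = 0"
  proof (rule lvalD[OF assms(1)])
    fix l r u w assume uw: "ot [] u (l @ ds @ r)" "ot (l @ nd @ r) w []"
    have "G ((u @ shift (length l) p) @ shift (length l) s @ (shift (length l) v @ w)) =
      G ((u @ shift (length l) p) @ shift (length l) t @ (shift (length l) v @ w))"
    proof (rule G_iso)
      show "ot [] ((u @ shift (length l) p) @ shift (length l) s @ shift (length l) v @ w) []"
        "ot [] ((u @ shift (length l) p) @ shift (length l) t @ shift (length l) v @ w) []"
        using plug[OF assms(2) uw] plug[OF assms(3) uw] by simp_all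
      show "turns (shift (length l) s) = turns (shift (length l) t)" using assms(4) by simp
      show "local_move (underlying (shift (length l) s)) (underlying (shift (length l) t)) \<or>
        local_move (underlying (shift (length l) t)) (underlying (shift (length l) s))"
        using assms(5) local_move_shift unfolding underlying_shift by blast
    qed
    then show "(\<Sum>(c, p)\<leftarrow>[(1, p @ s @ v), (- 1, p @ t @ v)]. c * G (u @ shift (length l) p @ w)) = 0"
      by simp
  qed
  then show ?thesis by simp
qed

lemma lval_step:
  assumes "lval ds nd \<psi>" "ot ds s nd" "ot ds t nd" "turns s = turns t" "iso_step s t"
  shows "\<psi> s = \<psi> t"
  using assms(5)
proof (rule iso_stepE)
  fix p s' t' v
  assume st: "s = p @ s' @ v" "t = p @ t' @ v"
    "local_move (underlying s') (underlying t') \<or> local_move (underlying t') (underlying s')"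
  show ?thesis
    unfolding st(1,2) by (rule lval_move[OF assms(1)]) (use assms(2-4) st in simp_all)
qed

lemma iso_chain:
  assumes "lval ds nd \<psi>" "iso_chain ds nd (s # xs)"
  shows "\<psi> s = \<psi> (last (s # xs))"
  using assms(2)
proof (induction xs arbitrary: s)
  case (Cons t xs)
  then show ?case using lval_step[OF assms(1), of s t] by auto
qed simp

lemma chain:
  assumes "lval ds nd \<psi>" "iso_chain ds nd (s # xs @ [t])"
  shows "\<psi> s = \<psi> t"
  using iso_chain[OF assms] by simp

abbreviation AA :: 'k where "AA \<equiv> a\<^sup>2 * inverse q"

text \<open>The kink factor $a (a^{-1}q)^{\mp 1}$ of \<open>G\<close>, where \<open>d\<close> is the direction of the left leg of the
  extrema.\<close>

definition curl :: "dir \<Rightarrow> 'k" where "curl d = (if d = Up then AA else q)"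

lemma G_powi:
  assumes "turns E = turns E' + 2 * k" "R E q a = c * R E' q a"
  shows "G E = (inverse a * q) powi k * c * G E'"
proof -
  have "rot E = rot E' + k" using assms(1) by (simp add: rot_turns)
  moreover have "inverse a * q \<noteq> 0" using nz by simp
  ultimately show ?thesis using assms(2) by (simp add: G_def power_int_add)
qed

lemma curl_right:
  assumes "lval [d] [d] \<psi>"
  shows "\<psi> [(1, OCup d), (0, ONode XPlus d d d d), (1, OCap d)] = curl d * \<psi> []"
proof -
  let ?s = "[(1, OCup d), (0, ONode XPlus d d d d), (1, OCap d)]"
  have "(\<Sum>(c, p)\<leftarrow>[(1, ?s), (- curl d, [])]. c * \<psi> p) = 0"
  proof (rule lvalD[OF assms])
    fix l r u w assume uw: "ot [] u (l @ [d] @ r)" "ot (l @ [d] @ r) w []"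
    have "ot [d] ?s [d]" by (cases d) simp_all
    from plug[OF this uw]
    have "oriented_knotted_graph (u @ [(length l + 1, OCup d), (length l, ONode XPlus d d d d), (length l + 1, OCap d)] @ w)"
      by (simp add: oriented_knotted_iff)
    then have "R (u @ [(length l + 1, OCup d), (length l, ONode XPlus d d d d), (length l + 1, OCap d)] @ w) q a
      = a * R (u @ w) q a"
      by (rule R_curl_right)
    \<comment> \<open>The minimum and the maximum of the curl turn in the same sense, so together
      they change the rotation number by 1 or -1.\<close>
    from G_powi[OF _ this, of "if d = Down then 1 else - 1"]
    show "(\<Sum>(c, p)\<leftarrow>[(1, ?s), (- curl d, [])]. c * G (u @ shift (length l) p @ w)) = 0"
      using nz by (cases d) (simp_all add: curl_def field_simps power2_eq_square power_int_minus)
  qed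
  then show ?thesis by simp
qed

lemma curl_left:
  assumes "lval [d] [d] \<psi>"
  shows "\<psi> [(0, OCup (opp d)), (1, ONode XPlus d d d d), (0, OCap (opp d))] = curl (opp d) * \<psi> []"
proof -
  let ?s = "[(0, OCup (opp d)), (1, ONode XPlus d d d d), (0, OCap (opp d))]"
  have "(\<Sum>(c, p)\<leftarrow>[(1, ?s), (- curl (opp d), [])]. c * \<psi> p) = 0"
  proof (rule lvalD[OF assms])
    fix l r u w assume uw: "ot [] u (l @ [d] @ r)" "ot (l @ [d] @ r) w []"
    have "ot [d] ?s [d]" by (cases d) simp_all
    from plug[OF this uw]
    have "oriented_knotted_graph (u @ [(length l, OCup (opp d)), (length l + 1, ONode XPlus d d d d), (length l, OCap (opp d))] @ w)"
      by (simp add: oriented_knotted_iff)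
    then have "R (u @ [(length l, OCup (opp d)), (length l + 1, ONode XPlus d d d d), (length l, OCap (opp d))] @ w) q a
      = a * R (u @ w) q a"
      by (rule R_curl_left)
    from G_powi[OF _ this, of "if d = Down then - 1 else 1"]
    show "(\<Sum>(c, p)\<leftarrow>[(1, ?s), (- curl (opp d), [])]. c * G (u @ shift (length l) p @ w)) = 0"
      using nz by (cases d) (simp_all add: curl_def field_simps power2_eq_square power_int_minus)
  qed
  then show ?thesis by simp
qed

section \<open>Skein and vertex relations for all orientations of a node\<close>

lemma skein_up:
  assumes "lval [Up, Up] [Up, Up] \<psi>"
  shows "\<psi> [(0, ONode XPlus Up Up Up Up)] - \<psi> [(0, ONode XMinus Up Up Up Up)] = z * \<psi> []"
proof -
  let ?A = "[(1, [(0, ONode XPlus Up Up Up Up)]), (- 1, [(0, ONode XMinus Up Up Up Up)]), (- z, [])]"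
  have "(\<Sum>(c, p)\<leftarrow>?A. c * \<psi> p) = 0"
  proof (rule lvalD[OF assms])
    fix l r u w assume uw: "ot [] u (l @ [Up, Up] @ r)" "ot (l @ [Up, Up] @ r) w []"
    then have "oriented_knotted_graph (u @ [(length l, ONode XPlus Up Up Up Up)] @ w)"
      using plug[of "[Up, Up]" "[(0, ONode XPlus Up Up Up Up)]" "[Up, Up]" u l r w]
      by (simp add: oriented_knotted_iff)
    then have "R (u @ [(length l, ONode XPlus Up Up Up Up)] @ w) q a
          - R (u @ [(length l, ONode XMinus Up Up Up Up)] @ w) q a = z * R (u @ w) q a"
      by (rule R_skein)
    then have "(inverse a * q) powi rot (u @ w) * (R (u @ [(length l, ONode XPlus Up Up Up Up)] @ w) q a
          - R (u @ [(length l, ONode XMinus Up Up Up Up)] @ w) q a) = (inverse a * q) powi rot (u @ w) * (z * R (u @ w) q a)"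
      by simp
    then show "(\<Sum>(c, p)\<leftarrow>?A. c * G (u @ shift (length l) p @ w)) = 0"
      by (simp add: G_def rot_turns algebra_simps)
  qed
  then show ?thesis by (simp add: algebra_simps)
qed

lemma vertex_up:
  assumes "lval [Up, Up] [Up, Up] \<psi>"
  shows "\<psi> [(0, ONode XVert Up Up Up Up)] = - \<psi> [(0, ONode XPlus Up Up Up Up)] + q * \<psi> []"
proof -
  let ?A = "[(1, [(0, ONode XVert Up Up Up Up)]), (1, [(0, ONode XPlus Up Up Up Up)]), (- q, [])]"
  have "(\<Sum>(c, p)\<leftarrow>?A. c * \<psi> p) = 0"
  proof (rule lvalD[OF assms])
    fix l r u w assume uw: "ot [] u (l @ [Up, Up] @ r)" "ot (l @ [Up, Up] @ r) w []"
    then have "oriented_knotted_graph (u @ [(length l, ONode XVert Up Up Up Up)] @ w)"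
      using plug[of "[Up, Up]" "[(0, ONode XVert Up Up Up Up)]" "[Up, Up]" u l r w]
      by (simp add: oriented_knotted_iff)
    then have "R (u @ [(length l, ONode XVert Up Up Up Up)] @ w) q a
          = - R (u @ [(length l, ONode XPlus Up Up Up Up)] @ w) q a + q * R (u @ w) q a"
      by (rule R_vertex)
    then have "(inverse a * q) powi rot (u @ w) * R (u @ [(length l, ONode XVert Up Up Up Up)] @ w) q a
          = (inverse a * q) powi rot (u @ w) * (- R (u @ [(length l, ONode XPlus Up Up Up Up)] @ w) q a + q * R (u @ w) q a)"
      by simp
    then show "(\<Sum>(c, p)\<leftarrow>?A. c * G (u @ shift (length l) p @ w)) = 0"
      by (simp add: G_def rot_turns algebra_simps)
  qed
  then show ?thesis by (simp add: algebra_simps)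
qed

text \<open>The relations are postulated for upward strands only, so other orientations are reached
  by quarter turns. A zigzag is inserted in the SE strand, its maximum is lifted above the node, and
  the node then slides across the minimum that stays below.\<close>

lemma rotate:
  assumes "lval [b, c] [c, b] \<psi>"
  shows "\<psi> [(0, ONode y b c c b)] = \<psi> [(0, OCup c), (1, ONode (switch y) (opp c) b b (opp c)), (2, OCap (opp c))]"
  by (rule chain[OF assms, of _ "[
      [(1, OCup c), (2, OCap (opp c)), (0, ONode y b c c b)],
      [(1, OCup c), (0, ONode y b c c b), (2, OCap (opp c))]]"]; cases b; cases c; cases y)
    (simp_all only: opp.simps switch.simps, code_simp+)

lemma rotated:
  assumes "lval [b, c] [c, b] \<psi>"
  defines "\<psi>' \<equiv> \<lambda>s. \<psi> ([(0, OCup c)] @ shift 1 s @ [(2, OCap (opp c))])"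
  shows "lval [opp c, b] [b, opp c] \<psi>'" "\<psi> [(0, ONode y b c c b)] = \<psi>' [(0, ONode (switch y) (opp c) b b (opp c))]"
proof -
  show "lval [opp c, b] [b, opp c] \<psi>'" unfolding \<psi>'_def
    by (rule lval_ctx[OF assms(1), where l = "[c]" and r = "[c]"]) (cases c; simp)+
  show "\<psi> [(0, ONode y b c c b)] = \<psi>' [(0, ONode (switch y) (opp c) b b (opp c))]"
    using rotate[OF assms(1)] by (simp add: \<psi>'_def)
qed

text \<open>The oriented smoothing with a sign. \<open>XPlus\<close> is a positive crossing for
  parallel strands (\<open>b = c\<close>) and a negative one for antiparallel strands, where the
  oriented smoothing is H. The sign lets a single skein formula cover both.\<close>

definition smoothing :: "(odiagram \<Rightarrow> 'k) \<Rightarrow> dir \<Rightarrow> dir \<Rightarrow> 'k" where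
  "smoothing \<psi> b c = (if b = c then \<psi> [] else - \<psi> [(0, OCap b), (0, OCup c)])"

lemma smoothing_rotated:
  assumes "lval [b, c] [c, b] \<psi>"
  shows "smoothing (\<lambda>s. \<psi> ([(0, OCup c)] @ shift 1 s @ [(2, OCap (opp c))])) (opp c) b = - smoothing \<psi> b c"
proof (cases "b = c")
  case True
  have "\<psi> [(0, OCup c), (1, OCap (opp c)), (1, OCup c), (2, OCap (opp c))] = \<psi> []"
    by (rule chain[OF assms, of _ "[[(1, OCup c), (2, OCap (opp c))]]"]; cases c)
      (simp_all only: True opp.simps, code_simp+)
  then show ?thesis using True by (cases c) (simp_all add: smoothing_def)
next
  case False
  have "\<psi> [(0, OCup c), (2, OCap (opp c))] = \<psi> [(0, OCap b), (0, OCup c)]"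
    by (rule chain[OF assms, of _ "[]"]; use False in \<open>cases b; cases c\<close>)
      (simp_all only: opp.simps append_Nil, code_simp+)
  then show ?thesis using False by (cases b; cases c) (simp_all add: smoothing_def)
qed

text \<open>A quarter turn exchanges \<open>XPlus\<close> with \<open>XMinus\<close> and changes the
  sign of \<open>smoothing\<close>, so the relation is passed on from one orientation to the next.
  Starting from Up Up the turns reach Up Down, Down Down and Down Up in this order.\<close>

lemma skein:
  assumes "lval [b, c] [c, b] \<psi>"
  shows "\<psi> [(0, ONode XPlus b c c b)] - \<psi> [(0, ONode XMinus b c c b)] = z * smoothing \<psi> b c"
proof -
  have rot: "\<psi> [(0, ONode XPlus b c c b)] - \<psi> [(0, ONode XMinus b c c b)] = z * smoothing \<psi> b c"
    if l: "lval [b, c] [c, b] \<psi>" and prev: "\<And>\<psi>. lval [opp c, b] [b, opp c] \<psi> \<Longrightarrow>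
        \<psi> [(0, ONode XPlus (opp c) b b (opp c))] - \<psi> [(0, ONode XMinus (opp c) b b (opp c))] = z * smoothing \<psi> (opp c) b"
    for b c \<psi>
    using prev[OF rotated(1)[OF l]] rotated(2)[OF l, of XPlus] rotated(2)[OF l, of XMinus] smoothing_rotated[OF l]
    by (simp add: algebra_simps)
  have uu: "\<psi> [(0, ONode XPlus Up Up Up Up)] - \<psi> [(0, ONode XMinus Up Up Up Up)] = z * smoothing \<psi> Up Up"
    if "lval [Up, Up] [Up, Up] \<psi>" for \<psi>
    using skein_up[OF that] by (simp add: smoothing_def)
  have ud: "\<psi> [(0, ONode XPlus Up Down Down Up)] - \<psi> [(0, ONode XMinus Up Down Down Up)] = z * smoothing \<psi> Up Down"
    if "lval [Up, Down] [Down, Up] \<psi>" for \<psi>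
    using rot[OF that] uu by simp
  have dd: "\<psi> [(0, ONode XPlus Down Down Down Down)] - \<psi> [(0, ONode XMinus Down Down Down Down)] = z * smoothing \<psi> Down Down"
    if "lval [Down, Down] [Down, Down] \<psi>" for \<psi>
    using rot[OF that] ud by simp
  have du: "\<psi> [(0, ONode XPlus Down Up Up Down)] - \<psi> [(0, ONode XMinus Down Up Up Down)] = z * smoothing \<psi> Down Up"
    if "lval [Down, Up] [Up, Down] \<psi>" for \<psi>
    using rot[OF that] dd by simp
  show ?thesis using assms uu ud dd du by (cases b; cases c) simp_all
qed

lemma vertex:
  assumes "lval [b, c] [c, b] \<psi>"
  shows "\<psi> [(0, ONode XVert b c c b)] = - \<psi> [(0, ONode XPlus b c c b)]
    + (if b = c then q * \<psi> [] else inverse q * \<psi> [(0, OCap b), (0, OCup c)])"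
proof -
  have rot: "\<psi> [(0, ONode XVert b c c b)] = - \<psi> [(0, ONode XPlus b c c b)] + (if b = c then q else - inverse q) * smoothing \<psi> b c"
    if l: "lval [b, c] [c, b] \<psi>" and prev: "\<And>\<psi>. lval [opp c, b] [b, opp c] \<psi> \<Longrightarrow>
        \<psi> [(0, ONode XVert (opp c) b b (opp c))] = - \<psi> [(0, ONode XPlus (opp c) b b (opp c))] +
        (if opp c = b then q else - inverse q) * smoothing \<psi> (opp c) b"
    for b c \<psi>
  proof -
    let ?k = "\<lambda>b c. if b = c then q else - inverse q"
    define X' where "X' = \<psi> [(0, ONode XMinus b c c b)]"
    have X: "\<psi> [(0, ONode XPlus b c c b)] = X' + z * smoothing \<psi> b c"
      using skein[OF l] by (simp add: X'_def algebra_simps)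
    have "\<psi> [(0, ONode XVert b c c b)] = - X' - ?k (opp c) b * smoothing \<psi> b c"
      unfolding X'_def rotated(2)[OF l] switch.simps prev[OF rotated(1)[OF l]] smoothing_rotated[OF l] by simp
    \<comment> \<open>A quarter turn produces \<open>XMinus\<close> instead of \<open>XPlus\<close>,
      and the skein relation corrects this at the cost of \<open>z\<close>. The coefficients q and
      -1/q of the two kinds of orientation add up to \<open>z\<close>.\<close>
    moreover have k: "z - ?k (opp c) b = ?k b c" by (cases b; cases c) simp_all
    ultimately show ?thesis unfolding X k[symmetric] by (simp add: algebra_simps)
  qed
  have uu: "\<psi> [(0, ONode XVert Up Up Up Up)] = - \<psi> [(0, ONode XPlus Up Up Up Up)] + (if Up = Up then q else - inverse q) * smoothing \<psi> Up Up"
    if "lval [Up, Up] [Up, Up] \<psi>" for \<psi>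
    using vertex_up[OF that] by (simp add: smoothing_def)
  have ud: "\<psi> [(0, ONode XVert Up Down Down Up)] = - \<psi> [(0, ONode XPlus Up Down Down Up)] + (if Up = Down then q else - inverse q) * smoothing \<psi> Up Down"
    if "lval [Up, Down] [Down, Up] \<psi>" for \<psi>
    using rot[OF that] uu by simp
  have dd: "\<psi> [(0, ONode XVert Down Down Down Down)] = - \<psi> [(0, ONode XPlus Down Down Down Down)] + (if Down = Down then q else - inverse q) * smoothing \<psi> Down Down"
    if "lval [Down, Down] [Down, Down] \<psi>" for \<psi>
    using rot[OF that] ud by simp
  have du: "\<psi> [(0, ONode XVert Down Up Up Down)] = - \<psi> [(0, ONode XPlus Down Up Up Down)] + (if Down = Up then q else - inverse q) * smoothing \<psi> Down Up"
    if "lval [Down, Up] [Up, Down] \<psi>" for \<psi>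
    using rot[OF that] dd by simp
  show ?thesis using assms uu ud dd du by (cases b; cases c) (simp_all add: smoothing_def)
qed

section \<open>Oriented twists at extrema\<close>

lemma cap_twist:
  assumes "lval [b, c] [] \<psi>" "c = opp b"
  shows "\<psi> [(0, ONode XMinus b c c b), (0, OCap c)] = curl c * \<psi> [(0, OCap b)]"
proof -
  \<comment> \<open>As for unoriented diagrams the twist is turned into a curl on the right of a
    strand. The extrema of that curl have direction \<open>c\<close> on the left, which selects the
    factor \<open>curl c\<close>.\<close>
  have "\<psi> [(0, ONode XMinus b c c b), (0, OCap c)]
    = \<psi> [(2, OCup c), (1, ONode XPlus c c c c), (2, OCap c), (0, OCap b)]"
    by (rule chain[OF assms(1), of _ "[
       [(1, OCup c), (0, OCap b), (0, ONode XMinus b c c b), (0, OCap c)],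
       [(1, OCup c), (2, ONode XMinus b c c b), (0, OCap b), (0, OCap c)],
       [(1, OCup c), (2, ONode XMinus b c c b), (2, OCap c), (0, OCap b)]]"]; unfold assms(2); cases b)
      (simp_all only: opp.simps, code_simp+)
  also have "\<dots> = curl c * \<psi> [(0, OCap b)]"
  proof -
    have "lval [c] [c] (\<lambda>s. \<psi> ([] @ shift 1 s @ [(0, OCap b)]))"
      by (rule lval_ctx[OF assms(1), where l = "[b]" and r = "[]"]) (use assms(2) in auto)
    from curl_right[OF this] show ?thesis by (simp add: numeral_2_eq_2)
  qed
  finally show ?thesis .
qed

lemma cup_twist:
  assumes "lval [] [c, d] \<psi>" "c = opp d"
  shows "\<psi> [(0, OCup d), (0, ONode XMinus d c c d)] = curl d * \<psi> [(0, OCup c)]"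
proof -
  have "\<psi> [(0, OCup d), (0, ONode XMinus d c c d)]
    = \<psi> [(0, OCup c), (2, OCup d), (1, ONode XPlus d d d d), (2, OCap d)]"
    by (rule chain[OF assms(1), of _ "[
       [(0, OCup d), (0, ONode XMinus d c c d), (0, OCup c), (1, OCap d)],
       [(0, OCup d), (0, OCup c), (2, ONode XMinus d c c d), (1, OCap d)],
       [(0, OCup c), (2, OCup d), (2, ONode XMinus d c c d), (1, OCap d)]]"]; unfold assms(2); cases d)
      (simp_all only: opp.simps, code_simp+)
  also have "\<dots> = curl d * \<psi> [(0, OCup c)]"
  proof -
    have "lval [d] [d] (\<lambda>s. \<psi> ([(0, OCup c)] @ shift 1 s @ []))"
      by (rule lval_ctx[OF assms(1), where l = "[c]" and r = "[]"]) (use assms(2) in \<open>cases d; auto\<close>)+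
    from curl_right[OF this] show ?thesis by (simp add: numeral_2_eq_2)
  qed
  finally show ?thesis .
qed

lemma curl_nz: "curl d \<noteq> 0"
  using nz by (simp add: curl_def)

lemma cap_twist_inv:
  assumes "lval [b, c] [] \<psi>" "c = opp b"
  shows "\<psi> [(0, ONode XPlus b c c b), (0, OCap c)] = inverse (curl b) * \<psi> [(0, OCap b)]"
proof -
  have "\<psi> [(0, OCap b)] = \<psi> [(0, ONode XPlus b c c b), (0, ONode XMinus c b b c), (0, OCap b)]"
    by (rule chain[OF assms(1), of _ "[]"]; unfold assms(2); cases b)
      (simp_all only: opp.simps append_Nil, code_simp+)
  also have "\<dots> = curl b * \<psi> [(0, ONode XPlus b c c b), (0, OCap c)]"
  proof -
    have "lval [c, b] [] (\<lambda>s. \<psi> ([(0, ONode XPlus b c c b)] @ shift 0 s @ []))"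
      by (rule lval_ctx[OF assms(1), where l = "[]" and r = "[]"]) (use assms(2) in \<open>cases b; auto\<close>)+
    from cap_twist[OF this] show ?thesis using assms(2) by (cases b) simp_all
  qed
  finally show ?thesis using curl_nz[of b] by simp
qed

end

section \<open>The state sum\<close>

fun orients :: "elem \<Rightarrow> oelem list" where
  "orients Cup = [OCup Up, OCup Down]"
| "orients Cap = [OCap Up, OCap Down]"
| "orients (Node x) = [ONode x sw se nw ne. sw \<leftarrow> [Up, Down], se \<leftarrow> [Up, Down],
     nw \<leftarrow> [Up, Down], ne \<leftarrow> [Up, Down]]"

definition choice_list :: "oelem \<Rightarrow> res list" where
  "choice_list e = (if top_outward e then [ResA, ResB]
                else if non_crossing_like_vertex e then [ResL, ResR]
                else [NoRes])"

text \<open>Each state is given by its weight, the resolved piece and the directions at the top. The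
  use of lists instead of sets lets the simplifier expand the local sums into explicit
  terms.\<close>

definition local_states :: "'k::field \<Rightarrow> elem \<Rightarrow> dir list \<Rightarrow> ('k \<times> odiagram \<times> dir list) list" where
  "local_states q e ds = [(local_weight q r, resolve_at (0, o') r, top_dirs o').
     o' \<leftarrow> filter (\<lambda>o'. bot_dirs o' = ds \<and> balanced o' \<and> \<not> top_inward o') (orients e), r \<leftarrow> choice_list o']"

text \<open>Parallel ends at the bottom of a node leave only the node itself. For antiparallel ends
  a crossing either has the two smoothings as well, or the nontransversal orientation is top inward
  and contributes nothing. A vertex always has both smoothings.\<close>

lemma local_states_simps [simp]:
  "local_states q Cup [] = [(1, [(0, OCup Up)], [Up, Down]), (1, [(0, OCup Down)], [Down, Up])]"
  "local_states q (Node XPlus) [Up, Up] = [(1, [(0, ONode XPlus Up Up Up Up)], [Up, Up])]"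
  "local_states q (Node XPlus) [Down, Down] = [(1, [(0, ONode XPlus Down Down Down Down)], [Down, Down])]"
  "local_states q (Node XPlus) [Up, Down] = [(1, [(0, ONode XPlus Up Down Down Up)], [Down, Up])]"
  "local_states q (Node XPlus) [Down, Up] = [(1, [(0, ONode XPlus Down Up Up Down)], [Up, Down]),
     (q - inverse q, [], [Down, Up]), (- (q - inverse q), [(0, OCap Down), (0, OCup Down)], [Down, Up])]"
  "local_states q (Node XMinus) [Up, Up] = [(1, [(0, ONode XMinus Up Up Up Up)], [Up, Up])]"
  "local_states q (Node XMinus) [Down, Down] = [(1, [(0, ONode XMinus Down Down Down Down)], [Down, Down])]"
  "local_states q (Node XMinus) [Down, Up] = [(1, [(0, ONode XMinus Down Up Up Down)], [Up, Down])]"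
  "local_states q (Node XMinus) [Up, Down] = [
     (q - inverse q, [(0, OCap Up), (0, OCup Up)], [Up, Down]), (- (q - inverse q), [], [Up, Down]),
     (1, [(0, ONode XMinus Up Down Down Up)], [Down, Up])]"
  "local_states q (Node XVert) [Up, Up] = [(1, [(0, ONode XVert Up Up Up Up)], [Up, Up])]"
  "local_states q (Node XVert) [Down, Down] = [(1, [(0, ONode XVert Down Down Down Down)], [Down, Down])]"
  "local_states q (Node XVert) [Down, Up] = [(1, [(0, ONode XVert Down Up Up Down)], [Up, Down]),
     (q, [(0, OCap Down), (0, OCup Down)], [Down, Up]), (inverse q, [], [Down, Up])]"
  "local_states q (Node XVert) [Up, Down] = [(q, [], [Up, Down]),
     (inverse q, [(0, OCap Up), (0, OCup Up)], [Up, Down]), (1, [(0, ONode XVert Up Down Down Up)], [Down, Up])]"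
  by (simp_all add: local_states_def choice_list_def)

lemma local_states_Cap [simp]:
  "local_states q Cap [b, c] = (if c = opp b then [(1, [(0, OCap b)], [])] else [])"
  by (cases b; cases c) (simp_all add: local_states_def choice_list_def)

lemma local_states_ot:
  assumes "(c, p, t) \<in> set (local_states q e ds)"
  shows "ot ds p t" "length ds = bot_width e" "length t = top_width e"
proof -
  obtain o' r where o': "o' \<in> set (orients e)" "bot_dirs o' = ds" "balanced o'" "r \<in> set (choice_list o')"
    "p = resolve_at (0, o') r" "t = top_dirs o'" "\<not> top_inward o'"
    using assms by (auto simp: local_states_def)
  have "forget o' = e" using o'(1) by (cases e) auto
  then show "length ds = bot_width e" "length t = top_width e"
    using o'(2,5,6) by (cases o'; auto)+
  show "ot ds p t" unfolding o'(2)[symmetric] o'(5,6)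
  proof (cases o')
    case (ONode x sw se nw ne)
    then show "ot (bot_dirs o') (resolve_at (0, o') r) (top_dirs o')" using o'(3,4,7)
      by (cases x; cases sw; cases se; cases nw; cases ne) (auto simp: choice_list_def)
  qed (use o'(4) in \<open>auto simp: choice_list_def\<close>)
qed

text \<open>The state sum of a piece with ends \<open>ds\<close> at the bottom.  The function \<open>h\<close> evaluates a state, given
  by its ends at the top and the resolved piece.\<close>

fun ev :: "'k::field \<Rightarrow> dir list \<Rightarrow> diagram \<Rightarrow> (dir list \<Rightarrow> odiagram \<Rightarrow> 'k) \<Rightarrow> 'k" where
  "ev q ds [] h = h ds []"
| "ev q ds ((i, e) # D) h = (if i + bot_width e \<le> length ds
     then \<Sum>(c, p, t)\<leftarrow>local_states q e (take (bot_width e) (drop i ds)).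
       c * ev q (take i ds @ t @ drop (i + bot_width e) ds) D (\<lambda>nd p'. h nd (shift i p @ p'))
     else 0)"

section \<open>Linearity and locality of the evaluation of states\<close>

lemma ev_append: "ev q ds (D @ D') h = ev q ds D (\<lambda>nd p. ev q nd D' (\<lambda>nd' p'. h nd' (p @ p')))"
proof (induction D arbitrary: ds h)
  case (Cons p D)
  then show ?case by (cases p) (simp cong: if_cong)
qed simp

lemma take_drop3: "ds = take i ds @ take m (drop i ds) @ drop (i + m) ds"
proof -
  have "drop (i + m) ds = drop m (drop i ds)" by (simp add: add.commute)
  then show ?thesis by (simp only: append_take_drop_id)
qed

lemma sum_list_cong: "(\<And>y. y \<in> set ys \<Longrightarrow> f y = g y) \<Longrightarrow> (\<Sum>y\<leftarrow>ys. f y) = (\<Sum>y\<leftarrow>ys. g y)"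
  by (rule arg_cong[of _ _ sum_list]) simp

lemma tangle_det: "tangle m D n \<Longrightarrow> tangle m D n' \<Longrightarrow> n = n'"
  by (induction m D n rule: tangle.induct) auto

lemma ev_cong:
  assumes "\<And>nd p. ot ds p nd \<Longrightarrow> tangle (length ds) D (length nd) \<Longrightarrow> h nd p = h' nd p"
  shows "ev q ds D h = ev q ds D h'"
  using assms
proof (induction D arbitrary: ds h h')
  case (Cons x D)
  obtain i e where x: "x = (i, e)" by (cases x)
  show ?case
  proof (cases "i + bot_width e \<le> length ds")
    case True
    let ?nd = "\<lambda>t. take i ds @ t @ drop (i + bot_width e) ds"
    have "ev q (?nd t) D (\<lambda>nd p'. h nd (shift i p @ p')) = ev q (?nd t) D (\<lambda>nd p'. h' nd (shift i p @ p'))"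
      if s: "(c, p, t) \<in> set (local_states q e (take (bot_width e) (drop i ds)))" for c p t
    proof (rule Cons.IH)
      fix nd p' assume *: "ot (?nd t) p' nd" "tangle (length (?nd t)) D (length nd)"
      have "ds = take i ds @ take (bot_width e) (drop i ds) @ drop (i + bot_width e) ds"
        by (rule take_drop3)
      then have "ot ds (shift i p) (?nd t)"
        using ot_shift[OF local_states_ot(1)[OF s], of "take i ds" "drop (i + bot_width e) ds"] True by simp
      then have "ot ds (shift i p @ p') nd" using *(1) by (auto simp: ot_append)
      moreover have "tangle (length ds) (x # D) (length nd)"
        using *(2) True local_states_ot(3)[OF s] x by (simp add: add_ac)
      ultimately show "h nd (shift i p @ p') = h' nd (shift i p @ p')" by (rule Cons.prems)
    qed
    then show ?thesis using True x by (auto intro!: sum_list_cong)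
  qed (simp add: x)
qed simp

lemma ev_0: "ev q ds D (\<lambda>nd p. 0) = 0"
proof (induction D arbitrary: ds)
  case (Cons x D)
  then show ?case by (cases x) (simp add: case_prod_unfold)
qed simp

lemma ev_add: "ev q ds D (\<lambda>nd p. h nd p + h' nd p) = ev q ds D h + ev q ds D h'"
proof (induction D arbitrary: ds h h')
  case (Cons x D)
  then show ?case by (cases x) (simp add: case_prod_unfold sum_list_addf[symmetric] algebra_simps)
qed simp

lemma ev_mult: "ev q ds D (\<lambda>nd p. c * h nd p) = c * ev q ds D h"
proof (induction D arbitrary: ds h)
  case (Cons x D)
  then show ?case by (cases x) (simp add: case_prod_unfold sum_list_const_mult[symmetric] algebra_simps)
qed simp

lemma ev_sum_list: "(\<Sum>(c, s)\<leftarrow>A. c * ev q ds D (h s)) = ev q ds D (\<lambda>nd p. \<Sum>(c, s)\<leftarrow>A. c * h s nd p)"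
  by (induction A) (auto simp: ev_0 ev_add ev_mult)

lemma ev_shift:
  assumes "tangle (length ds) s n"
  shows "ev q (l @ ds @ r) (shift (length l) s) h = ev q ds s (\<lambda>nd p. h (l @ nd @ r) (shift (length l) p))"
  using assms
proof (induction s arbitrary: ds h)
  case (Cons x s)
  obtain i e where x: "x = (i, e)" by (cases x)
  have le: "i + bot_width e \<le> length ds" using Cons.prems x by simp
  have "ev q (l @ (take i ds @ t @ drop (i + bot_width e) ds) @ r) (shift (length l) s)
      (\<lambda>nd p'. h nd (shift (length l + i) p @ p'))
    = ev q (take i ds @ t @ drop (i + bot_width e) ds) s (\<lambda>nd p'. h (l @ nd @ r) (shift (length l + i) p @ shift (length l) p'))"
    if "(c, p, t) \<in> set (local_states q e (take (bot_width e) (drop i ds)))" for c p t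
  proof (rule Cons.IH)
    have "length (take i ds @ t @ drop (i + bot_width e) ds) = length ds - bot_width e + top_width e"
      using le local_states_ot(3)[OF that] by simp
    then show "tangle (length (take i ds @ t @ drop (i + bot_width e) ds)) s n"
      using Cons.prems by (simp only: x tangle.simps)
  qed
  then show ?case using x le by (auto intro!: sum_list_cong)
qed simp

section \<open>Reduction of relations to local pieces\<close>

context moy_point
begin

definition F :: "diagram \<Rightarrow> 'k" where
  "F D = ev q [] D (\<lambda>nd p. if nd = [] then G p else 0)"

text \<open>By linearity the value on a combination of pieces is a sum over the states of
  \<open>v\<close> of the corresponding combinations of closed diagrams, and each of these
  vanishes.\<close>

lemma lval_ev:
  assumes "ot [] u (l @ ds @ r)"
  shows "lval ds nd (\<lambda>p. ev q (l @ nd @ r) v (\<lambda>e w. if e = [] then G (u @ shift (length l) p @ w) else 0))"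
  unfolding lval_def
proof (intro allI impI)
  fix A assume A: "\<forall>l r u w. ot [] u (l @ ds @ r) \<longrightarrow> ot (l @ nd @ r) w [] \<longrightarrow>
      (\<Sum>(c, p)\<leftarrow>A. c * G (u @ shift (length l) p @ w)) = 0"
  have "(\<Sum>(c, p)\<leftarrow>A. c * ev q (l @ nd @ r) v (\<lambda>e w. if e = [] then G (u @ shift (length l) p @ w) else 0))
    = ev q (l @ nd @ r) v (\<lambda>e w. \<Sum>(c, p)\<leftarrow>A. c * (if e = [] then G (u @ shift (length l) p @ w) else 0))"
    using ev_sum_list[where h = "\<lambda>p e w. if e = [] then G (u @ shift (length l) p @ w) else 0"]
    by simp
  also have "\<dots> = ev q (l @ nd @ r) v (\<lambda>e w. 0)"
  proof (rule ev_cong)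
    fix e w assume e: "ot (l @ nd @ r) w e"
    show "(\<Sum>(c, p)\<leftarrow>A. c * (if e = [] then G (u @ shift (length l) p @ w) else 0)) = 0"
      using A[rule_format, OF assms, of w] e by (cases "e = []") (simp_all add: case_prod_unfold)
  qed
  finally show "(\<Sum>(c, p)\<leftarrow>A. c * ev q (l @ nd @ r) v (\<lambda>e w. if e = [] then G (u @ shift (length l) p @ w) else 0)) = 0"
    by (simp add: ev_0)
qed

text \<open>The state of the part \<open>u\<close> and the strands beside the piece are fixed. The
  sum over the states of \<open>v\<close> then depends on the piece through a family of functionals
  indexed by the ends at its top, since these decide which states of \<open>v\<close> can
  follow.\<close>

lemma F_local:
  assumes "\<And>ds \<Psi>. length ds = m \<Longrightarrow> (\<And>nd. lval ds nd (\<Psi> nd)) \<Longrightarrow> (\<Sum>(c, s)\<leftarrow>A. c * ev q ds s \<Psi>) = 0"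
    and "\<And>c s. (c, s) \<in> set A \<Longrightarrow> \<exists>n. tangle m s n"
    and "tangle 0 u j" "i + m \<le> j"
  shows "(\<Sum>(c, s)\<leftarrow>A. c * F (u @ shift i s @ v)) = 0"
proof -
  let ?h = "\<lambda>s d p. ev q d (shift i s) (\<lambda>d' p'. ev q d' v (\<lambda>e w. if e = [] then G (p @ p' @ w) else 0))"
  have "(\<Sum>(c, s)\<leftarrow>A. c * F (u @ shift i s @ v)) = (\<Sum>(c, s)\<leftarrow>A. c * ev q [] u (?h s))"
    by (simp add: F_def ev_append)
  also have "\<dots> = ev q [] u (\<lambda>d p. \<Sum>(c, s)\<leftarrow>A. c * ?h s d p)"
    by (rule ev_sum_list)
  also have "\<dots> = ev q [] u (\<lambda>d p. 0)"
  proof (rule ev_cong)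
    fix d p assume d: "ot [] p d" "tangle (length ([]::dir list)) u (length d)"
    then have len: "i + m \<le> length d" using tangle_det[OF assms(3), of "length d"] assms(4) by simp
    define l ds r where "l = take i d" and "ds = take m (drop i d)" and "r = drop (i + m) d"
    have dd: "d = l @ ds @ r" unfolding l_def ds_def r_def
      by (rule take_drop3)
    have L: "length l = i" "length ds = m" using len by (auto simp: l_def ds_def)
    define \<Psi> where "\<Psi> nd p' = ev q (l @ nd @ r) v (\<lambda>e w. if e = [] then G (p @ shift (length l) p' @ w) else 0)" for nd p'
    have "?h s d p = ev q ds s \<Psi>" if cs: "(c, s) \<in> set A" for c s
    proof -
      obtain n where "tangle (length ds) s n" using assms(2)[OF cs] L by blast
      from ev_shift[OF this, of q l r] show ?thesis unfolding dd L(1)[symmetric] \<Psi>_def .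
    qed
    then have "(\<Sum>(c, s)\<leftarrow>A. c * ?h s d p) = (\<Sum>(c, s)\<leftarrow>A. c * ev q ds s \<Psi>)"
      by (intro sum_list_cong) auto
    also have "\<dots> = 0"
    proof (rule assms(1)[OF L(2)])
      show "lval ds nd (\<Psi> nd)" for nd
        unfolding \<Psi>_def using lval_ev[of p l ds r nd v] d(1) unfolding dd by simp
    qed
    finally show "(\<Sum>(c, s)\<leftarrow>A. c * ?h s d p) = 0" .
  qed
  finally show ?thesis by (simp add: ev_0)
qed

end

section \<open>Local identities of the state sum\<close>

context moy_point
begin

lemma skein_at:
  assumes "lval ds nd \<psi>" "ot ds p (l @ [b, c] @ r)" "ot (l @ [c, b] @ r) p' nd" "k = length l"
  shows "\<psi> (p @ [(k, ONode XPlus b c c b)] @ p') - \<psi> (p @ [(k, ONode XMinus b c c b)] @ p')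
    = z * (if b = c then \<psi> (p @ p') else - \<psi> (p @ [(k, OCap b), (k, OCup c)] @ p'))"
  using skein[OF lval_ctx[OF assms(1-4)]] by (simp add: smoothing_def)

text \<open>This and the next relation are the parallel and the antiparallel case of the skein
  relation inside a larger piece, solved for the \<open>XPlus\<close> term so that they eliminate
  positive nodes.\<close>

lemma skein_same:
  assumes "lval ds nd \<psi>" "ot ds p (l @ [b, b] @ r)" "ot (l @ [b, b] @ r) p' nd" "k = length l"
  shows "\<psi> (p @ [(k, ONode XPlus b b b b)] @ p') = \<psi> (p @ [(k, ONode XMinus b b b b)] @ p') + z * \<psi> (p @ p')"
  using skein_at[OF assms] by (simp only: if_True refl diff_eq_eq add.commute)

lemma skein_diff:
  assumes "lval ds nd \<psi>" "ot ds p (l @ [b, c] @ r)" "ot (l @ [c, b] @ r) p' nd" "k = length l" "b \<noteq> c"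
  shows "\<psi> (p @ [(k, ONode XPlus b c c b)] @ p')
    = \<psi> (p @ [(k, ONode XMinus b c c b)] @ p') - z * \<psi> (p @ [(k, OCap b), (k, OCup c)] @ p')"
  using skein_at[OF assms(1-4)] assms(5) by (simp add: algebra_simps)

lemma cap_twist_inv_at:
  assumes "lval ds nd \<psi>" "ot ds p (l @ [b, c] @ r)" "ot (l @ r) p' nd" "k = length l" "c = opp b"
  shows "\<psi> (p @ [(k, ONode XPlus b c c b), (k, OCap c)] @ p') = inverse (curl b) * \<psi> (p @ [(k, OCap b)] @ p')"
  using cap_twist_inv[OF lval_ctx[OF assms(1,2), of "[]" p' k]] assms(3-) by simp

lemma cup_twist_at:
  assumes "lval ds nd \<psi>" "ot ds p (l @ r)" "ot (l @ [c, d] @ r) p' nd" "k = length l" "c = opp d"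
  shows "\<psi> (p @ [(k, OCup d), (k, ONode XMinus d c c d)] @ p') = curl d * \<psi> (p @ [(k, OCup c)] @ p')"
  using cup_twist[OF lval_ctx[OF assms(1), of p l "[]" r "[c, d]" p' k]] assms(2-) by simp

lemma curl_left_at:
  assumes "lval ds nd \<psi>" "ot ds p (l @ [d] @ r)" "ot (l @ [d] @ r) p' nd" "k = length l" "k' = Suc k" "e = opp d"
  shows "\<psi> (p @ [(k, OCup e), (k', ONode XPlus d d d d), (k, OCap e)] @ p') = curl e * \<psi> (p @ p')"
  using curl_left[OF lval_ctx[OF assms(1-4)]] assms(5-) by simp

lemma curl_right_at:
  assumes "lval ds nd \<psi>" "ot ds p (l @ [d] @ r)" "ot (l @ [d] @ r) p' nd" "k = length l" "k' = Suc k"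
  shows "\<psi> (p @ [(k', OCup d), (k, ONode XPlus d d d d), (k', OCap d)] @ p') = curl d * \<psi> (p @ p')"
  using curl_right[OF lval_ctx[OF assms(1-4)]] assms(5-) by simp

end

abbreviation "xp i b c \<equiv> (i :: nat, ONode XPlus b c c b)"
abbreviation "xm i b c \<equiv> (i :: nat, ONode XMinus b c c b)"
abbreviation "xv i b c \<equiv> (i :: nat, ONode XVert b c c b)"
abbreviation "cu i d \<equiv> (i :: nat, OCup d)"
abbreviation "ca i d \<equiv> (i :: nat, OCap d)"

context moy_point
begin

section \<open>Planar moves, one list of directions at a time\<close>

lemma dirs_1: "length (ds :: dir list) = 1 \<Longrightarrow> ds = [Up] \<or> ds = [Down]"
  by (cases ds; cases "hd ds") auto

lemma dirs_2: "length (ds :: dir list) = 2 \<Longrightarrow> ds = [Up, Up] \<or> ds = [Up, Down] \<or> ds = [Down, Up] \<or> ds = [Down, Down]"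
  using dirs_1[of "tl ds"] by (cases ds; cases "hd ds") auto

lemma dirs_3: "length (ds :: dir list) = 3 \<Longrightarrow> ds = [Up, Up, Up] \<or> ds = [Up, Up, Down] \<or> ds = [Up, Down, Up] \<or>
    ds = [Up, Down, Down] \<or> ds = [Down, Up, Up] \<or> ds = [Down, Up, Down] \<or> ds = [Down, Down, Up] \<or> ds = [Down, Down, Down]"
  using dirs_2[of "tl ds"] by (cases ds; cases "hd ds") auto

text \<open>The pattern of all identities of this kind: for fixed ends at the bottom both sides
  expand into explicit sums of states. The facts named \<open>f\<close> identify states by isotopy,
  those named \<open>g\<close> express them by kink or skein relations, and the rest is algebra in
  \<open>q\<close> and \<open>a\<close>.\<close>

lemma ev_zigzag1:
  assumes len: "length ds = 1" and H: "\<And>nd. lval ds nd (\<Psi> nd)"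
  shows "ev q ds [(0, Cup), (1, Cap)] \<Psi> = \<Psi> ds []"
proof -
  have c0: "ev q [Up] [(0, Cup), (1, Cap)] \<Psi> = \<Psi> [Up] []" if H: "\<And>nd. lval [Up] nd (\<Psi> nd)"
  proof -
    have f1: "\<Psi> [Up] [cu 0 Up, ca (Suc 0) Down] = \<Psi> [Up] []"
      by (rule chain[OF H, of _ _ "[]"]) code_simp
    show ?thesis by (simp add: f1) (simp add: algebra_simps)?
  qed
  have c1: "ev q [Down] [(0, Cup), (1, Cap)] \<Psi>
      = \<Psi> [Down] []" if H: "\<And>nd. lval [Down] nd (\<Psi> nd)"
  proof -
    have f1: "\<Psi> [Down] [cu 0 Down, ca (Suc 0) Up] = \<Psi> [Down] []"
      by (rule chain[OF H, of _ _ "[]"]) code_simp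
    show ?thesis by (simp add: f1) (simp add: algebra_simps)?
  qed
  from dirs_1[OF len] show ?thesis
  proof (elim disjE)
    assume d: "ds = [Up]"
    show ?thesis unfolding d by (rule c0) (rule H[unfolded d])
  next
    assume d: "ds = [Down]"
    show ?thesis unfolding d by (rule c1) (rule H[unfolded d])
  qed
qed

lemma ev_zigzag2:
  assumes len: "length ds = 1" and H: "\<And>nd. lval ds nd (\<Psi> nd)"
  shows "ev q ds [(1, Cup), (0, Cap)] \<Psi> = \<Psi> ds []"
proof -
  have c0: "ev q [Up] [(1, Cup), (0, Cap)] \<Psi> = \<Psi> [Up] []" if H: "\<And>nd. lval [Up] nd (\<Psi> nd)"
  proof -
    have f1: "\<Psi> [Up] [cu (Suc 0) Down, ca 0 Up] = \<Psi> [Up] []"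
      by (rule chain[OF H, of _ _ "[]"]) code_simp
    show ?thesis by (simp add: f1) (simp add: algebra_simps)?
  qed
  have c1: "ev q [Down] [(1, Cup), (0, Cap)] \<Psi>
      = \<Psi> [Down] []" if H: "\<And>nd. lval [Down] nd (\<Psi> nd)"
  proof -
    have f1: "\<Psi> [Down] [cu (Suc 0) Up, ca 0 Down] = \<Psi> [Down] []"
      by (rule chain[OF H, of _ _ "[]"]) code_simp
    show ?thesis by (simp add: f1) (simp add: algebra_simps)?
  qed
  from dirs_1[OF len] show ?thesis
  proof (elim disjE)
    assume d: "ds = [Up]"
    show ?thesis unfolding d by (rule c0) (rule H[unfolded d])
  next
    assume d: "ds = [Down]"
    show ?thesis unfolding d by (rule c1) (rule H[unfolded d])
  qed
qed

text \<open>A quarter turn preserves top outward crossings and the distinction between right and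
  left turns. So the states of the two sides correspond with equal weights, and smoothed states
  differ by a zigzag.\<close>

lemma ev_cupslideX:
  assumes len: "length ds = 1" and H: "\<And>nd. lval ds nd (\<Psi> nd)"
  shows "ev q ds [(0, Cup), (1, X)] \<Psi> = ev q ds [(1, Cup), (0, Y)] \<Psi>"
proof -
  have c0: "ev q [Up] [(0, Cup), (1, X)] \<Psi>
      = ev q [Up] [(1, Cup), (0, Y)] \<Psi>" if H: "\<And>nd. lval [Up] nd (\<Psi> nd)"
  proof -
    have f1: "\<Psi> [Up, Up, Down] [cu 0 Up, xp (Suc 0) Down Up]
        = \<Psi> [Up, Up, Down] [cu (Suc 0) Up, xm 0 Up Up]"
      by (rule chain[OF H, of _ _ "[]"]) code_simp
    have f2: "\<Psi> [Up, Down, Up] [cu 0 Up, ca (Suc 0) Down, cu (Suc 0) Down]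
        = \<Psi> [Up, Down, Up] [cu (Suc 0) Down]"
      by (rule chain[OF H, of _ _ "[]"]) code_simp
    have f3: "\<Psi> [Up, Down, Up] [cu (Suc 0) Down, ca 0 Up, cu 0 Up] = \<Psi> [Up, Down, Up] [cu 0 Up]"
      by (rule chain[OF H, of _ _ "[]"]) code_simp
    have f4: "\<Psi> [Down, Up, Up] [cu 0 Down, xp (Suc 0) Up Up]
        = \<Psi> [Down, Up, Up] [cu (Suc 0) Down, xm 0 Up Down]"
      by (rule chain[OF H, of _ _ "[]"]) code_simp
    show ?thesis by (simp add: f1 f2 f3 f4) (simp add: algebra_simps)?
  qed
  have c1: "ev q [Down] [(0, Cup), (1, X)] \<Psi>
      = ev q [Down] [(1, Cup), (0, Y)] \<Psi>" if H: "\<And>nd. lval [Down] nd (\<Psi> nd)"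
  proof -
    have f1: "\<Psi> [Up, Down, Down] [cu 0 Up, xp (Suc 0) Down Down]
        = \<Psi> [Up, Down, Down] [cu (Suc 0) Up, xm 0 Down Up]"
      by (rule chain[OF H, of _ _ "[]"]) code_simp
    have f2: "\<Psi> [Down, Down, Up] [cu 0 Down, xp (Suc 0) Up Down]
        = \<Psi> [Down, Down, Up] [cu (Suc 0) Down, xm 0 Down Down]"
      by (rule chain[OF H, of _ _ "[]"]) code_simp
    show ?thesis by (simp add: f1 f2) (simp add: algebra_simps)?
  qed
  from dirs_1[OF len] show ?thesis
  proof (elim disjE)
    assume d: "ds = [Up]"
    show ?thesis unfolding d by (rule c0) (rule H[unfolded d])
  next
    assume d: "ds = [Down]"
    show ?thesis unfolding d by (rule c1) (rule H[unfolded d])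
  qed
qed

lemma ev_cupslideY:
  assumes len: "length ds = 1" and H: "\<And>nd. lval ds nd (\<Psi> nd)"
  shows "ev q ds [(0, Cup), (1, Y)] \<Psi> = ev q ds [(1, Cup), (0, X)] \<Psi>"
proof -
  have c0: "ev q [Up] [(0, Cup), (1, Y)] \<Psi>
      = ev q [Up] [(1, Cup), (0, X)] \<Psi>" if H: "\<And>nd. lval [Up] nd (\<Psi> nd)"
  proof -
    have f1: "\<Psi> [Up, Up, Down] [cu 0 Up, xm (Suc 0) Down Up]
        = \<Psi> [Up, Up, Down] [cu (Suc 0) Up, xp 0 Up Up]"
      by (rule chain[OF H, of _ _ "[]"]) code_simp
    have f2: "\<Psi> [Down, Up, Up] [cu 0 Down, xm (Suc 0) Up Up]
        = \<Psi> [Down, Up, Up] [cu (Suc 0) Down, xp 0 Up Down]"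
      by (rule chain[OF H, of _ _ "[]"]) code_simp
    show ?thesis by (simp add: f1 f2) (simp add: algebra_simps)?
  qed
  have c1: "ev q [Down] [(0, Cup), (1, Y)] \<Psi>
      = ev q [Down] [(1, Cup), (0, X)] \<Psi>" if H: "\<And>nd. lval [Down] nd (\<Psi> nd)"
  proof -
    have f1: "\<Psi> [Up, Down, Down] [cu 0 Up, xm (Suc 0) Down Down]
        = \<Psi> [Up, Down, Down] [cu (Suc 0) Up, xp 0 Down Up]"
      by (rule chain[OF H, of _ _ "[]"]) code_simp
    have f2: "\<Psi> [Down, Up, Down] [cu 0 Down, ca (Suc 0) Up, cu (Suc 0) Up]
        = \<Psi> [Down, Up, Down] [cu (Suc 0) Up]"
      by (rule chain[OF H, of _ _ "[]"]) code_simp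
    have f3: "\<Psi> [Down, Up, Down] [cu (Suc 0) Up, ca 0 Down, cu 0 Down]
        = \<Psi> [Down, Up, Down] [cu 0 Down]"
      by (rule chain[OF H, of _ _ "[]"]) code_simp
    have f4: "\<Psi> [Down, Down, Up] [cu 0 Down, xm (Suc 0) Up Down]
        = \<Psi> [Down, Down, Up] [cu (Suc 0) Down, xp 0 Down Down]"
      by (rule chain[OF H, of _ _ "[]"]) code_simp
    show ?thesis by (simp add: f1 f2 f3 f4) (simp add: algebra_simps)?
  qed
  from dirs_1[OF len] show ?thesis
  proof (elim disjE)
    assume d: "ds = [Up]"
    show ?thesis unfolding d by (rule c0) (rule H[unfolded d])
  next
    assume d: "ds = [Down]"
    show ?thesis unfolding d by (rule c1) (rule H[unfolded d])
  qed
qed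

text \<open>The same correspondence of states as for minima. For three ends of equal direction both
  sides are empty sums, because no orientation of the maximum fits.\<close>

lemma ev_capslideX:
  assumes len: "length ds = 3" and H: "\<And>nd. lval ds nd (\<Psi> nd)"
  shows "ev q ds [(1, X), (0, Cap)] \<Psi> = ev q ds [(0, Y), (1, Cap)] \<Psi>"
proof -
  have c0: "ev q [Up, Up, Up] [(1, X), (0, Cap)] \<Psi>
      = ev q [Up, Up, Up] [(0, Y), (1, Cap)] \<Psi>" if H: "\<And>nd. lval [Up, Up, Up] nd (\<Psi> nd)"
  proof -
    show ?thesis by (simp) (simp add: algebra_simps)?
  qed
  have c1: "ev q [Up, Up, Down] [(1, X), (0, Cap)] \<Psi>
      = ev q [Up, Up, Down] [(0, Y), (1, Cap)] \<Psi>" if H: "\<And>nd. lval [Up, Up, Down] nd (\<Psi> nd)"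
  proof -
    have f1: "\<Psi> [Up] [xp (Suc 0) Up Down, ca 0 Up] = \<Psi> [Up] [xm 0 Up Up, ca (Suc 0) Up]"
      by (rule chain[OF H, of _ _ "[]"]) code_simp
    have f2: "\<Psi> [Up] [ca (Suc 0) Up, cu (Suc 0) Down, ca 0 Up] = \<Psi> [Up] [ca (Suc 0) Up]"
      by (rule chain[OF H, of _ _ "[]"]) code_simp
    show ?thesis by (simp add: f1 f2) (simp add: algebra_simps)?
  qed
  have c2: "ev q [Up, Down, Up] [(1, X), (0, Cap)] \<Psi>
      = ev q [Up, Down, Up] [(0, Y), (1, Cap)] \<Psi>" if H: "\<And>nd. lval [Up, Down, Up] nd (\<Psi> nd)"
  proof -
    have f1: "\<Psi> [Up] [ca 0 Up, cu 0 Up, ca (Suc 0) Down] = \<Psi> [Up] [ca 0 Up]"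
      by (rule chain[OF H, of _ _ "[]"]) code_simp
    have f2: "\<Psi> [Up] [ca (Suc 0) Down, cu (Suc 0) Down, ca 0 Up] = \<Psi> [Up] [ca (Suc 0) Down]"
      by (rule chain[OF H, of _ _ "[]"]) code_simp
    show ?thesis by (simp add: f1 f2) (simp add: algebra_simps)?
  qed
  have c3: "ev q [Up, Down, Down] [(1, X), (0, Cap)] \<Psi>
      = ev q [Up, Down, Down] [(0, Y), (1, Cap)] \<Psi>"
      if H: "\<And>nd. lval [Up, Down, Down] nd (\<Psi> nd)"
  proof -
    have f1: "\<Psi> [Down] [xp (Suc 0) Down Down, ca 0 Up] = \<Psi> [Down] [xm 0 Up Down, ca (Suc 0) Up]"
      by (rule chain[OF H, of _ _ "[]"]) code_simp
    have f2: "\<Psi> [Down] [ca 0 Up, cu 0 Down, ca (Suc 0) Up] = \<Psi> [Down] [ca 0 Up]"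
      by (rule chain[OF H, of _ _ "[]"]) code_simp
    show ?thesis by (simp add: f1 f2) (simp add: algebra_simps)?
  qed
  have c4: "ev q [Down, Up, Up] [(1, X), (0, Cap)] \<Psi>
      = ev q [Down, Up, Up] [(0, Y), (1, Cap)] \<Psi>" if H: "\<And>nd. lval [Down, Up, Up] nd (\<Psi> nd)"
  proof -
    have f1: "\<Psi> [Up] [xp (Suc 0) Up Up, ca 0 Down] = \<Psi> [Up] [xm 0 Down Up, ca (Suc 0) Down]"
      by (rule chain[OF H, of _ _ "[]"]) code_simp
    have f2: "\<Psi> [Up] [ca 0 Down, cu 0 Up, ca (Suc 0) Down] = \<Psi> [Up] [ca 0 Down]"
      by (rule chain[OF H, of _ _ "[]"]) code_simp
    show ?thesis by (simp add: f1 f2) (simp add: algebra_simps)?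
  qed
  have c5: "ev q [Down, Up, Down] [(1, X), (0, Cap)] \<Psi>
      = ev q [Down, Up, Down] [(0, Y), (1, Cap)] \<Psi>"
      if H: "\<And>nd. lval [Down, Up, Down] nd (\<Psi> nd)"
  proof -
    have f1: "\<Psi> [Down] [ca (Suc 0) Up, cu (Suc 0) Up, ca 0 Down] = \<Psi> [Down] [ca (Suc 0) Up]"
      by (rule chain[OF H, of _ _ "[]"]) code_simp
    have f2: "\<Psi> [Down] [ca 0 Down, cu 0 Down, ca (Suc 0) Up] = \<Psi> [Down] [ca 0 Down]"
      by (rule chain[OF H, of _ _ "[]"]) code_simp
    show ?thesis by (simp add: f1 f2) (simp add: algebra_simps)?
  qed
  have c6: "ev q [Down, Down, Up] [(1, X), (0, Cap)] \<Psi>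
      = ev q [Down, Down, Up] [(0, Y), (1, Cap)] \<Psi>"
      if H: "\<And>nd. lval [Down, Down, Up] nd (\<Psi> nd)"
  proof -
    have f1: "\<Psi> [Down] [xp (Suc 0) Down Up, ca 0 Down] = \<Psi> [Down] [xm 0 Down Down, ca (Suc 0) Down]"
      by (rule chain[OF H, of _ _ "[]"]) code_simp
    have f2: "\<Psi> [Down] [ca (Suc 0) Down, cu (Suc 0) Up, ca 0 Down] = \<Psi> [Down] [ca (Suc 0) Down]"
      by (rule chain[OF H, of _ _ "[]"]) code_simp
    show ?thesis by (simp add: f1 f2) (simp add: algebra_simps)?
  qed
  have c7: "ev q [Down, Down, Down] [(1, X), (0, Cap)] \<Psi>
      = ev q [Down, Down, Down] [(0, Y), (1, Cap)] \<Psi>"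
      if H: "\<And>nd. lval [Down, Down, Down] nd (\<Psi> nd)"
  proof -
    show ?thesis by (simp) (simp add: algebra_simps)?
  qed
  from dirs_3[OF len] show ?thesis
  proof (elim disjE)
    assume d: "ds = [Up, Up, Up]"
    show ?thesis unfolding d by (rule c0) (rule H[unfolded d])
  next
    assume d: "ds = [Up, Up, Down]"
    show ?thesis unfolding d by (rule c1) (rule H[unfolded d])
  next
    assume d: "ds = [Up, Down, Up]"
    show ?thesis unfolding d by (rule c2) (rule H[unfolded d])
  next
    assume d: "ds = [Up, Down, Down]"
    show ?thesis unfolding d by (rule c3) (rule H[unfolded d])
  next
    assume d: "ds = [Down, Up, Up]"
    show ?thesis unfolding d by (rule c4) (rule H[unfolded d])
  next
    assume d: "ds = [Down, Up, Down]"
    show ?thesis unfolding d by (rule c5) (rule H[unfolded d])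
  next
    assume d: "ds = [Down, Down, Up]"
    show ?thesis unfolding d by (rule c6) (rule H[unfolded d])
  next
    assume d: "ds = [Down, Down, Down]"
    show ?thesis unfolding d by (rule c7) (rule H[unfolded d])
  qed
qed

lemma ev_capslideY:
  assumes len: "length ds = 3" and H: "\<And>nd. lval ds nd (\<Psi> nd)"
  shows "ev q ds [(1, Y), (0, Cap)] \<Psi> = ev q ds [(0, X), (1, Cap)] \<Psi>"
proof -
  have c0: "ev q [Up, Up, Up] [(1, Y), (0, Cap)] \<Psi>
      = ev q [Up, Up, Up] [(0, X), (1, Cap)] \<Psi>" if H: "\<And>nd. lval [Up, Up, Up] nd (\<Psi> nd)"
  proof -
    show ?thesis by (simp) (simp add: algebra_simps)?
  qed
  have c1: "ev q [Up, Up, Down] [(1, Y), (0, Cap)] \<Psi>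
      = ev q [Up, Up, Down] [(0, X), (1, Cap)] \<Psi>" if H: "\<And>nd. lval [Up, Up, Down] nd (\<Psi> nd)"
  proof -
    have f1: "\<Psi> [Up] [xm (Suc 0) Up Down, ca 0 Up] = \<Psi> [Up] [xp 0 Up Up, ca (Suc 0) Up]"
      by (rule chain[OF H, of _ _ "[]"]) code_simp
    have f2: "\<Psi> [Up] [ca (Suc 0) Up, cu (Suc 0) Down, ca 0 Up] = \<Psi> [Up] [ca (Suc 0) Up]"
      by (rule chain[OF H, of _ _ "[]"]) code_simp
    show ?thesis by (simp add: f1 f2) (simp add: algebra_simps)?
  qed
  have c2: "ev q [Up, Down, Up] [(1, Y), (0, Cap)] \<Psi>
      = ev q [Up, Down, Up] [(0, X), (1, Cap)] \<Psi>" if H: "\<And>nd. lval [Up, Down, Up] nd (\<Psi> nd)"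
  proof -
    have f1: "\<Psi> [Up] [ca 0 Up, cu 0 Up, ca (Suc 0) Down] = \<Psi> [Up] [ca 0 Up]"
      by (rule chain[OF H, of _ _ "[]"]) code_simp
    have f2: "\<Psi> [Up] [ca (Suc 0) Down, cu (Suc 0) Down, ca 0 Up] = \<Psi> [Up] [ca (Suc 0) Down]"
      by (rule chain[OF H, of _ _ "[]"]) code_simp
    show ?thesis by (simp add: f1 f2) (simp add: algebra_simps)?
  qed
  have c3: "ev q [Up, Down, Down] [(1, Y), (0, Cap)] \<Psi>
      = ev q [Up, Down, Down] [(0, X), (1, Cap)] \<Psi>"
      if H: "\<And>nd. lval [Up, Down, Down] nd (\<Psi> nd)"
  proof -
    have f1: "\<Psi> [Down] [xm (Suc 0) Down Down, ca 0 Up] = \<Psi> [Down] [xp 0 Up Down, ca (Suc 0) Up]"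
      by (rule chain[OF H, of _ _ "[]"]) code_simp
    have f2: "\<Psi> [Down] [ca 0 Up, cu 0 Down, ca (Suc 0) Up] = \<Psi> [Down] [ca 0 Up]"
      by (rule chain[OF H, of _ _ "[]"]) code_simp
    show ?thesis by (simp add: f1 f2) (simp add: algebra_simps)?
  qed
  have c4: "ev q [Down, Up, Up] [(1, Y), (0, Cap)] \<Psi>
      = ev q [Down, Up, Up] [(0, X), (1, Cap)] \<Psi>" if H: "\<And>nd. lval [Down, Up, Up] nd (\<Psi> nd)"
  proof -
    have f1: "\<Psi> [Up] [xm (Suc 0) Up Up, ca 0 Down] = \<Psi> [Up] [xp 0 Down Up, ca (Suc 0) Down]"
      by (rule chain[OF H, of _ _ "[]"]) code_simp
    have f2: "\<Psi> [Up] [ca 0 Down, cu 0 Up, ca (Suc 0) Down] = \<Psi> [Up] [ca 0 Down]"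
      by (rule chain[OF H, of _ _ "[]"]) code_simp
    show ?thesis by (simp add: f1 f2) (simp add: algebra_simps)?
  qed
  have c5: "ev q [Down, Up, Down] [(1, Y), (0, Cap)] \<Psi>
      = ev q [Down, Up, Down] [(0, X), (1, Cap)] \<Psi>"
      if H: "\<And>nd. lval [Down, Up, Down] nd (\<Psi> nd)"
  proof -
    have f1: "\<Psi> [Down] [ca (Suc 0) Up, cu (Suc 0) Up, ca 0 Down] = \<Psi> [Down] [ca (Suc 0) Up]"
      by (rule chain[OF H, of _ _ "[]"]) code_simp
    have f2: "\<Psi> [Down] [ca 0 Down, cu 0 Down, ca (Suc 0) Up] = \<Psi> [Down] [ca 0 Down]"
      by (rule chain[OF H, of _ _ "[]"]) code_simp
    show ?thesis by (simp add: f1 f2) (simp add: algebra_simps)?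
  qed
  have c6: "ev q [Down, Down, Up] [(1, Y), (0, Cap)] \<Psi>
      = ev q [Down, Down, Up] [(0, X), (1, Cap)] \<Psi>"
      if H: "\<And>nd. lval [Down, Down, Up] nd (\<Psi> nd)"
  proof -
    have f1: "\<Psi> [Down] [xm (Suc 0) Down Up, ca 0 Down] = \<Psi> [Down] [xp 0 Down Down, ca (Suc 0) Down]"
      by (rule chain[OF H, of _ _ "[]"]) code_simp
    have f2: "\<Psi> [Down] [ca (Suc 0) Down, cu (Suc 0) Up, ca 0 Down] = \<Psi> [Down] [ca (Suc 0) Down]"
      by (rule chain[OF H, of _ _ "[]"]) code_simp
    show ?thesis by (simp add: f1 f2) (simp add: algebra_simps)?
  qed
  have c7: "ev q [Down, Down, Down] [(1, Y), (0, Cap)] \<Psi>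
      = ev q [Down, Down, Down] [(0, X), (1, Cap)] \<Psi>"
      if H: "\<And>nd. lval [Down, Down, Down] nd (\<Psi> nd)"
  proof -
    show ?thesis by (simp) (simp add: algebra_simps)?
  qed
  from dirs_3[OF len] show ?thesis
  proof (elim disjE)
    assume d: "ds = [Up, Up, Up]"
    show ?thesis unfolding d by (rule c0) (rule H[unfolded d])
  next
    assume d: "ds = [Up, Up, Down]"
    show ?thesis unfolding d by (rule c1) (rule H[unfolded d])
  next
    assume d: "ds = [Up, Down, Up]"
    show ?thesis unfolding d by (rule c2) (rule H[unfolded d])
  next
    assume d: "ds = [Up, Down, Down]"
    show ?thesis unfolding d by (rule c3) (rule H[unfolded d])
  next
    assume d: "ds = [Down, Up, Up]"
    show ?thesis unfolding d by (rule c4) (rule H[unfolded d])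
  next
    assume d: "ds = [Down, Up, Down]"
    show ?thesis unfolding d by (rule c5) (rule H[unfolded d])
  next
    assume d: "ds = [Down, Down, Up]"
    show ?thesis unfolding d by (rule c6) (rule H[unfolded d])
  next
    assume d: "ds = [Down, Down, Down]"
    show ?thesis unfolding d by (rule c7) (rule H[unfolded d])
  qed
qed

section \<open>Reidemeister moves II and III\<close>

lemma ev_bigon:
  assumes len: "length ds = 2" and H: "\<And>nd. lval ds nd (\<Psi> nd)"
  shows "ev q ds [(0, X), (0, Y)] \<Psi> = \<Psi> ds []"
proof -
  have c0: "ev q [Up, Up] [(0, X), (0, Y)] \<Psi>
      = \<Psi> [Up, Up] []" if H: "\<And>nd. lval [Up, Up] nd (\<Psi> nd)"
  proof -
    have f1: "\<Psi> [Up, Up] [xp 0 Up Up, xm 0 Up Up] = \<Psi> [Up, Up] []"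
      by (rule chain[OF H, of _ _ "[]"]) code_simp
    show ?thesis by (simp add: f1) (simp add: algebra_simps)?
  qed
  have c1: "ev q [Up, Down] [(0, X), (0, Y)] \<Psi>
      = \<Psi> [Up, Down] []" if H: "\<And>nd. lval [Up, Down] nd (\<Psi> nd)"
  proof -
    have f1: "\<Psi> [Up, Down] [xp 0 Up Down, xm 0 Down Up] = \<Psi> [Up, Down] []"
      by (rule chain[OF H, of _ _ "[]"]) code_simp
    show ?thesis by (simp add: f1) (simp add: algebra_simps)?
  qed
  have c2: "ev q [Down, Up] [(0, X), (0, Y)] \<Psi>
      = \<Psi> [Down, Up] []" if H: "\<And>nd. lval [Down, Up] nd (\<Psi> nd)"
  proof -
    have f1: "\<Psi> [Down, Up] [xp 0 Down Up, xm 0 Up Down] = \<Psi> [Down, Up] []"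
      by (rule chain[OF H, of _ _ "[]"]) code_simp
    \<comment> \<open>The four states with one smoothed crossing end in Up Down and have to cancel.
      The two with a turn-back are kinks with factors 1/q and q and give
      \<open>- z * (q - inverse q)\<close> times the smoothing H. The other two give
      \<open>z\<close> times the difference of \<open>XMinus\<close> and \<open>XPlus\<close>, which
      by the skein relation is \<open>z * z\<close> times the same smoothing.\<close>
    have g1: "\<Psi> [Up, Down] [xp 0 Down Up, ca 0 Up, cu 0 Up]
        = inverse q * \<Psi> [Up, Down] [ca 0 Down, cu 0 Up]"
      using cap_twist_inv_at[OF H, of "[]" "[]" Down Up "[]" "[cu 0 Up]" "[Up, Down]" 0, simplified]
      by (simp add: curl_def)
    have g2: "\<Psi> [Up, Down] [ca 0 Down, cu 0 Down, xm 0 Down Up]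
        = q * \<Psi> [Up, Down] [ca 0 Down, cu 0 Up]"
      using cup_twist_at[OF H, of "[ca 0 Down]" "[]" "[]" Up Down "[]" "[Up, Down]" 0, simplified]
      by (simp add: curl_def)
    have g3: "\<Psi> [Up, Down] [xp 0 Down Up]
        = \<Psi> [Up, Down] [xm 0 Down Up] - z * \<Psi> [Up, Down] [ca 0 Down, cu 0 Up]"
      using skein_diff[OF H, of "[]" "[]" Down Up "[]" "[]" "[Up, Down]" 0, simplified] by simp
    show ?thesis by (simp add: f1 g1 g2 g3) (simp add: algebra_simps)?
  qed
  have c3: "ev q [Down, Down] [(0, X), (0, Y)] \<Psi>
      = \<Psi> [Down, Down] []" if H: "\<And>nd. lval [Down, Down] nd (\<Psi> nd)"
  proof -
    have f1: "\<Psi> [Down, Down] [xp 0 Down Down, xm 0 Down Down] = \<Psi> [Down, Down] []"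
      by (rule chain[OF H, of _ _ "[]"]) code_simp
    show ?thesis by (simp add: f1) (simp add: algebra_simps)?
  qed
  from dirs_2[OF len] show ?thesis
  proof (elim disjE)
    assume d: "ds = [Up, Up]"
    show ?thesis unfolding d by (rule c0) (rule H[unfolded d])
  next
    assume d: "ds = [Up, Down]"
    show ?thesis unfolding d by (rule c1) (rule H[unfolded d])
  next
    assume d: "ds = [Down, Up]"
    show ?thesis unfolding d by (rule c2) (rule H[unfolded d])
  next
    assume d: "ds = [Down, Down]"
    show ?thesis unfolding d by (rule c3) (rule H[unfolded d])
  qed
qed

lemma ev_braid:
  assumes len: "length ds = 3" and H: "\<And>nd. lval ds nd (\<Psi> nd)"
  shows "ev q ds [(0, X), (1, X), (0, X)] \<Psi> = ev q ds [(1, X), (0, X), (1, X)] \<Psi>"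
proof -
  have c0: "ev q [Up, Up, Up] [(0, X), (1, X), (0, X)] \<Psi>
      = ev q [Up, Up, Up] [(1, X), (0, X), (1, X)] \<Psi>" if H: "\<And>nd. lval [Up, Up, Up] nd (\<Psi> nd)"
  proof -
    have f1: "\<Psi> [Up, Up, Up] [xp 0 Up Up, xp (Suc 0) Up Up, xp 0 Up Up]
        = \<Psi> [Up, Up, Up] [xp (Suc 0) Up Up, xp 0 Up Up, xp (Suc 0) Up Up]"
      by (rule chain[OF H, of _ _ "[]"]) code_simp
    show ?thesis by (simp add: f1) (simp add: algebra_simps)?
  qed
  have c1: "ev q [Up, Up, Down] [(0, X), (1, X), (0, X)] \<Psi>
      = ev q [Up, Up, Down] [(1, X), (0, X), (1, X)] \<Psi>"
      if H: "\<And>nd. lval [Up, Up, Down] nd (\<Psi> nd)"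
  proof -
    have f1: "\<Psi> [Down, Up, Up] [xp 0 Up Up, xp (Suc 0) Up Down, xp 0 Up Down]
        = \<Psi> [Down, Up, Up] [xp (Suc 0) Up Down, xp 0 Up Down, xp (Suc 0) Up Up]"
      by (rule chain[OF H, of _ _ "[]"]) code_simp
    show ?thesis by (simp add: f1) (simp add: algebra_simps)?
  qed
  have c2: "ev q [Up, Down, Up] [(0, X), (1, X), (0, X)] \<Psi>
      = ev q [Up, Down, Up] [(1, X), (0, X), (1, X)] \<Psi>"
      if H: "\<And>nd. lval [Up, Down, Up] nd (\<Psi> nd)"
  proof -
    have f1: "\<Psi> [Up, Down, Up] [xp 0 Up Down, xp (Suc 0) Up Up, xp 0 Down Up]
        = \<Psi> [Up, Down, Up] [xp (Suc 0) Down Up, xp 0 Up Up, xp (Suc 0) Up Down]"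
      by (rule chain[OF H, of _ _ "[]"]) code_simp
    \<comment> \<open>The maximum slides across the third strand so that the two crossings form a
      bigon and cancel. A bigon created next to the minimum then puts the two crossings above the
      turn-back.\<close>
    have f2: "\<Psi> [Down, Up, Up] [xp 0 Up Down, xp (Suc 0) Up Up, ca 0 Down, cu 0 Down]
        = \<Psi> [Down, Up, Up] [ca (Suc 0) Down, cu (Suc 0) Down, xp 0 Up Down, xp (Suc 0) Up Up]"
      by (rule chain[OF H, of _ _ "[[xp 0 Up Down, xm 0 Down Up, ca (Suc 0) Down, cu 0 Down],
            [ca (Suc 0) Down, cu 0 Down],
            [ca (Suc 0) Down, cu 0 Down, xm (Suc 0) Up Up, xp (Suc 0) Up Up]]"]) code_simp
    show ?thesis by (simp add: f1 f2) (simp add: algebra_simps)?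
  qed
  have c3: "ev q [Up, Down, Down] [(0, X), (1, X), (0, X)] \<Psi>
      = ev q [Up, Down, Down] [(1, X), (0, X), (1, X)] \<Psi>"
      if H: "\<And>nd. lval [Up, Down, Down] nd (\<Psi> nd)"
  proof -
    have f1: "\<Psi> [Down, Down, Up] [xp 0 Up Down, xp (Suc 0) Up Down, xp 0 Down Down]
        = \<Psi> [Down, Down, Up] [xp (Suc 0) Down Down, xp 0 Up Down, xp (Suc 0) Up Down]"
      by (rule chain[OF H, of _ _ "[]"]) code_simp
    show ?thesis by (simp add: f1) (simp add: algebra_simps)?
  qed
  \<comment> \<open>The states that end in Down Up Up are the delicate ones. Let E be the turn-back
    at 0. Two equal crossings in succession are reduced by a skein relation, and the state with two
    crossings around a turn-back is moved by \<open>f5\<close> from one side of the diagram to the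
    other. After reduction the two sides differ by \<open>z\<^sup>2 * (q - inverse q - z)\<close>
    times E, which is zero; the summands q and 1/q come from the kinks in \<open>g7\<close> and
    \<open>g3\<close>.\<close>
  have c4: "ev q [Down, Up, Up] [(0, X), (1, X), (0, X)] \<Psi>
      = ev q [Down, Up, Up] [(1, X), (0, X), (1, X)] \<Psi>"
      if H: "\<And>nd. lval [Down, Up, Up] nd (\<Psi> nd)"
  proof -
    have f1: "\<Psi> [Up, Up, Down] [xp 0 Down Up, xp (Suc 0) Down Up, xp 0 Up Up]
        = \<Psi> [Up, Up, Down] [xp (Suc 0) Up Up, xp 0 Down Up, xp (Suc 0) Down Up]"
      by (rule chain[OF H, of _ _ "[]"]) code_simp
    have f2: "\<Psi> [Up, Down, Up] [ca 0 Down, cu 0 Down, xp (Suc 0) Up Up, xp 0 Down Up]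
        = \<Psi> [Up, Down, Up] [xp (Suc 0) Up Up, xp 0 Down Up, ca (Suc 0) Down, cu (Suc 0) Down]"
      by (rule chain[OF H, of _ _ "[[ca 0 Down, cu (Suc 0) Down, xm 0 Up Down, xp 0 Down Up],
            [ca 0 Down, cu (Suc 0) Down],
            [xp (Suc 0) Up Up, xm (Suc 0) Up Up, ca 0 Down, cu (Suc 0) Down]]"]) code_simp
    have f3: "\<Psi> [Down, Up, Up] [xp (Suc 0) Up Up, xm (Suc 0) Up Up] = \<Psi> [Down, Up, Up] []"
      by (rule chain[OF H, of _ _ "[]"]) code_simp
    have f4: "\<Psi> [Down, Up, Up] [xp 0 Down Up, xm 0 Up Down] = \<Psi> [Down, Up, Up] []"
      by (rule chain[OF H, of _ _ "[]"]) code_simp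
    have f5: "\<Psi> [Down, Up, Up] [xp 0 Down Up, ca (Suc 0) Down, cu (Suc 0) Down, xp 0 Up Down]
        = \<Psi> [Down, Up, Up] [xm (Suc 0) Up Up, ca 0 Down, cu 0 Down, xm (Suc 0) Up Up]"
      by (rule chain[OF H, of _ _ "[[xm (Suc 0) Up Up, ca 0 Down, cu (Suc 0) Down, xp 0 Up Down]]"]) code_simp
    have g1: "\<Psi> [Down, Up, Up] [xp (Suc 0) Up Up, xp (Suc 0) Up Up]
        = \<Psi> [Down, Up, Up] [xp (Suc 0) Up Up, xm (Suc 0) Up Up]
          + z * \<Psi> [Down, Up, Up] [xp (Suc 0) Up Up]"
      using skein_same[OF H, of "[xp (Suc 0) Up Up]" "[Down]" Up "[]" "[]" "[Down, Up, Up]" 1, simplified]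
      by simp
    have g2: "\<Psi> [Down, Up, Up] [xp 0 Down Up, xp 0 Up Down]
        = \<Psi> [Down, Up, Up] [xp 0 Down Up, xm 0 Up Down]
          - z * \<Psi> [Down, Up, Up] [xp 0 Down Up, ca 0 Up, cu 0 Down]"
      using skein_diff[OF H, of "[xp 0 Down Up]" "[]" Up Down "[Up]" "[]" "[Down, Up, Up]" 0, simplified]
      by simp
    have g3: "\<Psi> [Down, Up, Up] [xp 0 Down Up, ca 0 Up, cu 0 Down]
        = inverse q * \<Psi> [Down, Up, Up] [ca 0 Down, cu 0 Down]"
      using cap_twist_inv_at[OF H, of "[]" "[]" Down Up "[Up]" "[cu 0 Down]" "[Down, Up, Up]" 0, simplified]
      by (simp add: curl_def)
    have g4: "\<Psi> [Down, Up, Up] [xp (Suc 0) Up Up, ca 0 Down, cu 0 Down, xp (Suc 0) Up Up]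
        = \<Psi> [Down, Up, Up] [xm (Suc 0) Up Up, ca 0 Down, cu 0 Down, xp (Suc 0) Up Up]
          + z * \<Psi> [Down, Up, Up] [ca 0 Down, cu 0 Down, xp (Suc 0) Up Up]"
      using skein_same[OF H, of "[]" "[Down]" Up "[]" "[ca 0 Down, cu 0 Down, xp (Suc 0) Up Up]" "[Down, Up, Up]" 1, simplified]
      by simp
    have g5: "\<Psi> [Down, Up, Up] [xm (Suc 0) Up Up, ca 0 Down, cu 0 Down, xp (Suc 0) Up Up]
        = \<Psi> [Down, Up, Up] [xm (Suc 0) Up Up, ca 0 Down, cu 0 Down, xm (Suc 0) Up Up]
          + z * \<Psi> [Down, Up, Up] [xm (Suc 0) Up Up, ca 0 Down, cu 0 Down]"
      using skein_same[OF H, of "[xm (Suc 0) Up Up, ca 0 Down, cu 0 Down]" "[Down]" Up "[]" "[]" "[Down, Up, Up]" 1, simplified]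
      by simp
    have g6: "\<Psi> [Down, Up, Up] [xp (Suc 0) Up Up, ca 0 Down, cu 0 Down]
        = \<Psi> [Down, Up, Up] [xm (Suc 0) Up Up, ca 0 Down, cu 0 Down]
          + z * \<Psi> [Down, Up, Up] [ca 0 Down, cu 0 Down]"
      using skein_same[OF H, of "[]" "[Down]" Up "[]" "[ca 0 Down, cu 0 Down]" "[Down, Up, Up]" 1, simplified]
      by simp
    have g7: "\<Psi> [Down, Up, Up] [ca 0 Down, cu 0 Down, xp (Suc 0) Up Up, ca 0 Down, cu 0 Down]
        = q * \<Psi> [Down, Up, Up] [ca 0 Down, cu 0 Down]"
      using curl_left_at[OF H, of "[ca 0 Down]" "[]" Up "[]" "[cu 0 Down]" "[Down, Up, Up]" 0 "Suc 0" Down, simplified]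
      by (simp add: curl_def)
    show ?thesis by (simp add: f1 f2 f3 f4 f5 g1 g2 g3 g4 g5 g6 g7) (simp add: algebra_simps)?
  qed
  have c5: "ev q [Down, Up, Down] [(0, X), (1, X), (0, X)] \<Psi>
      = ev q [Down, Up, Down] [(1, X), (0, X), (1, X)] \<Psi>"
      if H: "\<And>nd. lval [Down, Up, Down] nd (\<Psi> nd)"
  proof -
    have f1: "\<Psi> [Down, Up, Down] [xp 0 Down Up, xp (Suc 0) Down Down, xp 0 Up Down]
        = \<Psi> [Down, Up, Down] [xp (Suc 0) Up Down, xp 0 Down Down, xp (Suc 0) Down Up]"
      by (rule chain[OF H, of _ _ "[]"]) code_simp
    have f2: "\<Psi> [Down, Down, Up] [ca 0 Down, cu 0 Down, xp (Suc 0) Up Down, xp 0 Down Down]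
        = \<Psi> [Down, Down, Up] [xp (Suc 0) Up Down, xp 0 Down Down, ca (Suc 0) Down, cu (Suc 0) Down]"
      by (rule chain[OF H, of _ _ "[[ca 0 Down, cu (Suc 0) Down, xm 0 Down Down, xp 0 Down Down],
            [ca 0 Down, cu (Suc 0) Down],
            [xp (Suc 0) Up Down, xm (Suc 0) Down Up, ca 0 Down, cu (Suc 0) Down]]"]) code_simp
    show ?thesis by (simp add: f1 f2) (simp add: algebra_simps)?
  qed
  \<comment> \<open>The same cancellation with the roles of the two positions exchanged, so that the
    turn-back E lies at 1.\<close>
  have c6: "ev q [Down, Down, Up] [(0, X), (1, X), (0, X)] \<Psi>
      = ev q [Down, Down, Up] [(1, X), (0, X), (1, X)] \<Psi>"
      if H: "\<And>nd. lval [Down, Down, Up] nd (\<Psi> nd)"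
  proof -
    have f1: "\<Psi> [Up, Down, Down] [xp 0 Down Down, xp (Suc 0) Down Up, xp 0 Down Up]
        = \<Psi> [Up, Down, Down] [xp (Suc 0) Down Up, xp 0 Down Up, xp (Suc 0) Down Down]"
      by (rule chain[OF H, of _ _ "[]"]) code_simp
    have f2: "\<Psi> [Down, Up, Down] [xp 0 Down Down, xp (Suc 0) Down Up, ca 0 Down, cu 0 Down]
        = \<Psi> [Down, Up, Down] [ca (Suc 0) Down, cu (Suc 0) Down, xp 0 Down Down, xp (Suc 0) Down Up]"
      by (rule chain[OF H, of _ _ "[[xp 0 Down Down, xm 0 Down Down, ca (Suc 0) Down, cu 0 Down],
            [ca (Suc 0) Down, cu 0 Down],
            [ca (Suc 0) Down, cu 0 Down, xm (Suc 0) Up Down, xp (Suc 0) Down Up]]"]) code_simp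
    have f3: "\<Psi> [Down, Down, Up] [xp (Suc 0) Down Up, xm (Suc 0) Up Down] = \<Psi> [Down, Down, Up] []"
      by (rule chain[OF H, of _ _ "[]"]) code_simp
    have f4: "\<Psi> [Down, Down, Up] [xp 0 Down Down, xm 0 Down Down] = \<Psi> [Down, Down, Up] []"
      by (rule chain[OF H, of _ _ "[]"]) code_simp
    have f5: "\<Psi> [Down, Down, Up] [xp (Suc 0) Down Up, ca 0 Down, cu 0 Down, xp (Suc 0) Up Down]
        = \<Psi> [Down, Down, Up] [xm 0 Down Down, ca (Suc 0) Down, cu (Suc 0) Down, xm 0 Down Down]"
      by (rule chain[OF H, of _ _ "[[xm 0 Down Down, ca (Suc 0) Down, cu 0 Down, xp (Suc 0) Up Down]]"]) code_simp
    have g1: "\<Psi> [Down, Down, Up] [xp 0 Down Down, xp 0 Down Down]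
        = \<Psi> [Down, Down, Up] [xp 0 Down Down, xm 0 Down Down]
          + z * \<Psi> [Down, Down, Up] [xp 0 Down Down]"
      using skein_same[OF H, of "[xp 0 Down Down]" "[]" Down "[Up]" "[]" "[Down, Down, Up]" 0, simplified]
      by simp
    have g2: "\<Psi> [Down, Down, Up] [xp (Suc 0) Down Up, xp (Suc 0) Up Down]
        = \<Psi> [Down, Down, Up] [xp (Suc 0) Down Up, xm (Suc 0) Up Down]
          - z * \<Psi> [Down, Down, Up] [xp (Suc 0) Down Up, ca (Suc 0) Up, cu (Suc 0) Down]"
      using skein_diff[OF H, of "[xp (Suc 0) Down Up]" "[Down]" Up Down "[]" "[]" "[Down, Down, Up]" 1, simplified]
      by simp
    have g3: "\<Psi> [Down, Down, Up] [xp (Suc 0) Down Up, ca (Suc 0) Up, cu (Suc 0) Down]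
        = inverse q * \<Psi> [Down, Down, Up] [ca (Suc 0) Down, cu (Suc 0) Down]"
      using cap_twist_inv_at[OF H, of "[]" "[Down]" Down Up "[]" "[cu (Suc 0) Down]" "[Down, Down, Up]" 1, simplified]
      by (simp add: curl_def)
    have g4: "\<Psi> [Down, Down, Up] [xp 0 Down Down, ca (Suc 0) Down, cu (Suc 0) Down, xp 0 Down Down]
        = \<Psi> [Down, Down, Up] [xm 0 Down Down, ca (Suc 0) Down, cu (Suc 0) Down, xp 0 Down Down]
          + z * \<Psi> [Down, Down, Up] [ca (Suc 0) Down, cu (Suc 0) Down, xp 0 Down Down]"
      using skein_same[OF H, of "[]" "[]" Down "[Up]" "[ca (Suc 0) Down, cu (Suc 0) Down, xp 0 Down Down]" "[Down, Down, Up]" 0, simplified]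
      by simp
    have g5: "\<Psi> [Down, Down, Up] [xm 0 Down Down, ca (Suc 0) Down, cu (Suc 0) Down, xp 0 Down Down]
        = \<Psi> [Down, Down, Up] [xm 0 Down Down, ca (Suc 0) Down, cu (Suc 0) Down, xm 0 Down Down]
          + z * \<Psi> [Down, Down, Up] [xm 0 Down Down, ca (Suc 0) Down, cu (Suc 0) Down]"
      using skein_same[OF H, of "[xm 0 Down Down, ca (Suc 0) Down, cu (Suc 0) Down]" "[]" Down "[Up]" "[]" "[Down, Down, Up]" 0, simplified]
      by simp
    have g6: "\<Psi> [Down, Down, Up] [xp 0 Down Down, ca (Suc 0) Down, cu (Suc 0) Down]
        = \<Psi> [Down, Down, Up] [xm 0 Down Down, ca (Suc 0) Down, cu (Suc 0) Down]
          + z * \<Psi> [Down, Down, Up] [ca (Suc 0) Down, cu (Suc 0) Down]"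
      using skein_same[OF H, of "[]" "[]" Down "[Up]" "[ca (Suc 0) Down, cu (Suc 0) Down]" "[Down, Down, Up]" 0, simplified]
      by simp
    have g7: "\<Psi> [Down, Down, Up] [ca (Suc 0) Down, cu (Suc 0) Down, xp 0 Down Down, ca (Suc 0) Down, cu (Suc 0) Down]
        = q * \<Psi> [Down, Down, Up] [ca (Suc 0) Down, cu (Suc 0) Down]"
      using curl_right_at[OF H, of "[ca (Suc 0) Down]" "[]" Down "[]" "[cu (Suc 0) Down]" "[Down, Down, Up]" 0 "Suc 0", simplified]
      by (simp add: curl_def)
    show ?thesis by (simp add: f1 f2 f3 f4 f5 g1 g2 g3 g4 g5 g6 g7) (simp add: algebra_simps)?
  qed
  have c7: "ev q [Down, Down, Down] [(0, X), (1, X), (0, X)] \<Psi>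
      = ev q [Down, Down, Down] [(1, X), (0, X), (1, X)] \<Psi>"
      if H: "\<And>nd. lval [Down, Down, Down] nd (\<Psi> nd)"
  proof -
    have f1: "\<Psi> [Down, Down, Down] [xp 0 Down Down, xp (Suc 0) Down Down, xp 0 Down Down]
        = \<Psi> [Down, Down, Down] [xp (Suc 0) Down Down, xp 0 Down Down, xp (Suc 0) Down Down]"
      by (rule chain[OF H, of _ _ "[]"]) code_simp
    show ?thesis by (simp add: f1) (simp add: algebra_simps)?
  qed
  from dirs_3[OF len] show ?thesis
  proof (elim disjE)
    assume d: "ds = [Up, Up, Up]"
    show ?thesis unfolding d by (rule c0) (rule H[unfolded d])
  next
    assume d: "ds = [Up, Up, Down]"
    show ?thesis unfolding d by (rule c1) (rule H[unfolded d])
  next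
    assume d: "ds = [Up, Down, Up]"
    show ?thesis unfolding d by (rule c2) (rule H[unfolded d])
  next
    assume d: "ds = [Up, Down, Down]"
    show ?thesis unfolding d by (rule c3) (rule H[unfolded d])
  next
    assume d: "ds = [Down, Up, Up]"
    show ?thesis unfolding d by (rule c4) (rule H[unfolded d])
  next
    assume d: "ds = [Down, Up, Down]"
    show ?thesis unfolding d by (rule c5) (rule H[unfolded d])
  next
    assume d: "ds = [Down, Down, Up]"
    show ?thesis unfolding d by (rule c6) (rule H[unfolded d])
  next
    assume d: "ds = [Down, Down, Down]"
    show ?thesis unfolding d by (rule c7) (rule H[unfolded d])
  qed
qed

section \<open>Skein and vertex relations of the state sum\<close>

lemma ev_skein:
  assumes len: "length ds = 2" and H: "\<And>nd. lval ds nd (\<Psi> nd)"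
  shows "ev q ds [(0, X)] \<Psi> - ev q ds [(0, Y)] \<Psi> = z * (\<Psi> ds [] - ev q ds [(0, Cap), (0, Cup)] \<Psi>)"
proof -
  have c0: "ev q [Up, Up] [(0, X)] \<Psi> - ev q [Up, Up] [(0, Y)] \<Psi>
      = z * (\<Psi> [Up, Up] []
        - ev q [Up, Up] [(0, Cap), (0, Cup)] \<Psi>)" if H: "\<And>nd. lval [Up, Up] nd (\<Psi> nd)"
  proof -
    have g1: "\<Psi> [Up, Up] [xp 0 Up Up] = \<Psi> [Up, Up] [xm 0 Up Up] + z * \<Psi> [Up, Up] []"
      using skein_same[OF H, of "[]" "[]" Up "[]" "[]" "[Up, Up]" 0, simplified] by simp
    show ?thesis by (simp add: g1) (simp add: algebra_simps)?
  qed
  \<comment> \<open>States with ends Up Down at both levels exist only for \<open>XMinus\<close>,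
    since \<open>XPlus\<close> would be top inward. Its weights yield z (V - H) without any relation
    for \<open>G\<close>. The states with ends Down Up at the top are covered by the oriented skein
    relation.\<close>
  have c1: "ev q [Up, Down] [(0, X)] \<Psi> - ev q [Up, Down] [(0, Y)] \<Psi>
      = z * (\<Psi> [Up, Down] []
        - ev q [Up, Down] [(0, Cap), (0, Cup)] \<Psi>)" if H: "\<And>nd. lval [Up, Down] nd (\<Psi> nd)"
  proof -
    have g1: "\<Psi> [Down, Up] [xp 0 Up Down]
        = \<Psi> [Down, Up] [xm 0 Up Down] - z * \<Psi> [Down, Up] [ca 0 Up, cu 0 Down]"
      using skein_diff[OF H, of "[]" "[]" Up Down "[]" "[]" "[Down, Up]" 0, simplified] by simp
    show ?thesis by (simp add: g1) (simp add: algebra_simps)?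
  qed
  have c2: "ev q [Down, Up] [(0, X)] \<Psi> - ev q [Down, Up] [(0, Y)] \<Psi>
      = z * (\<Psi> [Down, Up] []
        - ev q [Down, Up] [(0, Cap), (0, Cup)] \<Psi>)" if H: "\<And>nd. lval [Down, Up] nd (\<Psi> nd)"
  proof -
    have g1: "\<Psi> [Up, Down] [xp 0 Down Up]
        = \<Psi> [Up, Down] [xm 0 Down Up] - z * \<Psi> [Up, Down] [ca 0 Down, cu 0 Up]"
      using skein_diff[OF H, of "[]" "[]" Down Up "[]" "[]" "[Up, Down]" 0, simplified] by simp
    show ?thesis by (simp add: g1) (simp add: algebra_simps)?
  qed
  have c3: "ev q [Down, Down] [(0, X)] \<Psi> - ev q [Down, Down] [(0, Y)] \<Psi>
      = z * (\<Psi> [Down, Down] []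
        - ev q [Down, Down] [(0, Cap), (0, Cup)] \<Psi>)" if H: "\<And>nd. lval [Down, Down] nd (\<Psi> nd)"
  proof -
    have g1: "\<Psi> [Down, Down] [xp 0 Down Down]
        = \<Psi> [Down, Down] [xm 0 Down Down] + z * \<Psi> [Down, Down] []"
      using skein_same[OF H, of "[]" "[]" Down "[]" "[]" "[Down, Down]" 0, simplified] by simp
    show ?thesis by (simp add: g1) (simp add: algebra_simps)?
  qed
  from dirs_2[OF len] show ?thesis
  proof (elim disjE)
    assume d: "ds = [Up, Up]"
    show ?thesis unfolding d by (rule c0) (rule H[unfolded d])
  next
    assume d: "ds = [Up, Down]"
    show ?thesis unfolding d by (rule c1) (rule H[unfolded d])
  next
    assume d: "ds = [Down, Up]"
    show ?thesis unfolding d by (rule c2) (rule H[unfolded d])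
  next
    assume d: "ds = [Down, Down]"
    show ?thesis unfolding d by (rule c3) (rule H[unfolded d])
  qed
qed

text \<open>For nontransversal directions the weights q and 1/q of the two smoothings are what the
  right-hand side gives: qV + H/q if \<open>XPlus\<close> would be top inward, and the same minus z
  (V - H), that is V/q + qH, if it is top outward.\<close>

lemma ev_vertex:
  assumes len: "length ds = 2" and H: "\<And>nd. lval ds nd (\<Psi> nd)"
  shows "ev q ds [(0, Node XVert)] \<Psi> = - ev q ds [(0, X)] \<Psi> + q * \<Psi> ds [] + inverse q * ev q ds [(0, Cap), (0, Cup)] \<Psi>"
proof -
  have c0: "ev q [Up, Up] [(0, Node XVert)] \<Psi>
      = - ev q [Up, Up] [(0, X)] \<Psi> + q * \<Psi> [Up, Up] []
        + inverse q * ev q [Up, Up] [(0, Cap), (0, Cup)] \<Psi>"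
      if H: "\<And>nd. lval [Up, Up] nd (\<Psi> nd)"
  proof -
    have g1: "\<Psi> [Up, Up] [xv 0 Up Up] = - \<Psi> [Up, Up] [xp 0 Up Up] + q * \<Psi> [Up, Up] []"
      using vertex[OF H] by simp
    show ?thesis by (simp add: g1) (simp add: algebra_simps)?
  qed
  have c1: "ev q [Up, Down] [(0, Node XVert)] \<Psi>
      = - ev q [Up, Down] [(0, X)] \<Psi> + q * \<Psi> [Up, Down] []
        + inverse q * ev q [Up, Down] [(0, Cap), (0, Cup)] \<Psi>"
      if H: "\<And>nd. lval [Up, Down] nd (\<Psi> nd)"
  proof -
    have g1: "\<Psi> [Down, Up] [xv 0 Up Down]
        = - \<Psi> [Down, Up] [xp 0 Up Down] + inverse q * \<Psi> [Down, Up] [ca 0 Up, cu 0 Down]"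
      using vertex[OF H] by simp
    show ?thesis by (simp add: g1) (simp add: algebra_simps)?
  qed
  have c2: "ev q [Down, Up] [(0, Node XVert)] \<Psi>
      = - ev q [Down, Up] [(0, X)] \<Psi> + q * \<Psi> [Down, Up] []
        + inverse q * ev q [Down, Up] [(0, Cap), (0, Cup)] \<Psi>"
      if H: "\<And>nd. lval [Down, Up] nd (\<Psi> nd)"
  proof -
    have g1: "\<Psi> [Up, Down] [xv 0 Down Up]
        = - \<Psi> [Up, Down] [xp 0 Down Up] + inverse q * \<Psi> [Up, Down] [ca 0 Down, cu 0 Up]"
      using vertex[OF H] by simp
    show ?thesis by (simp add: g1) (simp add: algebra_simps)?
  qed
  have c3: "ev q [Down, Down] [(0, Node XVert)] \<Psi>
      = - ev q [Down, Down] [(0, X)] \<Psi> + q * \<Psi> [Down, Down] []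
        + inverse q * ev q [Down, Down] [(0, Cap), (0, Cup)] \<Psi>"
      if H: "\<And>nd. lval [Down, Down] nd (\<Psi> nd)"
  proof -
    have g1: "\<Psi> [Down, Down] [xv 0 Down Down]
        = - \<Psi> [Down, Down] [xp 0 Down Down] + q * \<Psi> [Down, Down] []"
      using vertex[OF H] by simp
    show ?thesis by (simp add: g1) (simp add: algebra_simps)?
  qed
  from dirs_2[OF len] show ?thesis
  proof (elim disjE)
    assume d: "ds = [Up, Up]"
    show ?thesis unfolding d by (rule c0) (rule H[unfolded d])
  next
    assume d: "ds = [Up, Down]"
    show ?thesis unfolding d by (rule c1) (rule H[unfolded d])
  next
    assume d: "ds = [Down, Up]"
    show ?thesis unfolding d by (rule c2) (rule H[unfolded d])
  next
    assume d: "ds = [Down, Down]"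
    show ?thesis unfolding d by (rule c3) (rule H[unfolded d])
  qed
qed

section \<open>Circles and kinks beside a strand\<close>

lemma clockwise_circle:
  assumes len: "length ds = 1" and H: "\<And>nd. lval ds nd (\<Psi> nd)"
  shows "z * \<Psi> ds [cu 0 Up, ca 0 Up] = (AA - inverse q) * \<Psi> ds []"
    "z * \<Psi> ds [cu (Suc 0) Up, ca (Suc 0) Up] = (AA - inverse q) * \<Psi> ds []"
proof -
  have c0: "z * \<Psi> [Up] [cu 0 Up, ca 0 Up] = (AA - inverse q) * \<Psi> [Up] []"
    "z * \<Psi> [Up] [cu (Suc 0) Up, ca (Suc 0) Up] = (AA - inverse q) * \<Psi> [Up] []" if H: "\<And>nd. lval [Up] nd (\<Psi> nd)"
  proof -
    \<comment> \<open>The value of a circle is postulated only for a diagram that consists of it, so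
      beside a strand it is derived from a curl. The clockwise curl with \<open>XPlus\<close> has
      factor \<open>AA\<close>; with the crossing switched it is a twist with factor 1/q, and the
      skein relation yields the circle as the difference.\<close>
    have a1: "\<Psi> [Up] [cu (Suc 0) Up, xp 0 Up Up, ca (Suc 0) Up] = AA * \<Psi> [Up] []"
      using curl_right_at[OF H, of "[]" "[]" Up "[]" "[]" "[Up]" 0 "Suc 0", simplified]
      by (simp add: curl_def)
    have a2: "\<Psi> [Up] [cu (Suc 0) Up, xp 0 Up Up, ca (Suc 0) Up]
        = \<Psi> [Up] [cu (Suc 0) Up, xm 0 Up Up, ca (Suc 0) Up]
          + z * \<Psi> [Up] [cu (Suc 0) Up, ca (Suc 0) Up]"
      using skein_same[OF H, of "[cu (Suc 0) Up]" "[]" Up "[Down]" "[ca (Suc 0) Up]" "[Up]" 0, simplified]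
      by simp
    have a3: "\<Psi> [Up] [cu (Suc 0) Up, xm 0 Up Up, ca (Suc 0) Up]
        = \<Psi> [Up] [cu 0 Up, xp (Suc 0) Down Up, ca (Suc 0) Up]"
      by (rule chain[OF H, of _ _ "[]"]) (simp add: iso_step_def is_move2_def is_move3_def)
    have a4: "\<Psi> [Up] [cu 0 Up, xp (Suc 0) Down Up, ca (Suc 0) Up]
        = inverse q * \<Psi> [Up] [cu 0 Up, ca (Suc 0) Down]"
      using cap_twist_inv_at[OF H, of "[cu 0 Up]" "[Up]" Down Up "[]" "[]" "[Up]" 1, simplified]
      by (simp add: curl_def)
    have a5: "\<Psi> [Up] [cu 0 Up, ca (Suc 0) Down] = \<Psi> [Up] []"
      by (rule chain[OF H, of _ _ "[]"]) (simp add: iso_step_def is_move2_def is_move3_def)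
    have "AA * \<Psi> [Up] [] = inverse q * \<Psi> [Up] [] + z * \<Psi> [Up] [cu (Suc 0) Up, ca (Suc 0) Up]"
      by (simp only: a1[symmetric] a2 a3 a4 a5)
    then have a6: "z * \<Psi> [Up] [cu (Suc 0) Up, ca (Suc 0) Up] = (AA - inverse q) * \<Psi> [Up] []"
      by (metis add_diff_cancel_left' left_diff_distrib)
    \<comment> \<open>The circle is carried to the other side of the strand: a bigon is created, its
      two crossings are turned at the minimum and at the maximum, and they cancel on the far
      side.\<close>
    have a7: "\<Psi> [Up] [cu (Suc 0) Up, ca (Suc 0) Up] = \<Psi> [Up] [cu 0 Up, ca 0 Up]"
      by (rule chain[OF H, of _ _ "[[cu (Suc 0) Up, xp 0 Up Up, xm 0 Up Up, ca (Suc 0) Up],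
            [cu 0 Up, xm (Suc 0) Down Up, xm 0 Up Up, ca (Suc 0) Up],
            [cu 0 Up, xm (Suc 0) Down Up, xp (Suc 0) Up Down, ca 0 Up]]"]) (simp add: iso_step_def is_move2_def is_move3_def)
    show "z * \<Psi> [Up] [cu 0 Up, ca 0 Up]
        = (AA - inverse q) * \<Psi> [Up] []" "z * \<Psi> [Up] [cu (Suc 0) Up, ca (Suc 0) Up] = (AA
          - inverse q) * \<Psi> [Up] []"
      using a6 a7 by simp_all
  qed
  have c1: "z * \<Psi> [Down] [cu 0 Up, ca 0 Up] = (AA - inverse q) * \<Psi> [Down] []"
    "z * \<Psi> [Down] [cu (Suc 0) Up, ca (Suc 0) Up] = (AA - inverse q) * \<Psi> [Down] []" if H: "\<And>nd. lval [Down] nd (\<Psi> nd)"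
  proof -
    have a1: "\<Psi> [Down] [cu 0 Up, xp (Suc 0) Down Down, ca 0 Up] = AA * \<Psi> [Down] []"
      using curl_left_at[OF H, of "[]" "[]" Down "[]" "[]" "[Down]" 0 "Suc 0" Up, simplified]
      by (simp add: curl_def)
    have a2: "\<Psi> [Down] [cu 0 Up, xp (Suc 0) Down Down, ca 0 Up]
        = \<Psi> [Down] [cu 0 Up, xm (Suc 0) Down Down, ca 0 Up] + z * \<Psi> [Down] [cu 0 Up, ca 0 Up]"
      using skein_same[OF H, of "[cu 0 Up]" "[Up]" Down "[]" "[ca 0 Up]" "[Down]" 1, simplified] by simp
    have a3: "\<Psi> [Down] [cu 0 Up, xm (Suc 0) Down Down, ca 0 Up]
        = \<Psi> [Down] [cu (Suc 0) Up, xp 0 Down Up, ca 0 Up]"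
      by (rule chain[OF H, of _ _ "[]"]) (simp add: iso_step_def is_move2_def is_move3_def)
    have a4: "\<Psi> [Down] [cu (Suc 0) Up, xp 0 Down Up, ca 0 Up]
        = inverse q * \<Psi> [Down] [cu (Suc 0) Up, ca 0 Down]"
      using cap_twist_inv_at[OF H, of "[cu (Suc 0) Up]" "[]" Down Up "[Down]" "[]" "[Down]" 0, simplified]
      by (simp add: curl_def)
    have a5: "\<Psi> [Down] [cu (Suc 0) Up, ca 0 Down] = \<Psi> [Down] []"
      by (rule chain[OF H, of _ _ "[]"]) (simp add: iso_step_def is_move2_def is_move3_def)
    have "AA * \<Psi> [Down] [] = inverse q * \<Psi> [Down] [] + z * \<Psi> [Down] [cu 0 Up, ca 0 Up]"
      by (simp only: a1[symmetric] a2 a3 a4 a5)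
    then have a6: "z * \<Psi> [Down] [cu 0 Up, ca 0 Up] = (AA - inverse q) * \<Psi> [Down] []"
      by (metis add_diff_cancel_left' left_diff_distrib)
    have a7: "\<Psi> [Down] [cu 0 Up, ca 0 Up] = \<Psi> [Down] [cu (Suc 0) Up, ca (Suc 0) Up]"
      by (rule chain[OF H, of _ _ "[[cu 0 Up, xp (Suc 0) Down Down, xm (Suc 0) Down Down, ca 0 Up],
            [cu (Suc 0) Up, xm 0 Down Up, xm (Suc 0) Down Down, ca 0 Up],
            [cu (Suc 0) Up, xm 0 Down Up, xp 0 Up Down, ca (Suc 0) Up]]"]) (simp add: iso_step_def is_move2_def is_move3_def)
    show "z * \<Psi> [Down] [cu 0 Up, ca 0 Up]
        = (AA - inverse q) * \<Psi> [Down] []" "z * \<Psi> [Down] [cu (Suc 0) Up, ca (Suc 0) Up] = (AA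
          - inverse q) * \<Psi> [Down] []"
      using a6 a7 by simp_all
  qed
  from dirs_1[OF len] have "z * \<Psi> ds [cu 0 Up, ca 0 Up] = (AA - inverse q) * \<Psi> ds [] \<and>
    z * \<Psi> ds [cu (Suc 0) Up, ca (Suc 0) Up] = (AA - inverse q) * \<Psi> ds []"
  proof (elim disjE)
    assume d: "ds = [Up]"
    show ?thesis unfolding d using c0 H[unfolded d] by blast
  next
    assume d: "ds = [Down]"
    show ?thesis unfolding d using c1 H[unfolded d] by blast
  qed
  then show "z * \<Psi> ds [cu 0 Up, ca 0 Up] = (AA - inverse q) * \<Psi> ds []"
    "z * \<Psi> ds [cu (Suc 0) Up, ca (Suc 0) Up] = (AA - inverse q) * \<Psi> ds []" by auto
qed

text \<open>For an upward strand the only state is a clockwise curl with factor \<open>AA\<close>.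
  For a downward strand the curl has factor q, and the two smoothings contribute a clockwise circle,
  of value AA - 1/q after multiplication by \<open>z\<close>, and -\<open>z\<close> times a plain
  strand. The sum q + (AA - 1/q) - (q - 1/q) is again \<open>AA\<close>.\<close>

lemma ev_curl_right:
  assumes len: "length ds = 1" and H: "\<And>nd. lval ds nd (\<Psi> nd)"
  shows "ev q ds [(1, Cup), (0, X), (1, Cap)] \<Psi> = AA * \<Psi> ds []"
proof -
  have c0: "ev q [Up] [(1, Cup), (0, X), (1, Cap)] \<Psi>
      = AA * \<Psi> [Up] []" if H: "\<And>nd. lval [Up] nd (\<Psi> nd)"
  proof -
    have g1: "\<Psi> [Up] [cu (Suc 0) Up, xp 0 Up Up, ca (Suc 0) Up] = curl Up * \<Psi> [Up] []"
      using curl_right_at[OF H, of "[]" "[]" Up "[]" "[]" "[Up]" 0 "Suc 0", simplified] by simp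
    have g2: "curl Up = AA" "curl Down = q" by (simp_all add: curl_def)
    show ?thesis by (simp add: g1 g2) (simp add: algebra_simps)?
  qed
  have c1: "ev q [Down] [(1, Cup), (0, X), (1, Cap)] \<Psi>
      = AA * \<Psi> [Down] []" if H: "\<And>nd. lval [Down] nd (\<Psi> nd)"
  proof -
    have f1: "\<Psi> [Down] [cu (Suc 0) Up, ca 0 Down, cu 0 Down, ca (Suc 0) Up] = \<Psi> [Down] []"
      by (rule chain[OF H, of _ _ "[[cu 0 Down, ca (Suc 0) Up]]"]) code_simp
    have g1: "\<Psi> [Down] [cu (Suc 0) Down, xp 0 Down Down, ca (Suc 0) Down] = curl Down * \<Psi> [Down] []"
      using curl_right_at[OF H, of "[]" "[]" Down "[]" "[]" "[Down]" 0 "Suc 0", simplified] by simp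
    have g2: "curl Up = AA" "curl Down = q" by (simp_all add: curl_def)
    have g3: "(q - inverse q) * \<Psi> [Down] [cu (Suc 0) Up, ca (Suc 0) Up]
        = (AA - inverse q) * \<Psi> [Down] []"
      using clockwise_circle(2)[OF _ H] by simp
    show ?thesis by (simp add: f1 g1 g2 g3) (simp add: algebra_simps)?
  qed
  from dirs_1[OF len] show ?thesis
  proof (elim disjE)
    assume d: "ds = [Up]"
    show ?thesis unfolding d by (rule c0) (rule H[unfolded d])
  next
    assume d: "ds = [Down]"
    show ?thesis unfolding d by (rule c1) (rule H[unfolded d])
  qed
qed

lemma ev_curl_left:
  assumes len: "length ds = 1" and H: "\<And>nd. lval ds nd (\<Psi> nd)"
  shows "ev q ds [(0, Cup), (1, X), (0, Cap)] \<Psi> = AA * \<Psi> ds []"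
proof -
  have c0: "ev q [Up] [(0, Cup), (1, X), (0, Cap)] \<Psi>
      = AA * \<Psi> [Up] []" if H: "\<And>nd. lval [Up] nd (\<Psi> nd)"
  proof -
    have f1: "\<Psi> [Up] [cu 0 Up, ca (Suc 0) Down, cu (Suc 0) Down, ca 0 Up] = \<Psi> [Up] []"
      by (rule chain[OF H, of _ _ "[[cu (Suc 0) Down, ca 0 Up]]"]) code_simp
    have g1: "\<Psi> [Up] [cu 0 Down, xp (Suc 0) Up Up, ca 0 Down] = curl Down * \<Psi> [Up] []"
      using curl_left_at[OF H, of "[]" "[]" Up "[]" "[]" "[Up]" 0 "Suc 0" Down, simplified] by simp
    have g2: "curl Up = AA" "curl Down = q" by (simp_all add: curl_def)
    have g3: "(q - inverse q) * \<Psi> [Up] [cu 0 Up, ca 0 Up] = (AA - inverse q) * \<Psi> [Up] []"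
      using clockwise_circle(1)[OF _ H] by simp
    show ?thesis by (simp add: f1 g1 g2 g3) (simp add: algebra_simps)?
  qed
  have c1: "ev q [Down] [(0, Cup), (1, X), (0, Cap)] \<Psi>
      = AA * \<Psi> [Down] []" if H: "\<And>nd. lval [Down] nd (\<Psi> nd)"
  proof -
    have g1: "\<Psi> [Down] [cu 0 Up, xp (Suc 0) Down Down, ca 0 Up] = curl Up * \<Psi> [Down] []"
      using curl_left_at[OF H, of "[]" "[]" Down "[]" "[]" "[Down]" 0 "Suc 0" Up, simplified] by simp
    have g2: "curl Up = AA" "curl Down = q" by (simp_all add: curl_def)
    show ?thesis by (simp add: g1 g2) (simp add: algebra_simps)?
  qed
  from dirs_1[OF len] show ?thesis
  proof (elim disjE)
    assume d: "ds = [Up]"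
    show ?thesis unfolding d by (rule c0) (rule H[unfolded d])
  next
    assume d: "ds = [Down]"
    show ?thesis unfolding d by (rule c1) (rule H[unfolded d])
  qed
qed

end

section \<open>Invariance of the state sum\<close>

lemma ev_Cons_at:
  assumes "length l = i" "length b = bot_width e"
  shows "ev q (l @ b @ r) ((i, e) # D) h
    = (\<Sum>(c, p, t)\<leftarrow>local_states q e b. c * ev q (l @ t @ r) D (\<lambda>nd p'. h nd (shift i p @ p')))"
  using assms by simp

lemma sum_list_swap: "(\<Sum>x\<leftarrow>xs. \<Sum>y\<leftarrow>ys. f x y) = (\<Sum>y\<leftarrow>ys. \<Sum>x\<leftarrow>xs. (f x y :: 'a :: comm_monoid_add))"
  by (induction xs) (simp_all add: sum_list_addf)

context moy_point
begin

text \<open>A resolved piece may consist of no, one or two elementary pieces, so exchanging two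
  states takes several elementary exchanges. The functional varies in the induction because the
  pieces already passed become part of the context.\<close>

lemma exchange_one:
  assumes "ot b [(i, x)] t" "ot b2 p t2" "lval (b @ m @ b2) (t @ m @ t2) \<psi>"
  shows "\<psi> ([(i, x)] @ shift (length t + length m) p) = \<psi> (shift (length b + length m) p @ [(i, x)])"
  using assms(2,3)
proof (induction b2 p t2 arbitrary: \<psi> rule: ot.induct)
  case (2 b2 j y p t2)
  let ?k = "length t + length m" and ?k' = "length b + length m"
  define b2' where "b2' = take j b2 @ top_dirs y @ drop (j + length (bot_dirs y)) b2"
  have y: "ot b2 [(j, y)] b2'" and p: "ot b2' p t2" using "2.prems"(1) by (auto simp: b2'_def)
  have x: "length t + length (bot_dirs x) = length b + length (top_dirs x)" "i + length (bot_dirs x) \<le> length b"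
    "i + length (top_dirs x) \<le> length t"
    using assms(1) by auto
  have xy: "ot (b @ m @ b2) [(i, x)] (t @ m @ b2)" "ot (b @ m @ b2') [(i, x)] (t @ m @ b2')"
    using ot_shift[OF assms(1), of "[]" "m @ b2"] ot_shift[OF assms(1), of "[]" "m @ b2'"] by simp_all
  have yy: "ot (t @ m @ b2) [(?k + j, y)] (t @ m @ b2')" "ot (b @ m @ b2) [(?k' + j, y)] (b @ m @ b2')"
    using ot_shift[OF y, of "t @ m" "[]"] ot_shift[OF y, of "b @ m" "[]"] by simp_all
  have pp: "ot (t @ m @ b2') (shift ?k p) (t @ m @ t2)" using ot_shift[OF p, of "t @ m" "[]"] by simp
  have w: "length (bot_dirs e) = bot_width (forget e)" "length (top_dirs e) = top_width (forget e)" for e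
    by (cases e; simp)+
  have "\<psi> ([] @ [(i, x), (?k + j, y)] @ shift ?k p) = \<psi> ([] @ [(?k' + j, y), (i, x)] @ shift ?k p)"
  proof (rule lval_move[OF "2.prems"(2)])
    show "ot (b @ m @ b2) ([] @ [(i, x), (?k + j, y)] @ shift ?k p) (t @ m @ t2)"
      using xy(1) yy(1) pp ot_append[of _ "[(i, x)]" "(?k + j, y) # shift ?k p"]
        ot_append[of _ "[(?k + j, y)]" "shift ?k p"] by (simp only: append_Nil append_Cons) blast
    show "ot (b @ m @ b2) ([] @ [(?k' + j, y), (i, x)] @ shift ?k p) (t @ m @ t2)"
      using xy(2) yy(2) pp ot_append[of _ "[(?k' + j, y)]" "(i, x) # shift ?k p"]
        ot_append[of _ "[(i, x)]" "shift ?k p"] by (simp only: append_Nil append_Cons) blast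
    define k where "k = ?k + j - (i + top_width (forget x))"
    have "?k + j = i + top_width (forget x) + k" "?k' + j = i + bot_width (forget x) + k"
      using x unfolding k_def w by linarith+
    then show "local_move (underlying [(i, x), (?k + j, y)]) (underlying [(?k' + j, y), (i, x)]) \<or>
      local_move (underlying [(?k' + j, y), (i, x)]) (underlying [(i, x), (?k + j, y)])"
      using local_move.height_exchange[of i "forget x" k "forget y"] by simp
  qed simp
  also have "\<dots> = \<psi> ([(?k' + j, y)] @ shift 0 ([(i, x)] @ shift ?k p) @ [])" by simp
  also have "\<dots> = \<psi> ([(?k' + j, y)] @ shift 0 (shift ?k' p @ [(i, x)]) @ [])"
  proof (rule "2.IH"[of "\<lambda>s. \<psi> ([(?k' + j, y)] @ shift 0 s @ [])"])
    show "ot (take j b2 @ top_dirs y @ drop (j + length (bot_dirs y)) b2) p t2" using p by (simp add: b2'_def)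
    show "lval (b @ m @ take j b2 @ top_dirs y @ drop (j + length (bot_dirs y)) b2) (t @ m @ t2)
      (\<lambda>s. \<psi> ([(?k' + j, y)] @ shift 0 s @ []))"
      by (rule lval_ctx[OF "2.prems"(2), where l = "[]" and r = "[]"]) (use yy(2) in \<open>simp_all add: b2'_def\<close>)
  qed
  finally show ?case by simp
qed simp

lemma exchange_pieces:
  assumes "ot b p t" "ot b2 p2 t2" "lval (b @ m @ b2) (t @ m @ t2) \<psi>"
  shows "\<psi> (p @ shift (length t + length m) p2) = \<psi> (shift (length b + length m) p2 @ p)"
  using assms(1,3)
proof (induction b p t arbitrary: \<psi> rule: ot.induct)
  case (2 b i x p t)
  define b' where "b' = take i b @ top_dirs x @ drop (i + length (bot_dirs x)) b"
  have x: "ot b [(i, x)] b'" and p: "ot b' p t" using "2.prems"(1) by (auto simp: b'_def)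
  have xx: "ot (b @ m @ b2) [(i, x)] (b' @ m @ b2)" using ot_shift[OF x, of "[]" "m @ b2"] by simp
  have pp: "ot (b' @ m @ t2) p (t @ m @ t2)" using ot_shift[OF p, of "[]" "m @ t2"] by simp
  have "\<psi> ([(i, x)] @ shift 0 (p @ shift (length t + length m) p2) @ [])
    = \<psi> ([(i, x)] @ shift 0 (shift (length b' + length m) p2 @ p) @ [])"
    unfolding b'_def
  proof (rule "2.IH"[of "\<lambda>s. \<psi> ([(i, x)] @ shift 0 s @ [])"])
    show "ot (take i b @ top_dirs x @ drop (i + length (bot_dirs x)) b) p t" using p by (simp add: b'_def)
    show "lval ((take i b @ top_dirs x @ drop (i + length (bot_dirs x)) b) @ m @ b2) (t @ m @ t2)
      (\<lambda>s. \<psi> ([(i, x)] @ shift 0 s @ []))"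
      by (rule lval_ctx[OF "2.prems"(2), where l = "[]" and r = "[]"]) (use xx in \<open>simp_all add: b'_def\<close>)
  qed
  also have "\<dots> = \<psi> ([] @ shift 0 ([(i, x)] @ shift (length b' + length m) p2) @ p)" by simp
  also have "\<dots> = \<psi> ([] @ shift 0 (shift (length b + length m) p2 @ [(i, x)]) @ p)"
  proof (rule exchange_one[OF x assms(2), of m "\<lambda>s. \<psi> ([] @ shift 0 s @ p)"])
    show "lval (b @ m @ b2) (b' @ m @ t2) (\<lambda>s. \<psi> ([] @ shift 0 s @ p))"
      by (rule lval_ctx[OF "2.prems"(2), where l = "[]" and r = "[]"]) (use pp in simp_all)
  qed
  finally show ?case by simp
qed simp

text \<open>Both sides are double sums over the states of the two pieces, which are chosen
  independently because the pieces share no strand. The orders of summation differ, and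
  corresponding terms are isotopic.\<close>

lemma ev_exchange:
  assumes len: "length ds = bot_width d + k + bot_width e" and H: "\<And>nd. lval ds nd (\<Psi> nd)"
  shows "ev q ds [(0, d), (top_width d + k, e)] \<Psi> = ev q ds [(bot_width d + k, e), (0, d)] \<Psi>"
proof -
  define b m b2 where "b = take (bot_width d) ds" and "m = take k (drop (bot_width d) ds)"
    and "b2 = drop (bot_width d + k) ds"
  have ds: "ds = b @ m @ b2" unfolding b_def m_def b2_def
    using take_drop3[of ds 0 "bot_width d"] take_drop3[of ds "bot_width d" k] by simp
  have L: "length b = bot_width d" "length m = k" "length b2 = bot_width e"
    using len by (auto simp: b_def m_def b2_def)
  let ?S = "\<lambda>e b. local_states q e b"
  have "ev q ds [(0, d), (top_width d + k, e)] \<Psi>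
    = (\<Sum>(c, p, t)\<leftarrow>?S d b. c * ev q (t @ m @ b2) [(top_width d + k, e)] (\<lambda>nd p'. \<Psi> nd (p @ p')))"
    using ev_Cons_at[of "[]" 0 b d q "m @ b2" "[(top_width d + k, e)]" \<Psi>] L ds by (simp del: ev.simps(2))
  also have "\<dots> = (\<Sum>(c, p, t)\<leftarrow>?S d b. c * (\<Sum>(c', p', t')\<leftarrow>?S e b2. c' * \<Psi> (t @ m @ t') (p @ shift (top_width d + k) p')))"
  proof (intro sum_list_cong, clarify)
    fix c p t assume "(c, p, t) \<in> set (?S d b)"
    then have "length (t @ m) = top_width d + k" using local_states_ot(3) L by simp
    from ev_Cons_at[OF this L(3), of q "[]" "[]"]
    show "c * ev q (t @ m @ b2) [(top_width d + k, e)] (\<lambda>nd p'. \<Psi> nd (p @ p'))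
      = c * (\<Sum>(c', p', t')\<leftarrow>?S e b2. c' * \<Psi> (t @ m @ t') (p @ shift (top_width d + k) p'))"
      by (simp del: ev.simps(2))
  qed
  also have "\<dots> = (\<Sum>y\<leftarrow>?S d b. \<Sum>y'\<leftarrow>?S e b2. fst y * (fst y' *
      \<Psi> (snd (snd y) @ m @ snd (snd y')) (fst (snd y) @ shift (top_width d + k) (fst (snd y')))))"
    by (simp add: case_prod_unfold sum_list_const_mult)
  also have "\<dots> = (\<Sum>y\<leftarrow>?S d b. \<Sum>y'\<leftarrow>?S e b2. fst y * (fst y' *
      \<Psi> (snd (snd y) @ m @ snd (snd y')) (shift (bot_width d + k) (fst (snd y')) @ fst (snd y))))"
  proof (intro sum_list_cong)
    fix y y' assume y: "y \<in> set (?S d b)" "y' \<in> set (?S e b2)"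
    obtain c p t c' p' t' where yy: "y = (c, p, t)" "y' = (c', p', t')" by (cases y; cases y') 
    have "\<Psi> (t @ m @ t') (p @ shift (length t + length m) p')
        = \<Psi> (t @ m @ t') (shift (length b + length m) p' @ p)"
      using y yy by (intro exchange_pieces[of b p t b2 p' t' m] H[unfolded ds]) (auto intro: local_states_ot)
    then show "fst y * (fst y' * \<Psi> (snd (snd y) @ m @ snd (snd y')) (fst (snd y) @ shift (top_width d + k) (fst (snd y'))))
     = fst y * (fst y' * \<Psi> (snd (snd y) @ m @ snd (snd y')) (shift (bot_width d + k) (fst (snd y')) @ fst (snd y)))"
      using L local_states_ot(3)[of c p t q d b] y yy by simp
  qed
  also have "\<dots> = (\<Sum>y'\<leftarrow>?S e b2. \<Sum>y\<leftarrow>?S d b. fst y' * (fst y *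
      \<Psi> (snd (snd y) @ m @ snd (snd y')) (shift (bot_width d + k) (fst (snd y')) @ fst (snd y))))"
    by (subst sum_list_swap) (simp add: mult.left_commute)
  also have "\<dots> = (\<Sum>(c', p', t')\<leftarrow>?S e b2. c' * (\<Sum>(c, p, t)\<leftarrow>?S d b. c * \<Psi> (t @ m @ t') (shift (bot_width d + k) p' @ p)))"
    by (simp add: case_prod_unfold sum_list_const_mult)
  also have "\<dots> = (\<Sum>(c', p', t')\<leftarrow>?S e b2. c' * ev q (b @ m @ t') [(0, d)] (\<lambda>nd p. \<Psi> nd (shift (bot_width d + k) p' @ p)))"
    using ev_Cons_at[of "[]" 0 b d q _ "[]"] L by (simp add: case_prod_unfold del: ev.simps(2))
  also have "\<dots> = ev q ds [(bot_width d + k, e), (0, d)] \<Psi>"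
    using ev_Cons_at[of "b @ m" "bot_width d + k" b2 e q "[]" "[(0, d)]" \<Psi>] L ds
    by (simp del: ev.simps(2))
  finally show ?thesis .
qed

section \<open>Relations of the state sum for closed diagrams\<close>

lemma F_eq:
  assumes "\<And>ds \<Psi>. length ds = m \<Longrightarrow> (\<And>nd. lval ds nd (\<Psi> nd)) \<Longrightarrow> ev q ds s \<Psi> = ev q ds t \<Psi>"
    and "tangle m s n" "tangle m t n'" "tangle 0 u j" "i + m \<le> j"
  shows "F (u @ shift i s @ v) = F (u @ shift i t @ v)"
proof -
  have "(\<Sum>(c, w)\<leftarrow>[(1, s), (- 1, t)]. c * F (u @ shift i w @ v)) = 0"
  proof (rule F_local[where m = m and j = j])
    fix ds \<Psi> assume "length ds = m" "\<And>nd. lval ds nd (\<Psi> nd)"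
    then show "(\<Sum>(c, w)\<leftarrow>[(1, s), (- 1, t)]. c * ev q ds w \<Psi>) = 0" using assms(1) by simp
  qed (use assms in auto)
  then show ?thesis by simp
qed

lemma F_move:
  assumes "core_move s t" "knotted_graph (u @ s @ v)" "vertex_free (u @ s @ v)"
  shows "F (u @ s @ v) = F (u @ t @ v)"
proof -
  obtain j n where j: "tangle 0 u j" "tangle j s n"
    using assms(2) by (auto simp: knotted_graph_def tangle_append)
  from assms(1) show ?thesis
  proof cases
    case (exchange i d k e)
    then have "i + (bot_width d + k + bot_width e) \<le> j" using j(2) by auto
    then show ?thesis
      using F_eq[of "bot_width d + k + bot_width e" "[(0, d), (top_width d + k, e)]" "[(bot_width d + k, e), (0, d)]" _ _ u j i v,
          OF ev_exchange _ _ j(1)] exchange by (simp add: add_ac)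
  next
    case (zigzag1 i)
    have le: "i + 1 \<le> j" using j(2) zigzag1 by simp
    have "ev q ds [(0, Cup), (1, Cap)] \<Psi>
        = ev q ds [] \<Psi>" if "length ds = 1" "\<And>nd. lval ds nd (\<Psi> nd)" for ds \<Psi>
      unfolding ev.simps(1) using that by (rule ev_zigzag1)
    from F_eq[OF this _ _ j(1) le, of 1 1 v] show ?thesis using zigzag1 by simp
  next
    case (zigzag2 i)
    have le: "i + 1 \<le> j" using j(2) zigzag2 by simp
    have "ev q ds [(1, Cup), (0, Cap)] \<Psi>
        = ev q ds [] \<Psi>" if "length ds = 1" "\<And>nd. lval ds nd (\<Psi> nd)" for ds \<Psi>
      unfolding ev.simps(1) using that by (rule ev_zigzag2)
    from F_eq[OF this _ _ j(1) le, of 1 1 v] show ?thesis using zigzag2 by simp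
  next
    case (cupslide x i)
    have le: "i + 1 \<le> j" using j(2) cupslide by simp
    show ?thesis
    proof (cases x)
      case XPlus
      from F_eq[OF ev_cupslideX _ _ j(1) le, of 3 3 v] show ?thesis using cupslide XPlus by simp
    next
      case XMinus
      from F_eq[OF ev_cupslideY _ _ j(1) le, of 3 3 v] show ?thesis using cupslide XMinus by simp
    qed (use cupslide in simp)
  next
    case (capslide x i)
    have le: "i + 3 \<le> j" using j(2) capslide by simp
    show ?thesis
    proof (cases x)
      case XPlus
      from F_eq[OF ev_capslideX _ _ j(1) le, of 1 1 v] show ?thesis using capslide XPlus by simp
    next
      case XMinus
      from F_eq[OF ev_capslideY _ _ j(1) le, of 1 1 v] show ?thesis using capslide XMinus by simp
    qed (use capslide in simp)
  next
    case (bigon i)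
    have le: "i + 2 \<le> j" using j(2) bigon by simp
    have "ev q ds [(0, X), (0, Y)] \<Psi>
        = ev q ds [] \<Psi>" if "length ds = 2" "\<And>nd. lval ds nd (\<Psi> nd)" for ds \<Psi>
      unfolding ev.simps(1) using that by (rule ev_bigon)
    from F_eq[OF this _ _ j(1) le, of 2 2 v] show ?thesis using bigon by simp
  next
    case (braid i)
    have "i + 3 \<le> j" using j(2) braid by (simp, linarith)
    from F_eq[OF ev_braid _ _ j(1) this, of 3 3 v] show ?thesis using braid by simp
  qed
qed

lemma F_skein:
  assumes "knotted_graph (u @ [(i, X)] @ v)"
  shows "F (u @ [(i, X)] @ v) - F (u @ [(i, Y)] @ v) = z * (F (u @ v) - F (u @ [(i, Cap), (i, Cup)] @ v))"
proof -
  obtain j where j: "tangle 0 u j" "i + 2 \<le> j"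
    using assms by (auto simp: knotted_graph_def tangle_append)
  have "(\<Sum>(c, w)\<leftarrow>[(1, [(0, X)]), (- 1, [(0, Y)]), (- z, []), (z, [(0, Cap), (0, Cup)])]. c * F (u @ shift i w @ v)) = 0"
  proof (rule F_local[where m = 2, OF _ _ j])
    fix ds \<Psi> assume "length ds = 2" "\<And>nd. lval ds nd (\<Psi> nd)"
    from ev_skein[OF this]
    show "(\<Sum>(c, w)\<leftarrow>[(1, [(0, X)]), (- 1, [(0, Y)]), (- z, []), (z, [(0, Cap), (0, Cup)])]. c * ev q ds w \<Psi>)
        = 0"
      by (simp del: ev.simps(2) add: algebra_simps)
  qed auto
  then show ?thesis by (simp add: algebra_simps)
qed

lemma F_vertex:
  assumes "knotted_graph (u @ [(i, Node XVert)] @ v)"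
  shows "F (u @ [(i, Node XVert)] @ v) = - F (u @ [(i, X)] @ v) + q * F (u @ v) + inverse q * F (u @ [(i, Cap), (i, Cup)] @ v)"
proof -
  obtain j where j: "tangle 0 u j" "i + 2 \<le> j"
    using assms by (auto simp: knotted_graph_def tangle_append)
  have "(\<Sum>(c, w)\<leftarrow>[(1, [(0, Node XVert)]), (1, [(0, X)]), (- q, []), (- inverse q, [(0, Cap), (0, Cup)])]. c * F (u @ shift i w @ v)) = 0"
  proof (rule F_local[where m = 2, OF _ _ j])
    fix ds \<Psi> assume "length ds = 2" "\<And>nd. lval ds nd (\<Psi> nd)"
    from ev_vertex[OF this]
    show "(\<Sum>(c, w)\<leftarrow>[(1, [(0, Node XVert)]), (1, [(0, X)]), (- q, []), (- inverse q, [(0, Cap), (0, Cup)])]. c * ev q ds w \<Psi>)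
        = 0"
      by (simp del: ev.simps(2))
  qed auto
  then show ?thesis by (simp add: algebra_simps)
qed

lemma F_curl:
  assumes "tangle 0 u j" "Suc i \<le> j"
  shows "F (u @ [(Suc i, Cup), (i, X), (Suc i, Cap)] @ v) = AA * F (u @ v)"
    "F (u @ [(i, Cup), (Suc i, X), (i, Cap)] @ v) = AA * F (u @ v)"
proof -
  have "(\<Sum>(c, w)\<leftarrow>[(1, s), (- AA, [])]. c * F (u @ shift i w @ v)) = 0"
    if "\<And>ds \<Psi>. length ds = 1 \<Longrightarrow> (\<And>nd. lval ds nd (\<Psi> nd)) \<Longrightarrow> ev q ds s \<Psi> = AA * \<Psi> ds []"
      "tangle 1 s 1" for s
  proof (rule F_local[where m = 1])
    fix ds \<Psi> assume "length ds = 1" "\<And>nd. lval ds nd (\<Psi> nd)"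
    then show "(\<Sum>(c, w)\<leftarrow>[(1, s), (- AA, [])]. c * ev q ds w \<Psi>) = 0" using that(1) by simp
  qed (use assms that(2) in auto)
  from this[OF ev_curl_right] this[OF ev_curl_left]
  show "F (u @ [(Suc i, Cup), (i, X), (Suc i, Cap)] @ v) = AA * F (u @ v)"
    "F (u @ [(i, Cup), (Suc i, X), (i, Cap)] @ v) = AA * F (u @ v)"
    by simp_all
qed

lemma F_empty: "F [] = 1"
  using R_empty by (simp add: F_def G_def rot_def)

lemma F_circle: "F [(0, Cup), (0, Cap)] = (AA - inverse AA) / z + 1"
proof -
  have "F [(0, Cup), (0, Cap)] = G [(0, OCup Up), (0, OCap Up)] + G [(0, OCup Down), (0, OCap Down)]"
    by (simp add: F_def)
  \<comment> \<open>The clockwise and the counterclockwise circle have rotation numbers -1 and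
    1.\<close>
  also have "\<dots> = (inverse (inverse a * q) + inverse a * q) * ((a - inverse a) / z)"
    using R_circle by (simp add: G_def rot_def power_int_minus distrib_right add_divide_distrib)
  also have "\<dots> = (AA - inverse AA) / z + 1"
    using nz by (simp add: field_simps power2_eq_square)
  finally show ?thesis .
qed

sublocale F: kv_skein F z AA
proof
  show "z \<noteq> 0" "AA \<noteq> 0" using nz by simp_all
  fix u v i
  show "F (u @ [(Suc i, Cup), (i, X), (Suc i, Cap)] @ v) = AA * F (u @ v)"
    if "knotted_graph (u @ [(Suc i, Cup), (i, X), (Suc i, Cap)] @ v)"
    using that F_curl(1) by (auto simp: knotted_graph_def tangle_append)
  show "F (u @ [(i, Cup), (Suc i, X), (i, Cap)] @ v) = AA * F (u @ v)"
    if "knotted_graph (u @ [(i, Cup), (Suc i, X), (i, Cap)] @ v)"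
    using that F_curl(2) by (auto simp: knotted_graph_def tangle_append)
qed (use F_move F_empty F_circle F_skein in blast)+

end

section \<open>The recursive evaluation as a sum over orientations and resolutions\<close>

definition local_orientations :: "elem \<Rightarrow> dir list \<Rightarrow> oelem list" where
  "local_orientations e ds = filter (\<lambda>o'. bot_dirs o' = ds \<and> balanced o' \<and> \<not> top_inward o') (orients e)"

lemma distinct_orients: "distinct (orients e)"
  by (cases e) auto

lemma set_orients: "o' \<in> set (orients e) \<longleftrightarrow> forget o' = e"
proof
  assume e: "forget o' = e"
  have d: "d = Up \<or> d = Down" for d by (cases d) auto
  show "o' \<in> set (orients e)"
  proof (cases o')
    case (ONode x sw se nw ne)
    then show ?thesis using e d[of sw] d[of se] d[of nw] d[of ne] by auto
  qed (use e d in auto)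
next
  assume "o' \<in> set (orients e)"
  then show "forget o' = e" by (cases e) auto
qed

lemma choice_list: "distinct (choice_list e)" "set (choice_list e) = choices e"
  by (auto simp: choice_list_def)

lemma shift_resolve_at: "shift i (resolve_at (0, e) r) = resolve_at (i, e) r"
  by (cases r; cases e) auto

lemma sum_list_concat_map: "(\<Sum>y\<leftarrow>concat (map g xs). f y) = (\<Sum>x\<leftarrow>xs. \<Sum>y\<leftarrow>g x. (f y :: 'a :: monoid_add))"
  by (induction xs) auto

lemma sum_local_states:
  "(\<Sum>(c, p, t)\<leftarrow>local_states q e ds. c * f p t)
    = (\<Sum>o'\<in>set (local_orientations e ds). \<Sum>r\<in>choices o'. local_weight q r * f (resolve_at (0, o') r) (top_dirs o'))"
proof -
  have "(\<Sum>(c, p, t)\<leftarrow>local_states q e ds. c * f p t)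
    = (\<Sum>o'\<leftarrow>local_orientations e ds. \<Sum>r\<leftarrow>choice_list o'. local_weight q r * f (resolve_at (0, o') r) (top_dirs o'))"
    unfolding local_states_def local_orientations_def[symmetric] sum_list_concat_map
    by (simp add: comp_def)
  also have "\<dots> = (\<Sum>o'\<leftarrow>local_orientations e ds. \<Sum>r\<in>choices o'. local_weight q r * f (resolve_at (0, o') r) (top_dirs o'))"
    by (simp del: choices.simps add: sum_list_distinct_conv_sum_set choice_list)
  also have "\<dots> = (\<Sum>o'\<in>set (local_orientations e ds). \<Sum>r\<in>choices o'. local_weight q r * f (resolve_at (0, o') r) (top_dirs o'))"
    by (simp del: choices.simps add: sum_list_distinct_conv_sum_set local_orientations_def distinct_orients)
  finally show ?thesis .
qed

text \<open>The admissible orientations of a piece with prescribed ends. Closed diagrams alone would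
  not allow a recursion over the slices.\<close>

definition orientations :: "dir list \<Rightarrow> diagram \<Rightarrow> dir list \<Rightarrow> odiagram set" where
  "orientations ds D es = {E. otangle ds E es \<and> underlying E = D \<and> (\<forall>(i, e)\<in>set E. \<not> top_inward e)}"

lemma orientations_Nil: "orientations ds [] es = (if ds = es then {[]} else {})"
  by (auto simp: orientations_def underlying_def)

lemma orientations_Cons:
  "orientations ds ((i, e) # D) es = (if i + bot_width e \<le> length ds then
     (\<lambda>(o', E). (i, o') # E) ` (SIGMA o':set (local_orientations e (take (bot_width e) (drop i ds))).
        orientations (take i ds @ top_dirs o' @ drop (i + bot_width e) ds) D es) else {})"
  (is "?L = ?R")
proof -
  have w: "length (bot_dirs o') = bot_width (forget o')" for o' by (cases o') auto
  have "E \<in> ?L \<longleftrightarrow> E \<in> ?R" for E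
  proof (cases E)
    case Nil
    then show ?thesis by (auto simp: orientations_def underlying_def)
  next
    case (Cons p E')
    obtain j o' where p: "p = (j, o')" by (cases p)
    have "E \<in> ?L \<longleftrightarrow> j = i \<and> forget o' = e \<and> underlying E' = D \<and> \<not> top_inward o' \<and>
        (\<forall>(i, e)\<in>set E'. \<not> top_inward e) \<and> balanced o' \<and> i + bot_width e \<le> length ds \<and>
        take (bot_width e) (drop i ds) = bot_dirs o' \<and>
        otangle (take i ds @ top_dirs o' @ drop (i + bot_width e) ds) E' es"
      by (auto simp: orientations_def Cons p otangle_Cons w simp del: otangle.simps(2))
    also have "\<dots> \<longleftrightarrow> E \<in> ?R"
      by (auto simp: orientations_def Cons p local_orientations_def set_orients)
    finally show ?thesis .
  qed
  then show ?thesis by blast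
qed

lemma finite_orientations: "finite (orientations ds D es)"
proof (induction D arbitrary: ds)
  case (Cons p D)
  then show ?case by (cases p) (simp add: orientations_Cons)
qed (simp add: orientations_Nil)

lemma sum_resolutions_Cons:
  "(\<Sum>\<sigma>\<in>\<Sigma>\<^sub>r ((i, e) # E). f \<sigma>) = (\<Sum>r\<in>choices e. \<Sum>\<sigma>\<in>\<Sigma>\<^sub>r E. f (r # \<sigma>))"
proof -
  have "\<Sigma>\<^sub>r ((i, e) # E) = (\<lambda>(r, \<sigma>). r # \<sigma>) ` (choices e \<times> \<Sigma>\<^sub>r E)"
    by (auto simp: resolutions_def set_Cons_def simp del: choices.simps)
  moreover have "inj_on (\<lambda>(r, \<sigma>). r # \<sigma>) (choices e \<times> \<Sigma>\<^sub>r E)" by (auto simp: inj_on_def)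
  ultimately have "(\<Sum>\<sigma>\<in>\<Sigma>\<^sub>r ((i, e) # E). f \<sigma>) = (\<Sum>y\<in>choices e \<times> \<Sigma>\<^sub>r E. f (case y of (r, \<sigma>) \<Rightarrow> r # \<sigma>))"
    by (simp del: choices.simps add: sum.reindex)
  then show ?thesis by (simp del: choices.simps add: sum.cartesian_product case_prod_unfold)
qed

text \<open>Induction over the slices. The function \<open>g\<close> has to be arbitrary, because
  removing the lowest piece replaces it by the function that first puts the resolved piece in
  front.\<close>

lemma state_sum:
  "(\<Sum>E\<in>orientations ds D es. \<Sum>\<sigma>\<in>\<Sigma>\<^sub>r E. weight q \<sigma> * g (resolve E \<sigma>))
    = ev q ds D (\<lambda>nd p. if nd = es then g p else 0)"
proof (induction D arbitrary: ds g)
  case Nil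
  then show ?case by (simp add: orientations_Nil resolutions_def weight_def resolve_def)
next
  case (Cons p D)
  obtain i e where p: "p = (i, e)" by (cases p)
  show ?case
  proof (cases "i + bot_width e \<le> length ds")
    case False
    then show ?thesis by (simp add: p orientations_Cons)
  next
    case True
    let ?O = "set (local_orientations e (take (bot_width e) (drop i ds)))"
    let ?nd = "\<lambda>t. take i ds @ t @ drop (i + bot_width e) ds"
    let ?W = "\<lambda>E. \<Sum>\<sigma>\<in>\<Sigma>\<^sub>r E. weight q \<sigma> * g (resolve E \<sigma>)"
    have "(\<Sum>E\<in>orientations ds (p # D) es. ?W E)
      = (\<Sum>y\<in>(SIGMA o':?O. orientations (?nd (top_dirs o')) D es). ?W (case y of (o', E) \<Rightarrow> (i, o') # E))"
      using True
      by (simp del: choices.simps add: p orientations_Cons sum.reindex inj_on_def case_prod_unfold prod_eq_iff)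
    also have "\<dots> = (\<Sum>o'\<in>?O. \<Sum>E\<in>orientations (?nd (top_dirs o')) D es. ?W ((i, o') # E))"
      by (simp del: choices.simps add: sum.Sigma finite_orientations case_prod_unfold)
    also have "\<dots> = (\<Sum>o'\<in>?O. \<Sum>r\<in>choices o'. local_weight q r *
        ev q (?nd (top_dirs o')) D (\<lambda>nd p. if nd = es then g (shift i (resolve_at (0, o') r) @ p) else 0))"
    proof (intro sum.cong refl)
      fix o'
      have "(\<Sum>E\<in>orientations (?nd (top_dirs o')) D es. ?W ((i, o') # E))
        = (\<Sum>E\<in>orientations (?nd (top_dirs o')) D es. \<Sum>r\<in>choices o'. local_weight q r *
            (\<Sum>\<sigma>\<in>\<Sigma>\<^sub>r E. weight q \<sigma> * g (shift i (resolve_at (0, o') r) @ resolve E \<sigma>)))"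
        by (simp del: choices.simps add: sum_resolutions_Cons weight_def resolve_def shift_resolve_at sum_distrib_left mult.assoc)
      also have "\<dots> = (\<Sum>r\<in>choices o'. local_weight q r * (\<Sum>E\<in>orientations (?nd (top_dirs o')) D es.
            (\<Sum>\<sigma>\<in>\<Sigma>\<^sub>r E. weight q \<sigma> * g (shift i (resolve_at (0, o') r) @ resolve E \<sigma>))))"
        by (subst sum.swap) (simp del: choices.simps add: sum_distrib_left)
      also have "\<dots> = (\<Sum>r\<in>choices o'. local_weight q r *
        ev q (?nd (top_dirs o')) D (\<lambda>nd p. if nd = es then g (shift i (resolve_at (0, o') r) @ p) else 0))"
      proof (intro sum.cong arg_cong[of _ _ "\<lambda>y. _ * y"] refl)
        fix r
        define g' where "g' p = g (shift i (resolve_at (0, o') r) @ p)" for p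
        have "(\<Sum>E\<in>orientations (?nd (top_dirs o')) D es. \<Sum>\<sigma>\<in>\<Sigma>\<^sub>r E. weight q \<sigma> * g' (resolve E \<sigma>))
          = ev q (?nd (top_dirs o')) D (\<lambda>nd p. if nd = es then g' p else 0)"
          by (rule Cons.IH)
        then show "(\<Sum>E\<in>orientations (?nd (top_dirs o')) D es. \<Sum>\<sigma>\<in>\<Sigma>\<^sub>r E.
            weight q \<sigma> * g (shift i (resolve_at (0, o') r) @ resolve E \<sigma>))
          = ev q (?nd (top_dirs o')) D (\<lambda>nd p. if nd = es then g (shift i (resolve_at (0, o') r) @ p) else 0)"
          unfolding g'_def .
      qed
      finally show "(\<Sum>E\<in>orientations (?nd (top_dirs o')) D es. ?W ((i, o') # E)) = \<dots>" .
    qed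
    also have "\<dots> = ev q ds (p # D) (\<lambda>nd p. if nd = es then g p else 0)"
      using True sum_local_states[where f = "\<lambda>p t. ev q (?nd t) D (\<lambda>nd p'. if nd = es then g (shift i p @ p') else 0)"]
      by (simp del: choices.simps add: p)
    finally show ?thesis .
  qed
qed

lemma (in moy_point) F_state_sum:
  "F D = (\<Sum>E\<in>\<O> D. \<Sum>\<sigma>\<in>\<Sigma>\<^sub>r E. weight q \<sigma> * G (resolve E \<sigma>))"
proof -
  have "\<O> D = orientations [] D []"
    by (auto simp: admissible_orientations_def balanced_orientation_def orientations_def)
  then show ?thesis using state_sum[where g = G] by (simp add: F_def)
qed

section \<open>Comparison of the two invariants and specialization\<close>

lemma kauffman_vogel_skein:
  fixes q :: "'k::field"
  assumes P: "kauffman_vogel P" and gen: "generic q A"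
  shows "kv_skein (\<lambda>D. P D q A) (q - inverse q) A"
proof -
  note R = mp[OF P[unfolded kauffman_vogel_def, THEN spec, THEN spec] gen]
  note R1 = R[THEN conjunct1, rule_format] and R2 = R[THEN conjunct2, THEN conjunct1]
    and R3 = R[THEN conjunct2, THEN conjunct2, THEN conjunct1]
    and R4 = R[THEN conjunct2, THEN conjunct2, THEN conjunct2, THEN conjunct1, rule_format]
    and R5 = R[THEN conjunct2, THEN conjunct2, THEN conjunct2, THEN conjunct2, THEN conjunct1, rule_format]
    and R6 = R[THEN conjunct2, THEN conjunct2, THEN conjunct2, THEN conjunct2, THEN conjunct2, THEN conjunct1, rule_format]
  show ?thesis
  proof
    show "q - inverse q \<noteq> 0" "A \<noteq> 0" using gen by (auto simp: generic_def)
    show "P [] q A = 1" by (rule R2)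
    show "P [(0, Cup), (0, Cap)] q A = (A - inverse A) / (q - inverse q) + 1" by (rule R3)
    fix u v i
    show "P (u @ [(i, Node XPlus)] @ v) q A - P (u @ [(i, Node XMinus)] @ v) q A
       = (q - inverse q) * (P (u @ v) q A - P (u @ [(i, Cap), (i, Cup)] @ v) q A)"
      if "knotted_graph (u @ [(i, Node XPlus)] @ v)"
      using R4[OF that] .
    show "P (u @ [(Suc i, Cup), (i, Node XPlus), (Suc i, Cap)] @ v) q A = A * P (u @ v) q A"
      if "knotted_graph (u @ [(Suc i, Cup), (i, Node XPlus), (Suc i, Cap)] @ v)"
      using R5[of u i v] that by simp
    show "P (u @ [(i, Cup), (Suc i, Node XPlus), (i, Cap)] @ v) q A = A * P (u @ v) q A"
      if "knotted_graph (u @ [(i, Cup), (Suc i, Node XPlus), (i, Cap)] @ v)"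
      using R6[of u i v] that by simp
  next
    fix s t u v
    assume st: "core_move s t" "knotted_graph (u @ s @ v)"
    have "local_move s t" using st(1)
    proof cases
      case exchange then show ?thesis using local_move.height_exchange by simp
    next
      case (zigzag1 i) then show ?thesis using local_move.zigzag_left[of i] by simp
    next
      case (zigzag2 i) then show ?thesis using local_move.zigzag_right[of i] by simp
    next
      case (cupslide x i) then show ?thesis using local_move.cup_slide[of i x] by simp
    next
      case (capslide x i) then show ?thesis using local_move.cap_slide[of i x] by simp
    next
      case (bigon i) then show ?thesis using local_move.reidemeister2[of XPlus i] by simp
    next
      case (braid i) then show ?thesis using local_move.strand_slide[of XPlus i XPlus] by simp
    qed
    moreover have "knotted_graph (u @ t @ v)"
      using knotted_local[OF st(2) core_move_tangle[OF st(1)]] .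
    ultimately have "isotopy_step (u @ s @ v) (u @ t @ v)"
      using st(2) unfolding isotopy_step_def by blast
    then have "isotopic (u @ s @ v) (u @ t @ v)"
      unfolding isotopic_def by (intro r_into_rtranclp) simp
    then show "P (u @ s @ v) q A = P (u @ t @ v) q A" by (rule R1)
  qed
qed

definition vertices :: "diagram \<Rightarrow> nat" where
  "vertices D = length (filter (\<lambda>p. snd p = Node XVert) D)"

text \<open>The vertex relation expresses a diagram by three diagrams with one vertex less, so
  agreement spreads from vertex-free diagrams by induction on the number of vertices.\<close>

lemma vertex_elimination:
  fixes f g :: "diagram \<Rightarrow> 'k::field"
  assumes vf: "\<And>D. knotted_graph D \<Longrightarrow> vertex_free D \<Longrightarrow> f D = g D"
    and f: "\<And>u i v. knotted_graph (u @ [(i, Node XVert)] @ v) \<Longrightarrow> f (u @ [(i, Node XVert)] @ v)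
      = - f (u @ [(i, Node XPlus)] @ v) + q * f (u @ v) + inverse q * f (u @ [(i, Cap), (i, Cup)] @ v)"
    and g: "\<And>u i v. knotted_graph (u @ [(i, Node XVert)] @ v) \<Longrightarrow> g (u @ [(i, Node XVert)] @ v)
      = - g (u @ [(i, Node XPlus)] @ v) + q * g (u @ v) + inverse q * g (u @ [(i, Cap), (i, Cup)] @ v)"
    and "knotted_graph D"
  shows "f D = g D"
  using assms(4)
proof (induction "vertices D" arbitrary: D rule: less_induct)
  case less
  show ?case
  proof (cases "vertex_free D")
    case False
    then obtain i where "(i, Node XVert) \<in> set D" by (auto simp: vertex_free_def)
    then obtain u v where D: "D = u @ [(i, Node XVert)] @ v" by (metis split_list append_Cons append_Nil)
    have k: "knotted_graph (u @ s @ v)" if "s \<in> {[], [(i, Node XPlus)], [(i, Cap), (i, Cup)]}" for s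
      using knotted_local[of u "[(i, Node XVert)]" v s] less.prems that by (auto simp: D two_le_pred)
    have "f (u @ s @ v) = g (u @ s @ v)" if "s \<in> {[], [(i, Node XPlus)], [(i, Cap), (i, Cup)]}" for s
      by (rule less.hyps) (use that k[OF that] in \<open>auto simp: D vertices_def\<close>)
    from this[of "[]"] this[of "[(i, Node XPlus)]"] this[of "[(i, Cap), (i, Cup)]"]
    show ?thesis using f[of u i v] g[of u i v] less.prems by (simp add: D)
  qed (use vf less.prems in blast)
qed

lemma state_sum_formula:
  fixes P :: "diagram \<Rightarrow> 'k::field \<Rightarrow> 'k \<Rightarrow> 'k"
  assumes P: "kauffman_vogel P" and R: "moy R" and D: "knotted_graph D" and gen: "generic q a"
  shows "P D q (a\<^sup>2 * inverse q) =
      (\<Sum>E\<in>\<O> D. \<Sum>\<sigma>\<in>\<Sigma>\<^sub>r E. (inverse a * q) powi rot (resolve E \<sigma>) * weight q \<sigma> * R (resolve E \<sigma>) q a)"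
proof -
  interpret moy_point R q a using R gen by unfold_locales
  have gen': "generic q AA" using gen by (auto simp: generic_def)
  interpret K: kv_skein "\<lambda>D. P D q AA" z AA by (rule kauffman_vogel_skein[OF P gen'])
  interpret kv_skein_pair "\<lambda>D. P D q AA" F z AA ..
  note PR = mp[OF P[unfolded kauffman_vogel_def, THEN spec, THEN spec] gen', THEN conjunct2, THEN conjunct2, THEN conjunct2,
      THEN conjunct2, THEN conjunct2, THEN conjunct2, rule_format, THEN conjunct1]
  have "P D q AA = F D"
    by (rule vertex_elimination[of "\<lambda>D. P D q AA" F q, OF unique PR F_vertex D])
  then show ?thesis by (simp add: F_state_sum G_def mult_ac)
qed

theorem theorem1p1:
  fixes P :: "diagram \<Rightarrow> 'k::field \<Rightarrow> 'k \<Rightarrow> 'k"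
    and R :: "odiagram \<Rightarrow> 'k \<Rightarrow> 'k \<Rightarrow> 'k"
    and D :: diagram
  assumes "kauffman_vogel P" and "moy R" and "knotted_graph D"
  shows "(\<forall>q a. generic q a \<longrightarrow>
            P D q (a\<^sup>2 * inverse q) =
              (\<Sum>E\<in>\<O> D. \<Sum>\<sigma>\<in>\<Sigma>\<^sub>r E.
                 (inverse a * q) powi rot (resolve E \<sigma>) * weight q \<sigma> * R (resolve E \<sigma>) q a)) \<and>
         (\<forall>N::nat. \<forall>q. N \<ge> 1 \<longrightarrow> q \<noteq> 0 \<longrightarrow> q - inverse q \<noteq> 0 \<longrightarrow>
            P D q (q ^ (2 * N - 1)) =
              (\<Sum>E\<in>\<O> D. \<Sum>\<sigma>\<in>\<Sigma>\<^sub>r E.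
                 q powi (- (int N - 1) * rot (resolve E \<sigma>)) * weight q \<sigma>
                   * R (resolve E \<sigma>) q (q ^ N)))"
proof (intro conjI allI impI)
  fix q a :: 'k assume "generic q a"
  then show "P D q (a\<^sup>2 * inverse q) = (\<Sum>E\<in>\<O> D. \<Sum>\<sigma>\<in>\<Sigma>\<^sub>r E.
                 (inverse a * q) powi rot (resolve E \<sigma>) * weight q \<sigma> * R (resolve E \<sigma>) q a)"
    by (rule state_sum_formula[OF assms])
next
  fix N :: nat and q :: 'k
  assume N: "N \<ge> 1" and q: "q \<noteq> 0" "q - inverse q \<noteq> 0"
  then have gen: "generic q (q ^ N)" by (simp add: generic_def)
  \<comment> \<open>The exponent uses truncated subtraction, and \<open>N \<ge> 1\<close> ensures
    that 2N - 1 is the true predecessor of 2N.\<close>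
  have "(q ^ N)\<^sup>2 = q ^ Suc (2 * N - 1)"
    using N by (simp add: power_mult[symmetric] mult.commute del: power_Suc)
  then have "(q ^ N)\<^sup>2 * inverse q = q ^ (2 * N - 1)" using q by simp
  \<comment> \<open>At a = q^N the base q/a of the rotation factor becomes a power of
    \<open>q\<close>, so the two integer powers can be multiplied.\<close>
  moreover have "inverse (q ^ N) * q = q powi (- (int N - 1))"
    using q by (simp add: power_int_diff divide_simps)
  ultimately show "P D q (q ^ (2 * N - 1)) = (\<Sum>E\<in>\<O> D. \<Sum>\<sigma>\<in>\<Sigma>\<^sub>r E.
                 q powi (- (int N - 1) * rot (resolve E \<sigma>)) * weight q \<sigma> * R (resolve E \<sigma>) q (q ^ N))"
    using state_sum_formula[OF assms gen] by (simp add: power_int_mult)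
qed

end
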